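(* Let $f:\mathbb T^n\to\mathbb T^n$ be a hyperbolic toral automorphism, $V$ a $C^2$ unit vector field on $\mathbb T^n$, $\epsilon>0$, and let $\mathcal F$ be the rank 1 random perturbation of $f$ of size $\epsilon$ along $V$. Assume that $V$ has no tangential coincidences with the stable foliation of $f$, nor with any of the foliations $\mathfrak F_G$, where $G$ ranges over all proper compact toral subgroups of $\mathbb T^n$ that are invariant under some power of $f$. Assume further that there exists $x\in\mathbb T^n$ with $n(x)<\infty$. Then all the invariant measures of $\mathcal F$ are absolutely continuous with respect to the Riemannian measure $m$ on $\mathbb T^n$.
   Context: $\mathbb T^n=\mathbb R^n/\mathbb Z^n$ with its standard flat metric; $\pi:\mathbb R^n\to\mathbb T^n$ is the quotient map; $E^s\subset\mathbb R^n$ is the stable subspace of the matrix inducing $f$; the stable foliation is the projection of the foliation of $\mathbb R^n$ by translates of $E^s$. For $x\in\mathbb T^n$, $I_\epsilon(x)$ is the arc through $x$ of the integral curve of $V$, namely the maximal connected piece containing $x$ all of whose points are at Riemannian distance $\le\epsilon$ from $x$. $Q_x$ is the uniform distribution (normalized one-dimensional Riemannian measure) on $I_\epsilon(x)$. The rank 1 random perturbation $\mathcal F$ of $f$ is the Markov chain with transition probabilities $P(\cdot|x)=Q_{f(x)}$. An invariant measure of $\mathcal F$ is a Borel probability measure $\mu$ with $\int P(A|x)\,d\mu(x)=\mu(A)$ for all Borel $A$. $n_0(x)$ is the minimum $k\ge 1$ such that $Df^{k-1}_{fx}(V(fx)), Df^{k-2}_{f^2x}(V(f^2x)),\dots, Df_{f^{k-1}x}(V(f^{k-1}x)),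 V(f^kx)$ span the whole $n$-dimensional tangent space at $f^kx$; $n_0(x)=\infty$ if there is no such $k$. Define $H_0(x)=\{x\}$, $H_k(x)=\bigcup_{y\in H_{k-1}(x)} I_\epsilon(f(y))$ for $k\ge1$. Then $n(x)$ is the minimum of $n_0(y)+k$ over all $k\ge 0$ and $y\in H_k(x)$, with $n(x)=\infty$ if $n_0(y)=\infty$ for all $y\in\bigcup_k H_k(x)$. Tangential coincidence: a vector field $V$ has a tangential coincidence with a foliation if there exists a (nondegenerate) curve along the flow of $V$ that is fully contained in a single leaf. Foliation $\mathfrak F_G$: given a proper compact toral subgroup $G$ of $\mathbb T^n$ invariant under some power $f^k$ ($k\ge1$), let $W\subset\mathbb R^n$ be the linear subspace with $\pi(W)=G$; $\mathfrak F_G$ is the projection under $\pi$ of the foliation of $\mathbb R^n$ by the affine planes parallel to $\mathrm{Span}(W\cup E^s)$. *)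

theory Defs
  imports "HOL-Probability.Probability"
begin

section \<open>The flat torus\<close>

quotient_type 'n torus = "real ^ ('n::finite)" / "\<lambda>x y. \<forall>i. x $ i - y $ i \<in> \<int>"
  morphisms of_torus to_torus
proof (rule equivpI)
  show "reflp (\<lambda>x y::real^'n. \<forall>i. x $ i - y $ i \<in> \<int>)"
    by (auto intro: reflpI)
  show "symp (\<lambda>x y::real^'n. \<forall>i. x $ i - y $ i \<in> \<int>)"
    by (intro sympI) (metis Ints_minus minus_diff_eq)
  show "transp (\<lambda>x y::real^'n. \<forall>i. x $ i - y $ i \<in> \<int>)"
  proof (intro transpI allI)
    fix x y z :: "real^'n" and i
    assume "\<forall>i. x $ i - y $ i \<in> \<int>" "\<forall>i. y $ i - z $ i \<in> \<int>"
    then have "(x $ i - y $ i) + (y $ i - z $ i) \<in> \<int>" by (intro Ints_add) auto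
    then show "x $ i - z $ i \<in> \<int>" by simp
  qed
qed

lemma to_torus_eq_iff: "to_torus a = to_torus b \<longleftrightarrow> (\<forall>i. a $ i - b $ i \<in> \<int>)"
  by (rule torus.abs_eq_iff)

lemma to_torus_surj: "\<exists>v. to_torus v = x"
  by (induct x rule: torus.abs_induct) auto

instantiation torus :: (finite) ab_group_add
begin

lift_definition zero_torus :: "'a torus" is "0 :: real^'a" .

lift_definition plus_torus :: "'a torus \<Rightarrow> 'a torus \<Rightarrow> 'a torus"
  is "(+) :: real^'a \<Rightarrow> real^'a \<Rightarrow> real^'a"
proof -
  fix a b c d :: "real^'a" and i
  assume "\<And>i. a $ i - b $ i \<in> \<int>" "\<And>i. c $ i - d $ i \<in> \<int>"
  then have "(a $ i - b $ i) + (c $ i - d $ i) \<in> \<int>" by (intro Ints_add)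
  then show "(a + c) $ i - (b + d) $ i \<in> \<int>" by (simp add: algebra_simps)
qed

lift_definition uminus_torus :: "'a torus \<Rightarrow> 'a torus" is "uminus :: real^'a \<Rightarrow> real^'a"
proof -
  fix a b :: "real^'a" and i
  assume "\<And>i. a $ i - b $ i \<in> \<int>"
  then have "- (a $ i - b $ i) \<in> \<int>" by (intro iffD2[OF minus_in_Ints_iff])
  then show "(- a) $ i - (- b) $ i \<in> \<int>" by simp
qed

lift_definition minus_torus :: "'a torus \<Rightarrow> 'a torus \<Rightarrow> 'a torus"
  is "(-) :: real^'a \<Rightarrow> real^'a \<Rightarrow> real^'a"
proof -
  fix a b c d :: "real^'a" and i
  assume "\<And>i. a $ i - b $ i \<in> \<int>" "\<And>i. c $ i - d $ i \<in> \<int>"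
  then have "(a $ i - b $ i) - (c $ i - d $ i) \<in> \<int>" by (rule Ints_diff)
  then show "(a - c) $ i - (b - d) $ i \<in> \<int>" by (simp add: algebra_simps)
qed

instance
proof
  fix a b c :: "'a torus"
  show "a + b + c = a + (b + c)" by transfer (simp add: algebra_simps)
  show "a + b = b + a" by transfer (simp add: algebra_simps)
  show "0 + a = a" by transfer simp
  show "- a + a = 0" by transfer simp
  show "a - b = a + - b" by transfer simp
qed

end

instantiation torus :: (finite) metric_space
begin

definition dist_torus :: "'a torus \<Rightarrow> 'a torus \<Rightarrow> real" where
  "dist_torus x y = Inf {dist a b | a b. to_torus a = x \<and> to_torus b = y}"

definition uniformity_torus :: "('a torus \<times> 'a torus) filter" where
  "uniformity_torus = (INF e\<in>{0<..}. principal {(x, y). dist x y < e})"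

definition open_torus :: "'a torus set \<Rightarrow> bool" where
  "open_torus U = (\<forall>x\<in>U. eventually (\<lambda>(x', y). x' = x \<longrightarrow> y \<in> U) uniformity)"

instance
proof
  have bdd: "bdd_below {dist a b | a b. to_torus a = x \<and> to_torus b = y}" for x y :: "'a torus"
    by (rule bdd_belowI[of _ 0]) auto
  have ne: "{dist a b | a b. to_torus a = x \<and> to_torus b = y} \<noteq> {}" for x y :: "'a torus"
    using to_torus_surj[of x] to_torus_surj[of y] by auto
  have le: "dist (to_torus a) (to_torus b) \<le> dist a b" for a b :: "real^'a"
    unfolding dist_torus_def by (rule cInf_lower[OF _ bdd]) auto
  have approx: "\<exists>a b. to_torus a = x \<and> to_torus b = y \<and> dist a b < dist x y + e"
    if "e > 0" for x y :: "'a torus" and e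
    using cInf_lessD[OF ne, of x y "dist x y + e"] that unfolding dist_torus_def by auto
  have nonneg: "0 \<le> dist x y" for x y :: "'a torus"
    unfolding dist_torus_def by (rule cInf_greatest[OF ne]) auto
  have comm: "dist x y = dist y x" for x y :: "'a torus"
  proof -
    have "{dist a b | a b. to_torus a = x \<and> to_torus b = y}
        = {dist a b | a b. to_torus a = y \<and> to_torus b = x}"
      by (metis dist_commute)
    then show ?thesis by (simp add: dist_torus_def)
  qed
  have tri: "dist x z \<le> dist x y + dist y z" for x y z :: "'a torus"
  proof (rule field_le_epsilon)
    fix e :: real assume "e > 0"
    then obtain a b where ab: "to_torus a = x" "to_torus b = y" "dist a b < dist x y + e/2"
      using approx[of "e/2" x y] by auto
    obtain b' c where bc: "to_torus b' = y" "to_torus c = z" "dist b' c < dist y z + e/2"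
      using \<open>e > 0\<close> approx[of "e/2" y z] by auto
    have "\<forall>i. b' $ i - b $ i \<in> \<int>" using ab(2) bc(1) to_torus_eq_iff by metis
    then have "- (b' $ i - b $ i) \<in> \<int>" for i by (intro iffD2[OF minus_in_Ints_iff]) auto
    then have "to_torus (c - (b' - b)) = to_torus c"
      unfolding to_torus_eq_iff by simp
    then have "dist x z \<le> dist a (c - (b' - b))" using le[of a "c - (b' - b)"] ab bc by simp
    also have "\<dots> \<le> dist a b + dist b (c - (b' - b))" by (rule dist_triangle)
    also have "dist b (c - (b' - b)) = dist b' c" by (simp add: dist_norm algebra_simps)
    finally show "dist x z \<le> dist x y + dist y z + e" using ab bc by linarith
  qed
  fix x y z :: "'a torus"
  show "dist x y \<le> dist x z + dist y z" using tri[of x y z] comm[of y z] by simp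
  show "(dist x y = 0) = (x = y)"
  proof
    assume "x = y"
    obtain a where "to_torus a = x" using to_torus_surj by blast
    then show "dist x y = 0" using le[of a a] nonneg[of x x] \<open>x = y\<close> by simp
  next
    assume d0: "dist x y = 0"
    show "x = y"
    proof (rule ccontr)
      assume "x \<noteq> y"
      obtain a0 b0 where ab0: "to_torus a0 = x" "to_torus b0 = y" using to_torus_surj by metis
      then obtain i where i: "a0 $ i - b0 $ i \<notin> \<int>" using \<open>x \<noteq> y\<close> to_torus_eq_iff by metis
      define r where "r = a0 $ i - b0 $ i"
      define e where "e = min (frac r) (1 - frac r)"
      have "e > 0" using i frac_lt_1[of r] frac_ge_0[of r] frac_eq_0_iff[of r]
        unfolding e_def r_def by auto
      then obtain a b where ab: "to_torus a = x" "to_torus b = y" "dist a b < e"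
        using approx[of e x y] d0 by auto
      have "a $ i - a0 $ i \<in> \<int>" "b $ i - b0 $ i \<in> \<int>"
        using ab ab0 to_torus_eq_iff by metis+
      then have "(a $ i - a0 $ i) - (b $ i - b0 $ i) + of_int \<lfloor>r\<rfloor> \<in> \<int>"
        by (intro Ints_add[OF Ints_diff Ints_of_int])
      then obtain m where "(a $ i - a0 $ i) - (b $ i - b0 $ i) + of_int \<lfloor>r\<rfloor> = of_int m"
        by (rule Ints_cases)
      then have m: "a $ i - b $ i = frac r + of_int m" unfolding r_def frac_def by linarith
      have "\<bar>a $ i - b $ i\<bar> \<le> dist a b"
        using component_le_norm_cart[of "a - b" i] by (simp add: dist_norm)
      then have lt: "\<bar>frac r + of_int m\<bar> < min (frac r) (1 - frac r)"
        using ab(3) m e_def by simp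
      show False
      proof (cases "m \<ge> 0")
        case True
        then have "(of_int m :: real) \<ge> 0" by simp
        then show False using lt frac_ge_0[of r] by linarith
      next
        case False
        then have "m \<le> -1" by simp
        then have "(of_int m :: real) \<le> -1" by linarith
        then show False using lt frac_lt_1[of r] by linarith
      qed
    qed
  qed
qed (rule uniformity_torus_def open_torus_def)+

end

lemma dist_to_torus_le: "dist (to_torus a) (to_torus b) \<le> dist a b"
  unfolding dist_torus_def by (rule cInf_lower) (auto intro: bdd_belowI[of _ 0])

lemma continuous_on_to_torus: "continuous_on S to_torus"
  unfolding continuous_on_iff by (meson dist_to_torus_le le_less_trans)

text \<open>Riemannian volume: the image of Lebesgue measure on the fundamental domain.\<close>

definition torus_measure :: "('n::finite) torus measure" where
  "torus_measure =
     distr (restrict_space lborel {v :: real^'n. \<forall>i. 0 \<le> v $ i \<and> v $ i < 1}) borel to_torus"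

section \<open>Hyperbolic toral automorphisms\<close>

definition complex_eigenvalue :: "real^'n^'n \<Rightarrow> complex \<Rightarrow> bool" where
  "complex_eigenvalue A l \<longleftrightarrow>
     (\<exists>v :: complex^'n. v \<noteq> 0 \<and> (\<chi> i j. complex_of_real (A $ i $ j)) *v v = l *s v)"

definition hyperbolic_toral_automorphism ::
    "real^'n^'n \<Rightarrow> (('n::finite) torus \<Rightarrow> 'n torus) \<Rightarrow> bool" where
  "hyperbolic_toral_automorphism A f \<longleftrightarrow>
     (\<forall>i j. A $ i $ j \<in> \<int>) \<and> \<bar>det A\<bar> = 1 \<and>
     (\<forall>l. complex_eigenvalue A l \<longrightarrow> cmod l \<noteq> 1) \<and>
     (\<forall>v. f (to_torus v) = to_torus (A *v v))"

definition stable_subspace :: "real^'n^'n \<Rightarrow> (real^'n) set" where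
  "stable_subspace A = {v. (\<lambda>k. (((*v) A) ^^ k) v) \<longlonglongrightarrow> 0}"

text \<open>
  The tangent bundle of the torus is trivialised by the projection, so tangent vectors are elements
  of \<open>real^'n\<close> and the differential of a torus map at a point is the derivative of a lift.
\<close>

definition torus_differential ::
    "(('n::finite) torus \<Rightarrow> 'n torus) \<Rightarrow> 'n torus \<Rightarrow> real^'n \<Rightarrow> real^'n" where
  "torus_differential g x =
     (THE D. \<exists>F v. to_torus v = x \<and> (\<forall>w. to_torus (F w) = g (to_torus w)) \<and>
                   (F has_derivative D) (at v))"

lemma torus_differential_linear:
  fixes A :: "real^('n::finite)^'n"
  assumes g: "\<And>v. g (to_torus v) = to_torus (A *v v)"
  shows "torus_differential g x = (*v) A"
  unfolding torus_differential_def
proof (rule the_equality)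
  have L: "((*v) A has_derivative (*v) A) (at v)" for v
    by (intro linear_imp_has_derivative) simp
  obtain v where "to_torus v = x" using to_torus_surj by blast
  then show "\<exists>F v. to_torus v = x \<and> (\<forall>w. to_torus (F w) = g (to_torus w)) \<and>
                   (F has_derivative (*v) A) (at v)"
    using L g by (intro exI[of _ "(*v) A"] exI[of _ v]) auto
  fix D assume "\<exists>F v. to_torus v = x \<and> (\<forall>w. to_torus (F w) = g (to_torus w)) \<and>
                      (F has_derivative D) (at v)"
  then obtain F v where F: "\<And>w. to_torus (F w) = to_torus (A *v w)" "(F has_derivative D) (at v)"
    using g by auto
  define G where "G w = F w - A *v w" for w
  have G': "(G has_derivative (\<lambda>h. D h - A *v h)) (at v)"
    unfolding G_def by (intro has_derivative_diff F L)
  then have "isCont G v" by (rule has_derivative_continuous)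
  then have "(G \<longlongrightarrow> G v) (nhds v)" by (simp add: continuous_at tendsto_at_iff_tendsto_nhds)
  then have "eventually (\<lambda>w. dist (G w) (G v) < 1) (nhds v)" by (rule tendstoD) simp
  moreover have "G w = G v" if "dist (G w) (G v) < 1" for w
  proof (subst vec_eq_iff, rule allI)
    fix i
    have "F w $ i - (A *v w) $ i \<in> \<int>" "F v $ i - (A *v v) $ i \<in> \<int>"
      using F(1) to_torus_eq_iff by blast+
    then have Z: "G w $ i - G v $ i \<in> \<int>" unfolding G_def by (simp add: Ints_diff)
    have "\<bar>G w $ i - G v $ i\<bar> < 1"
      using that component_le_norm_cart[of "G w - G v" i] by (simp add: dist_norm)
    then show "G w $ i = G v $ i" using Z Ints_nonzero_abs_less1 by force
  qed
  ultimately have "eventually (\<lambda>w. G w = G v) (nhds v)" by (rule eventually_mono) blast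
  then have "eventually (\<lambda>w. G w = G v) (at v)" by (simp add: eventually_at_filter eventually_mono)
  then have "((\<lambda>w. G v) has_derivative (\<lambda>h. D h - A *v h)) (at v)"
    using has_derivative_transform_eventually[OF G'] by simp
  then have "(\<lambda>h. D h - A *v h) = (\<lambda>h. 0)"
    by (rule has_derivative_unique) simp
  then have "D h - A *v h = 0" for h by (rule fun_cong)
  then show "D = (*v) A" by (intro ext) simp
qed

section \<open>Vector fields, their arcs, and the random perturbation\<close>

definition C2 :: "('a::real_normed_vector \<Rightarrow> 'b::real_normed_vector) \<Rightarrow> bool" where
  "C2 F \<longleftrightarrow> (\<exists>F' :: 'a \<Rightarrow> 'a \<Rightarrow>\<^sub>L 'b. \<exists>F'' :: 'a \<Rightarrow> 'a \<Rightarrow>\<^sub>L 'a \<Rightarrow>\<^sub>L 'b.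
     (\<forall>x. (F has_derivative blinfun_apply (F' x)) (at x)) \<and>
     (\<forall>x. (F' has_derivative blinfun_apply (F'' x)) (at x)) \<and>
     continuous_on UNIV F'')"

definition C2_unit_vector_field :: "(('n::finite) torus \<Rightarrow> real^'n) \<Rightarrow> bool" where
  "C2_unit_vector_field V \<longleftrightarrow> C2 (\<lambda>v. V (to_torus v)) \<and> (\<forall>x. norm (V x) = 1)"

definition integral_curve ::
    "(('n::finite) torus \<Rightarrow> real^'n) \<Rightarrow> (real \<Rightarrow> 'n torus) \<Rightarrow> bool" where
  "integral_curve V g \<longleftrightarrow>
     (\<exists>c. (\<forall>t. g t = to_torus (c t)) \<and> (\<forall>t. (c has_vector_derivative V (g t)) (at t)))"

definition flow_line :: "(('n::finite) torus \<Rightarrow> real^'n) \<Rightarrow> 'n torus \<Rightarrow> real \<Rightarrow> 'n torus" where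
  "flow_line V x = (THE g. integral_curve V g \<and> g 0 = x)"

text \<open>
  Connectedness of an arc is understood along the integral curve, i.e. in the time parameter
  (a dense orbit meets a ball in infinitely many distinct pieces).
\<close>

definition arc_times :: "(('n::finite) torus \<Rightarrow> real^'n) \<Rightarrow> real \<Rightarrow> 'n torus \<Rightarrow> real set" where
  "arc_times V \<epsilon> x = connected_component_set {t. dist (flow_line V x t) x \<le> \<epsilon>} 0"

definition flow_arc :: "(('n::finite) torus \<Rightarrow> real^'n) \<Rightarrow> real \<Rightarrow> 'n torus \<Rightarrow> 'n torus set" where
  "flow_arc V \<epsilon> x = flow_line V x ` arc_times V \<epsilon> x"

text \<open>
  The field has unit length, so one-dimensional Riemannian measure on an arc is Lebesgue measure in
  the time parameter, provided each point of the arc is counted once. The condition on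
  \<open>\<bar>t\<bar>\<close> takes care of this: it only matters if the arc is a whole periodic orbit, of minimal
  period \<open>T\<close> say, where it selects the times in \<open>[-T/2, T/2]\<close>.
  If the arc has infinite length, it carries no uniform distribution, and \<open>uniform_measure\<close>
  is the zero measure.
\<close>

definition uniform_on_arc ::
    "(('n::finite) torus \<Rightarrow> real^'n) \<Rightarrow> real \<Rightarrow> 'n torus \<Rightarrow> 'n torus measure" where
  "uniform_on_arc V \<epsilon> x =
     distr (uniform_measure lborel
              {t \<in> arc_times V \<epsilon> x.
                 \<forall>s \<in> arc_times V \<epsilon> x. flow_line V x s = flow_line V x t \<longrightarrow> \<bar>t\<bar> \<le> \<bar>s\<bar>})
           borel (flow_line V x)"

definition rank1_perturbation ::
    "(('n::finite) torus \<Rightarrow> 'n torus) \<Rightarrow> ('n torus \<Rightarrow> real^'n) \<Rightarrow> real \<Rightarrow> 'n torus \<Rightarrow> 'n torus measure"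
    where
  "rank1_perturbation f V \<epsilon> x = uniform_on_arc V \<epsilon> (f x)"

definition invariant_measure :: "('a::topological_space \<Rightarrow> 'a measure) \<Rightarrow> 'a measure \<Rightarrow> bool" where
  "invariant_measure P \<mu> \<longleftrightarrow> prob_space \<mu> \<and> sets \<mu> = sets borel \<and>
     (\<forall>A \<in> sets borel. (\<integral>\<^sup>+ x. emeasure (P x) A \<partial>\<mu>) = emeasure \<mu> A)"

section \<open>The spanning times\<close>

definition spanning_time0 ::
    "(('n::finite) torus \<Rightarrow> 'n torus) \<Rightarrow> ('n torus \<Rightarrow> real^'n) \<Rightarrow> 'n torus \<Rightarrow> enat" where
  "spanning_time0 f V x =
     (INF k \<in> {k. k \<ge> 1 \<and>
                  span ((\<lambda>j. torus_differential (f ^^ (k - j)) ((f ^^ j) x) (V ((f ^^ j) x))) ` {1..k})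
                    = UNIV}. enat k)"

primrec reach ::
    "(('n::finite) torus \<Rightarrow> 'n torus) \<Rightarrow> ('n torus \<Rightarrow> real^'n) \<Rightarrow> real \<Rightarrow> 'n torus \<Rightarrow> nat
      \<Rightarrow> 'n torus set" where
  "reach f V \<epsilon> x 0 = {x}"
| "reach f V \<epsilon> x (Suc k) = (\<Union>y \<in> reach f V \<epsilon> x k. flow_arc V \<epsilon> (f y))"

definition spanning_time ::
    "(('n::finite) torus \<Rightarrow> 'n torus) \<Rightarrow> ('n torus \<Rightarrow> real^'n) \<Rightarrow> real \<Rightarrow> 'n torus \<Rightarrow> enat" where
  "spanning_time f V \<epsilon> x = (INF k. INF y \<in> reach f V \<epsilon> x k. spanning_time0 f V y + enat k)"

section \<open>Linear foliations and tangential coincidences\<close>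

text \<open>A foliation is represented by the set of its leaves.\<close>

definition linear_foliation :: "(real^'n) set \<Rightarrow> ('n::finite) torus set set" where
  "linear_foliation E = range (\<lambda>v. to_torus ` ((+) v ` E))"

definition tangential_coincidence ::
    "(('n::finite) torus \<Rightarrow> real^'n) \<Rightarrow> 'n torus set set \<Rightarrow> bool" where
  "tangential_coincidence V \<F> \<longleftrightarrow>
     (\<exists>g a b. \<exists>L\<in>\<F>. integral_curve V g \<and> a < b \<and> g ` {a..b} \<subseteq> L)"

definition stable_foliation :: "real^'n^'n \<Rightarrow> ('n::finite) torus set set" where
  "stable_foliation A = linear_foliation (stable_subspace A)"

definition toral_subgroup :: "('n::finite) torus set \<Rightarrow> bool" where
  "toral_subgroup G \<longleftrightarrow> compact G \<and> connected G \<and> 0 \<in> G \<and> (\<forall>x\<in>G. \<forall>y\<in>G. x - y \<in> G)"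

end

theory Submission
  imports Defs "HOL-Computational_Algebra.Fundamental_Theorem_Algebra"
begin

text \<open>
  If \<open>\<mu>\<close> is not absolutely continuous, maximality of a null set of positive measure yields a
  nonempty null set \<open>S\<close> that the chain cannot leave: if \<open>x\<close> is in \<open>S\<close>, so is almost every
  point of the arc through \<open>f x\<close>.

  Such an \<open>S\<close> is dense, because the forward orbit of every arc \<open>c\<close> of \<open>V\<close> is dense. Indeed let
  \<open>B = A ^ m\<close> with \<open>m\<close> chosen so that no ratio of distinct eigenvalues of \<open>B\<close> is a root of
  unity. For an integer frequency \<open>\<xi> \<noteq> 0\<close> the vectors \<open>v\<close> with \<open>\<xi> \<bullet> B^k v \<rightarrow> 0\<close> lie in
  \<open>W + E^s\<close>, where \<open>W = {v. \<forall>k. \<xi> \<bullet> B^k v = 0}\<close> projects onto an invariant toral subgroup; as \<open>V\<close>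
  has no tangential coincidence with the corresponding foliation, \<open>\<xi> \<bullet> B^k c'\<close> grows exponentially
  on some subarc, for most \<open>k\<close>, and \<open>exp (2 \<pi> i \<xi> \<bullet> B^k c)\<close> has mean tending to zero there
  (in the sense of Cesaro). Testing against a trigonometric polynomial that is very small outside a
  given open set involves finitely many \<open>\<xi>\<close> only.

  Finally, near a point with finite spanning time a few steps of the chain fill, for almost every
  choice of the times, a neighbourhood of full dimension, so that \<open>S\<close> is not null.
\<close>

section \<open>Linear recurrences\<close>

text \<open>The obstacle to growth is cancellation between eigenvalues of equal modulus. If
  \<lambda> and -\<lambda> both occur, \<xi> \<bullet> B^k c' may vanish along an arithmetic
  progression, whence the power m. Even without such ratios it may be small for infinitely many k,
  and these k change with the point of the arc; so pointwise lower bounds give way to a bound on the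
  density of bad k, uniform on a subarc, and convergence to Cesaro means. Jordan blocks are never
  computed: everything is expressed by scalar recurrences given by lists of roots with multiplicity.
  The same recurrence bounds the second derivative of the phase by \<rho>^k with \<rho> below the
  square of the growth rate, which is what integration by parts tolerates. The trigonometric
  polynomial works because, as its degree M grows, its mean decays like a power of 1/M, while off a
  neighbourhood of its centre it decays exponentially. In the last step S is only dense and a time
  is admissible only almost surely, so neither starting point nor times can be prescribed exactly.
  Charts are therefore handled up to an arbitrarily small Lipschitz error.\<close>

definition sdiff :: "complex \<Rightarrow> (nat \<Rightarrow> complex) \<Rightarrow> nat \<Rightarrow> complex" where
  "sdiff z s k = s (Suc k) - z * s k"

text \<open>With E the shift, this applies the product of the factors E - z to s. Thus
  \<open>sdiffs zs s = (\<lambda>_. 0)\<close> is the linear recurrence with characteristic roots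
  zs, a repeated entry being a multiple root.\<close>

definition sdiffs :: "complex list \<Rightarrow> (nat \<Rightarrow> complex) \<Rightarrow> nat \<Rightarrow> complex" where
  "sdiffs zs = fold sdiff zs"

lemma sdiffs_simps [simp]:
  "sdiffs [] s = s" "sdiffs (z # zs) s = sdiffs zs (sdiff z s)"
  by (simp_all add: sdiffs_def)

lemma sdiff_commute: "sdiff a (sdiff b s) = sdiff b (sdiff a s)"
  by (auto simp: sdiff_def fun_eq_iff algebra_simps)

lemma sdiffs_sdiff: "sdiffs zs (sdiff a s) = sdiff a (sdiffs zs s)"
  by (induction zs arbitrary: s) (simp_all, metis sdiff_commute)

lemma sdiffs_remove1:
  assumes "z \<in> set zs"
  shows "sdiffs zs s = sdiffs (remove1 z zs) (sdiff z s)"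
proof -
  have "fold sdiff zs = fold sdiff (remove1 z zs) \<circ> sdiff z"
    by (rule fold_remove1_split[OF _ assms]) (auto simp: fun_eq_iff sdiff_commute)
  then show ?thesis by (simp add: sdiffs_def)
qed

lemma sdiff_zero [simp]: "sdiff z (\<lambda>_. 0) = (\<lambda>_. 0)"
  by (simp add: sdiff_def fun_eq_iff)

lemma sdiffs_zero [simp]: "sdiffs zs (\<lambda>_. 0) = (\<lambda>_. 0)"
  by (induction zs) simp_all

lemma sdiff_eq_0_geometric:
  assumes "sdiff z s = (\<lambda>_. 0)"
  shows "s k = z ^ k * s 0"
proof (induction k)
  case (Suc k)
  have "s (Suc k) = z * s k" using fun_cong[OF assms, of k] by (simp add: sdiff_def)
  then show ?case using Suc by simp
qed simp

text \<open>A multiple root brings in a polynomial factor in k; the strict inequality cmod z <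
  \<rho> absorbs it, one factor of the recurrence at a time. C is chosen before s, which later makes
  bounds uniform along an arc.\<close>

lemma sdiffs_bound:
  assumes "\<forall>z\<in>set zs. cmod z < \<rho>" "\<rho> > 0"
  shows "\<exists>C\<ge>0. \<forall>s M. M \<ge> 0 \<longrightarrow> sdiffs zs s = (\<lambda>_. 0) \<longrightarrow> (\<forall>i<length zs. cmod (s i) \<le> M) \<longrightarrow>
           (\<forall>k. cmod (s k) \<le> C * M * \<rho> ^ k)"
  using assms(1)
proof (induction zs)
  case Nil
  then show ?case by (intro exI[of _ 0]) auto
next
  case (Cons z zs)
  then obtain C where C: "C \<ge> 0" and IH: "\<And>s M k. M \<ge> 0 \<Longrightarrow> sdiffs zs s = (\<lambda>_. 0) \<Longrightarrow>
      (\<forall>i<length zs. cmod (s i) \<le> M) \<Longrightarrow> cmod (s k) \<le> C * M * \<rho> ^ k"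
    by auto
  have z: "cmod z < \<rho>" using Cons.prems by simp
  \<comment> \<open>Chosen so that C (1 + cmod z) + cmod z C' \<le> C' \<rho>, which closes the
    recursion s (k + 1) = sdiff z s k + z s k; the 1 covers k = 0.\<close>
  define C' where "C' = max 1 (C * (1 + cmod z) / (\<rho> - cmod z))"
  have C': "C * (1 + cmod z) \<le> C' * (\<rho> - cmod z)" "C' \<ge> 1"
    using z by (auto simp: C'_def max_def field_simps)
  have "cmod (s k) \<le> C' * M * \<rho> ^ k"
    if M: "M \<ge> 0" and s: "sdiffs (z # zs) s = (\<lambda>_. 0)"
      and i: "\<forall>i<length (z # zs). cmod (s i) \<le> M" for s M k
  proof (induction k)
    case 0
    have "cmod (s 0) \<le> 1 * M" using i by auto
    also have "\<dots> \<le> C' * M" by (intro mult_right_mono C' M)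
    finally show ?case by simp
  next
    case (Suc k)
    have "cmod (sdiff z s i) \<le> (1 + cmod z) * M" if "i < length zs" for i
    proof -
      have "cmod (sdiff z s i) \<le> cmod (s (Suc i)) + cmod z * cmod (s i)"
        unfolding sdiff_def by (metis norm_mult norm_triangle_ineq4)
      also have "\<dots> \<le> M + cmod z * M"
        using i that by (intro add_mono mult_left_mono) auto
      finally show ?thesis by (simp add: algebra_simps)
    qed
    then have "cmod (sdiff z s k) \<le> C * ((1 + cmod z) * M) * \<rho> ^ k"
      using s M by (intro IH) auto
    also have "\<dots> = (C * (1 + cmod z)) * (M * \<rho> ^ k)" by simp
    also have "\<dots> \<le> (C' * (\<rho> - cmod z)) * (M * \<rho> ^ k)"
      using M assms by (intro mult_right_mono C') auto
    finally have 1: "cmod (sdiff z s k) \<le> (C' * (\<rho> - cmod z)) * (M * \<rho> ^ k)" .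
    have "s (Suc k) = sdiff z s k + z * s k" by (simp add: sdiff_def)
    then have "cmod (s (Suc k)) \<le> cmod (sdiff z s k) + cmod z * cmod (s k)"
      by (metis norm_mult norm_triangle_ineq)
    also have "\<dots> \<le> (C' * (\<rho> - cmod z)) * (M * \<rho> ^ k) + cmod z * (C' * M * \<rho> ^ k)"
      by (intro add_mono 1 mult_left_mono Suc) auto
    finally show ?case by (simp add: algebra_simps)
  qed
  then show ?case using C' by (intro exI[of _ C']) auto
qed

lemma sdiffs_eq_0_tendsto_0:
  assumes "sdiffs zs s = (\<lambda>_. 0)" "\<forall>z\<in>set zs. cmod z < 1"
  shows "s \<longlonglongrightarrow> 0"
proof -
  define R where "R = Max (insert 0 (cmod ` set zs))"
  define \<rho> where "\<rho> = (1 + R) / 2"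
  have R: "R \<ge> 0" "\<And>z. z \<in> set zs \<Longrightarrow> cmod z \<le> R" by (auto simp: R_def)
  have "R \<in> insert 0 (cmod ` set zs)" unfolding R_def by (intro Max_in) auto
  then have R1: "R < 1" using assms(2) by auto
  have \<rho>: "\<forall>z\<in>set zs. cmod z < \<rho>" "\<rho> > 0" "\<rho> < 1"
    using R R1 unfolding \<rho>_def by (fastforce simp: field_simps)+
  define M where "M = Max (insert 0 ((\<lambda>i. cmod (s i)) ` {..<length zs}))"
  have M: "M \<ge> 0" "\<forall>i<length zs. cmod (s i) \<le> M" by (auto simp: M_def)
  obtain C where "\<And>k. cmod (s k) \<le> C * M * \<rho> ^ k"
    using sdiffs_bound[OF \<rho>(1,2)] M assms(1) by blast
  moreover have "(\<lambda>k. C * M * \<rho> ^ k) \<longlonglongrightarrow> 0"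
    using \<rho> by (intro tendsto_mult_right_zero LIMSEQ_realpow_zero) auto
  ultimately show ?thesis
    by (intro Lim_null_comparison[of s "\<lambda>k. C * M * \<rho> ^ k"]) auto
qed

lemma sdiff_tendsto_0:
  assumes "s \<longlonglongrightarrow> 0" shows "sdiff z s \<longlonglongrightarrow> 0"
proof -
  have "(\<lambda>k. s (Suc k) - z * s k) \<longlonglongrightarrow> 0 - z * 0"
    by (intro tendsto_intros LIMSEQ_Suc assms)
  then show ?thesis by (simp add: sdiff_def[abs_def])
qed

text \<open>After one factor is applied the sequence still tends to 0, so it vanishes by induction.
  Then s is geometric with a ratio outside the unit disc, and only the zero sequence of this kind
  tends to 0.\<close>

lemma sdiffs_expanding_eq_0:
  assumes "sdiffs zs s = (\<lambda>_. 0)" "\<forall>z\<in>set zs. cmod z > 1" "s \<longlonglongrightarrow> 0"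
  shows "s = (\<lambda>_. 0)"
  using assms
proof (induction zs arbitrary: s)
  case (Cons z zs)
  have "sdiff z s = (\<lambda>_. 0)" 
  proof (rule Cons.IH)
    show "sdiffs zs (sdiff z s) = (\<lambda>_. 0)" using Cons.prems(1) by simp
    show "\<forall>z\<in>set zs. 1 < cmod z" using Cons.prems(2) by simp
    show "sdiff z s \<longlonglongrightarrow> 0" by (rule sdiff_tendsto_0) (rule Cons.prems(3))
  qed
  then have g: "s k = z ^ k * s 0" for k by (rule sdiff_eq_0_geometric)
  have "s 0 = 0"
  proof (rule ccontr)
    assume "s 0 \<noteq> 0"
    have "cmod (s 0) \<le> cmod (s k)" for k
    proof -
      have "1 * cmod (s 0) \<le> cmod z ^ k * cmod (s 0)"
        using Cons.prems by (intro mult_right_mono one_le_power) auto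
      then show ?thesis by (metis g mult_1 norm_mult norm_power)
    qed
    then have "cmod (s 0) \<le> 0"
      using tendsto_norm[OF Cons.prems(3)] by (intro LIMSEQ_le_const) auto
    then show False using \<open>s 0 \<noteq> 0\<close> by simp
  qed
  show ?case
  proof
    fix k show "s k = 0" using g[of k] \<open>s 0 = 0\<close> by simp
  qed
qed simp

lemma sdiffs_initial_zero:
  assumes "sdiffs zs s = (\<lambda>_. 0)" "\<forall>i<length zs. s i = 0"
  shows "s k = 0"
proof -
  define \<rho> where "\<rho> = Max (insert 0 (cmod ` set zs)) + 1"
  have \<rho>: "\<forall>z\<in>set zs. cmod z < \<rho>" "\<rho> > 0"
  proof -
    have "cmod z \<le> Max (insert 0 (cmod ` set zs))" if "z \<in> set zs" for z
      using that by (intro Max_ge) auto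
    then show "\<forall>z\<in>set zs. cmod z < \<rho>"
      unfolding \<rho>_def by (intro ballI le_less_trans[OF _ less_add_one])
    have "0 \<le> Max (insert 0 (cmod ` set zs))" by (intro Max_ge) auto
    then show "\<rho> > 0" unfolding \<rho>_def by linarith
  qed
  obtain C where "\<And>k. cmod (s k) \<le> C * 0 * \<rho> ^ k"
    using sdiffs_bound[OF \<rho>] assms by (metis norm_zero order_refl)
  then show ?thesis by simp
qed

text \<open>The polynomial (X^q - z^q) / (X - z) evaluated at the shift. It turns the factor E - z
  into E^q - z^q, which involves only two entries of s.\<close>

definition shift_quot :: "complex \<Rightarrow> nat \<Rightarrow> (nat \<Rightarrow> complex) \<Rightarrow> nat \<Rightarrow> complex" where
  "shift_quot z q s k = (\<Sum>i<q. z ^ (q - 1 - i) * s (k + i))"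

lemma shift_quot_sdiff: "shift_quot z q (sdiff z s) k = s (k + q) - z ^ q * s k"
proof (induction q)
  case (Suc q)
  have "shift_quot z (Suc q) (sdiff z s) k
      = (\<Sum>i<q. z ^ (q - i) * sdiff z s (k + i)) + sdiff z s (k + q)"
    by (simp add: shift_quot_def)
  also have "(\<Sum>i<q. z ^ (q - i) * sdiff z s (k + i)) = z * shift_quot z q (sdiff z s) k"
    unfolding shift_quot_def sum_distrib_left
  proof (intro sum.cong refl)
    fix i assume "i \<in> {..<q}"
    then have "q - i = Suc (q - 1 - i)" by auto
    then show "z ^ (q - i) * sdiff z s (k + i) = z * (z ^ (q - 1 - i) * sdiff z s (k + i))"
      by simp
  qed
  finally show ?case using Suc by (simp add: sdiff_def algebra_simps)
qed (simp add: shift_quot_def)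

lemma sdiff_shift_quot: "sdiff a (shift_quot z q s) = shift_quot z q (sdiff a s)"
  by (auto simp: shift_quot_def sdiff_def fun_eq_iff sum_distrib_left sum_subtractf
      right_diff_distrib mult_ac)

lemma sdiffs_shift_quot: "sdiffs zs (shift_quot z q s) = shift_quot z q (sdiffs zs s)"
  by (induction zs arbitrary: s) (simp_all add: sdiff_shift_quot)

lemma shift_quot_zero [simp]: "shift_quot z q (\<lambda>_. 0) = (\<lambda>_. 0)"
  by (simp add: shift_quot_def fun_eq_iff)

text \<open>The sum is the value of (X^q - z^q) / (X - z) at l: it is q l^(q - 1) if z = l and (l^q
  - z^q) / (l - z) otherwise. The case z = l occurs when l is a multiple root.\<close>

lemma geometric_quot_nonzero:
  fixes z l :: complex
  assumes "l \<noteq> 0" "q \<ge> 1" "z ^ q = l ^ q \<Longrightarrow> z = l"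
  shows "(\<Sum>i<q. z ^ (q - 1 - i) * l ^ i) \<noteq> 0"
proof (cases "z = l")
  case True
  have "(\<Sum>i<q. z ^ (q - 1 - i) * l ^ i) = (\<Sum>i<q. l ^ (q - 1))"
    using True by (intro sum.cong refl) (simp flip: power_add)
  then show ?thesis using assms by simp
next
  case False
  have "shift_quot z q (sdiff z (\<lambda>i. l ^ i)) 0 = l ^ q - z ^ q"
    by (simp add: shift_quot_sdiff)
  moreover have "sdiff z (\<lambda>i. l ^ i) = (\<lambda>i. (l - z) * l ^ i)"
    by (auto simp: sdiff_def algebra_simps)
  ultimately have "(l - z) * (\<Sum>i<q. z ^ (q - 1 - i) * l ^ i) = l ^ q - z ^ q"
    by (simp add: shift_quot_def sum_distrib_left mult_ac)
  then show ?thesis using False assms by auto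
qed

lemma sparse_card_le:
  assumes "finite (T::nat set)" "T \<subseteq> {..<N}" "M > 0"
    and "\<And>k l. k \<in> T \<Longrightarrow> l \<in> T \<Longrightarrow> k < l \<Longrightarrow> k + M \<le> l"
  shows "real (card T) \<le> real N / real M + 1"
proof -
  have "inj_on (\<lambda>k. k div M) T"
  proof (rule linorder_inj_onI)
    fix k l assume "k < l" "k \<in> T" "l \<in> T"
    then have "k + M \<le> l" using assms by auto
    then have "(k + M) div M \<le> l div M" by (rule div_le_mono)
    then show "k div M \<noteq> l div M" using \<open>M > 0\<close> by simp
  qed auto
  moreover have "(\<lambda>k. k div M) ` T \<subseteq> {..N div M}"
    using assms(2) by (auto intro!: div_le_mono)
  ultimately have "card T \<le> card {..N div M}" by (intro card_inj_on_le) auto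
  then have "real (card T) \<le> real (N div M) + 1" by simp
  also have "real (N div M) \<le> real N / real M" by (simp add: of_nat_div_le_of_nat)
  finally show ?thesis by simp
qed

text \<open>A set of bad times of positive density contains pairs \<open>k, k + q\<close> with a bounded \<open>q\<close> for a
  positive proportion of the \<open>k\<close>. At such \<open>k\<close> the sequence \<open>s (k + q) - z ^ q * s k\<close>, from which
  the root \<open>z\<close> has been eliminated, is small as well; nondegeneracy keeps its leading coefficient
  away from zero.\<close>

lemma sdiffs_density:
  assumes "cmod l > 0"
    and "\<forall>z\<in>set zs. cmod z \<le> cmod l"
    and "\<forall>z\<in>set zs. \<forall>q\<ge>1. z ^ q = l ^ q \<longrightarrow> z = l"
    and "\<eta> > 0" "c > 0"
  shows "\<exists>\<delta>>0. \<exists>N0. \<forall>s. sdiff l (sdiffs zs s) = (\<lambda>_. 0) \<longrightarrow> cmod (sdiffs zs s 0) \<ge> c \<longrightarrow>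
     (\<forall>N\<ge>N0. real (card {k. k < N \<and> cmod (s k) < \<delta> * cmod l ^ k}) \<le> \<eta> * real N)"
  using assms(2-)
proof (induction zs arbitrary: \<eta> c)
  case Nil
  have "real (card {k. k < N \<and> cmod (s k) < c * cmod l ^ k}) \<le> \<eta> * real N"
    if s: "sdiff l (sdiffs [] s) = (\<lambda>_. 0)" and c: "c \<le> cmod (sdiffs [] s 0)" for s N
  proof -
    have "s k = l ^ k * s 0" for k using s by (intro sdiff_eq_0_geometric) simp
    then have sk: "cmod (s k) = cmod (s 0) * cmod l ^ k" for k
      by (metis mult.commute norm_mult norm_power)
    have "c * cmod l ^ k \<le> cmod (s k)" for k
      unfolding sk[of k] using c by (intro mult_right_mono) auto
    then have "{k. k < N \<and> cmod (s k) < c * cmod l ^ k} = {}" by (auto simp: not_less)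
    then show ?thesis using \<open>\<eta> > 0\<close> by (simp only:) simp
  qed
  then show ?case using \<open>c > 0\<close> by blast
next
  case (Cons z zs)
  define L where "L = cmod l"
  have L: "L > 0" using assms(1) by (simp add: L_def)
  have l0: "l \<noteq> 0" using assms(1) by auto
  \<comment> \<open>Three shares of \<eta> N / 3: M accounts for the bad times at mutual distance at
    least M, \<eta>' for all gaps q \<le> M together, and N1 for the additive 1 of
    \<open>sparse_card_le\<close>.\<close>
  obtain M0 :: nat where M0: "3 / \<eta> < real M0" using reals_Archimedean2 by blast
  define M where "M = Suc M0"
  have M: "M > 0" "3 / \<eta> < real M" using M0 by (simp_all add: M_def)
  define \<eta>' where "\<eta>' = \<eta> / (3 * real M)"
  have \<eta>': "\<eta>' > 0" using M \<open>\<eta> > 0\<close> by (simp add: \<eta>'_def)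
  define g where "g q = (\<Sum>i<q. z ^ (q - 1 - i) * l ^ i)" for q
  have g: "g q \<noteq> 0" if "q \<ge> 1" for q
    unfolding g_def using Cons.prems that by (intro geometric_quot_nonzero l0) auto
  define c' where "c' = c * Min ((\<lambda>q. cmod (g q)) ` {1..M})"
  have gM: "Min ((\<lambda>q. cmod (g q)) ` {1..M}) > 0" using M g by (subst Min_gr_iff) auto
  have c': "c' > 0" unfolding c'_def using \<open>c > 0\<close> gM by simp
  have "\<forall>w\<in>set zs. cmod w \<le> cmod l" "\<forall>w\<in>set zs. \<forall>q\<ge>1. w ^ q = l ^ q \<longrightarrow> w = l"
    using Cons.prems(1,2) by simp_all
  from Cons.IH[OF this \<eta>' c'] obtain \<delta>' N' where \<delta>': "\<delta>' > 0"
    and IH0: "\<forall>s. sdiff l (sdiffs zs s) = (\<lambda>_. 0) \<longrightarrow> cmod (sdiffs zs s 0) \<ge> c' \<longrightarrow>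
      (\<forall>N\<ge>N'. real (card {k. k < N \<and> cmod (s k) < \<delta>' * cmod l ^ k}) \<le> \<eta>' * real N)"
    by (elim exE conjE)
  have IH: "real (card {k. k < N \<and> cmod (s k) < \<delta>' * L ^ k}) \<le> \<eta>' * real N"
    if "sdiff l (sdiffs zs s) = (\<lambda>_. 0)" "cmod (sdiffs zs s 0) \<ge> c'" "N \<ge> N'" for s N
    unfolding L_def using IH0[rule_format, OF that] .
  \<comment> \<open>A common bound for L^q and cmod z ^ q over all gaps q \<le> M; hence the two
    terms of s (k + q) - z^q s k cost the factor 2 K in \<delta>.\<close>
  define K where "K = max 1 L ^ M"
  have K: "K \<ge> 1" by (auto simp: K_def intro: one_le_power)
  define \<delta> where "\<delta> = \<delta>' / (2 * K)"
  have \<delta>: "\<delta> > 0" using \<delta>' K by (simp add: \<delta>_def)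
  obtain N1 :: nat where N1: "3 / \<eta> < real N1" using reals_Archimedean2 by blast
  have "real (card {k. k < N \<and> cmod (s k) < \<delta> * L ^ k}) \<le> \<eta> * real N"
    if s: "sdiff l (sdiffs (z # zs) s) = (\<lambda>_. 0)" and sc: "cmod (sdiffs (z # zs) s 0) \<ge> c"
      and N: "N \<ge> max N' N1" for s N
  proof -
    define S where "S = {k. k < N \<and> cmod (s k) < \<delta> * L ^ k}"
    have finS: "finite S" "S \<subseteq> {..<N}" by (auto simp: S_def)
    define P where "P q = {k \<in> S. k + q \<in> S}" for q
    have P: "real (card (P q)) \<le> \<eta>' * real N" if q: "q \<in> {1..M}" for q
    proof -
      define r where "r = shift_quot z q (sdiff z s)"
      have u: "sdiffs zs r = shift_quot z q (sdiffs (z # zs) s)"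
        by (simp add: r_def sdiffs_shift_quot)
      have geo: "sdiffs (z # zs) s k = l ^ k * sdiffs (z # zs) s 0" for k
        using s by (rule sdiff_eq_0_geometric)
      \<comment> \<open>Since \<open>sdiffs (z # zs) s\<close> is geometric with ratio l, the
        quotient polynomial acts on it as multiplication by its value at l, which is g q. This is
        the origin of c'.\<close>
      have "sdiffs zs r 0 = g q * sdiffs (z # zs) s 0"
      proof -
        have "sdiffs zs r 0 = (\<Sum>i<q. z ^ (q - 1 - i) * sdiffs (z # zs) s i)"
          unfolding u shift_quot_def by simp
        also have "\<dots> = (\<Sum>i<q. z ^ (q - 1 - i) * l ^ i * sdiffs (z # zs) s 0)"
          
        proof (intro sum.cong refl)
          fix i
          show "z ^ (q - 1 - i) * sdiffs (z # zs) s i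
              = z ^ (q - 1 - i) * l ^ i * sdiffs (z # zs) s 0"
            unfolding geo[of i] by (simp only: mult.assoc)
        qed
        finally show ?thesis unfolding g_def sum_distrib_right .
      qed
      then have "cmod (sdiffs zs r 0) = cmod (sdiffs (z # zs) s 0) * cmod (g q)"
        by (simp add: norm_mult)
      also have "\<dots> \<ge> c'" unfolding c'_def
        using sc \<open>c > 0\<close> gM q by (intro mult_mono Min_le) auto
      finally have 1: "cmod (sdiffs zs r 0) \<ge> c'" .
      have 2: "sdiff l (sdiffs zs r) = (\<lambda>_. 0)"
        unfolding u sdiff_shift_quot s by simp
      have "P q \<subseteq> {k. k < N \<and> cmod (r k) < \<delta>' * L ^ k}"
      proof
        fix k assume "k \<in> P q"
        then have k: "k < N" "cmod (s k) < \<delta> * L ^ k" "cmod (s (k + q)) < \<delta> * L ^ (k + q)"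
          by (auto simp: P_def S_def)
        have zL: "cmod z ^ q \<le> K" and LK: "L ^ q \<le> K"
        proof -
          have "L ^ q \<le> max 1 L ^ q" using L by (intro power_mono) auto
          also have "\<dots> \<le> K" unfolding K_def using q by (intro power_increasing) auto
          finally show "L ^ q \<le> K" .
          moreover have "cmod z ^ q \<le> L ^ q" using Cons.prems by (intro power_mono) (auto simp: L_def)
          ultimately show "cmod z ^ q \<le> K" by simp
        qed
        have "cmod (r k) \<le> cmod (s (k + q)) + cmod z ^ q * cmod (s k)"
          unfolding r_def shift_quot_sdiff by (metis norm_mult norm_power norm_triangle_ineq4)
        also have "\<dots> < \<delta> * L ^ (k + q) + cmod z ^ q * (\<delta> * L ^ k)"
          using k by (intro add_less_le_mono mult_left_mono) auto
        also have "\<dots> = (L ^ q + cmod z ^ q) * (\<delta> * L ^ k)" by (simp add: power_add algebra_simps)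
        also have "\<dots> \<le> (K + K) * (\<delta> * L ^ k)"
          using zL LK \<delta> L by (intro mult_right_mono add_mono) auto
        also have "\<dots> = \<delta>' * L ^ k" using K unfolding \<delta>_def by (simp add: field_simps)
        finally show "k \<in> {k. k < N \<and> cmod (r k) < \<delta>' * L ^ k}" using k by simp
      qed
      then have "card (P q) \<le> card {k. k < N \<and> cmod (r k) < \<delta>' * L ^ k}"
        by (intro card_mono) auto
      also have "real \<dots> \<le> \<eta>' * real N" using N by (intro IH 1 2) auto
      finally show ?thesis by simp
    qed
    \<comment> \<open>The bad times that are not followed by another one within M; two of them
      cannot be closer than M.\<close>
    define T where "T = S - (\<Union>q\<in>{1..M}. P q)"
    have T: "real (card T) \<le> real N / real M + 1"
    proof (rule sparse_card_le)
      fix k l assume kl: "k \<in> T" "l \<in> T" "k < l"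
      show "k + M \<le> l"
      proof (rule ccontr)
        assume "\<not> k + M \<le> l"
        then have "l - k \<in> {1..M}" "k \<in> P (l - k)" using kl by (auto simp: T_def P_def)
        then show False using kl by (auto simp: T_def)
      qed
    qed (use finS M in \<open>auto simp: T_def\<close>)
    have "S \<subseteq> T \<union> (\<Union>q\<in>{1..M}. P q)" by (auto simp: T_def)
    then have "card S \<le> card (T \<union> (\<Union>q\<in>{1..M}. P q))"
      using finS by (intro card_mono) (auto simp: T_def P_def)
    also have "\<dots> \<le> card T + card (\<Union>q\<in>{1..M}. P q)" by (rule card_Un_le)
    also have "card (\<Union>q\<in>{1..M}. P q) \<le> (\<Sum>q\<in>{1..M}. card (P q))" by (intro card_UN_le) auto
    finally have "card S \<le> card T + (\<Sum>q\<in>{1..M}. card (P q))" by simp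
    then have "real (card S) \<le> real (card T + (\<Sum>q\<in>{1..M}. card (P q)))" by (rule of_nat_mono)
    also have "\<dots> = real (card T) + (\<Sum>q\<in>{1..M}. real (card (P q)))" by simp
    also have "\<dots> \<le> (real N / real M + 1) + (\<Sum>q\<in>{1..M}. \<eta>' * real N)"
      by (intro add_mono T sum_mono P)
    also have "(\<Sum>q\<in>{1..M}. \<eta>' * real N) = \<eta> * real N / 3" using M by (simp add: \<eta>'_def)
    finally have fin: "real (card S) \<le> (real N / real M + 1) + \<eta> * real N / 3" .
    have "3 * real N \<le> (\<eta> * real M) * real N"
      using M \<open>\<eta> > 0\<close> by (intro mult_right_mono) (simp_all add: divide_less_eq mult.commute)
    then have m1: "real N / real M \<le> \<eta> * real N / 3"
      using M by (simp add: divide_le_eq mult_ac)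
    have "real N1 \<le> real N" using N by simp
    then have "3 / \<eta> \<le> real N" using N1 by linarith
    then have m2: "1 \<le> \<eta> * real N / 3"
      using \<open>\<eta> > 0\<close> by (simp add: divide_le_eq mult.commute)
    show ?thesis using fin m1 m2 unfolding S_def L_def by linarith
  qed
  then show ?case
    using \<delta> unfolding L_def by (intro exI[of _ \<delta>] conjI exI[of _ "max N' N1"] allI impI)
qed

section \<open>Annihilating polynomials of complex operators\<close>

definition complex_linear :: "(complex^'n \<Rightarrow> complex^'n) \<Rightarrow> bool" where
  "complex_linear T \<longleftrightarrow> (\<forall>x y. T (x + y) = T x + T y) \<and> (\<forall>c x. T (c *s x) = c *s T x)"

lemma complex_linearD:
  assumes "complex_linear T"
  shows "T (x + y) = T x + T y" "T (c *s x) = c *s T x" "T 0 = 0" "T (x - y) = T x - T y"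
proof -
  show a: "T (x + y) = T x + T y" "T (c *s x) = c *s T x" for x y c
    using assms by (auto simp: complex_linear_def)
  show "T 0 = 0" using a(2)[of 0 0] by simp
  show "T (x - y) = T x - T y" using a(1)[of "x - y" y] by simp
qed

lemma complex_linear_sum:
  assumes "complex_linear T"
  shows "T (sum g I) = (\<Sum>i\<in>I. T (g i))"
  by (induction I rule: infinite_finite_induct) (auto simp: complex_linearD[OF assms])

lemma complex_linear_matrix: "complex_linear ((*v) (M :: complex^'n^'n))"
  by (simp add: complex_linear_def matrix_vector_right_distrib vector_scalar_commute)

lemma complex_linear_funpow: "complex_linear T \<Longrightarrow> complex_linear (T ^^ k)"
  by (induction k) (auto simp: complex_linear_def)

definition vdiff :: "(complex^'n \<Rightarrow> complex^'n) \<Rightarrow> complex \<Rightarrow> complex^'n \<Rightarrow> complex^'n" where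
  "vdiff T z v = T v - z *s v"

definition vdiffs :: "(complex^'n \<Rightarrow> complex^'n) \<Rightarrow> complex list \<Rightarrow> complex^'n \<Rightarrow> complex^'n" where
  "vdiffs T zs = fold (vdiff T) zs"

lemma vdiffs_simps [simp]:
  "vdiffs T [] v = v" "vdiffs T (z # zs) v = vdiffs T zs (vdiff T z v)"
  by (simp_all add: vdiffs_def)

lemma vdiffs_append: "vdiffs T (xs @ ys) v = vdiffs T ys (vdiffs T xs v)"
  by (simp add: vdiffs_def)

lemma complex_linear_vdiff: "complex_linear T \<Longrightarrow> complex_linear (vdiff T z)"
  by (auto simp: complex_linear_def vdiff_def vec_eq_iff algebra_simps)

lemma complex_linear_vdiffs: "complex_linear T \<Longrightarrow> complex_linear (vdiffs T zs)"
proof (induction zs)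
  case (Cons z zs)
  then show ?case using complex_linear_vdiff[OF Cons.prems, of z] by (auto simp: complex_linear_def)
qed (simp add: complex_linear_def)

lemma vdiffs_commute:
  assumes "complex_linear G" "\<And>v. G (T v) = T (G v)"
  shows "G (vdiffs T zs v) = vdiffs T zs (G v)"
  by (induction zs arbitrary: v) (simp_all add: vdiff_def complex_linearD[OF assms(1)] assms(2))

lemma vdiff_commute_T: "complex_linear T \<Longrightarrow> vdiff T z (T v) = T (vdiff T z v)"
  by (simp add: vdiff_def complex_linearD)

lemma vdiffs_commute_T: "complex_linear T \<Longrightarrow> vdiffs T zs (T v) = T (vdiffs T zs v)"
  using vdiffs_commute[of T T zs v] by simp

lemma vdiffs_vdiff: "complex_linear T \<Longrightarrow> vdiff T z (vdiffs T zs v) = vdiffs T zs (vdiff T z v)"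
  by (rule vdiffs_commute) (auto simp: complex_linear_vdiff vdiff_commute_T)

lemma vdiffs_vdiffs: "complex_linear T \<Longrightarrow> vdiffs T ys (vdiffs T zs v) = vdiffs T zs (vdiffs T ys v)"
  by (rule vdiffs_commute) (auto simp: complex_linear_vdiffs vdiffs_commute_T)

text \<open>The statement is about a family, \<open>dependent\<close> about a set: a repeated vector
  is not visible in the set and gets the coefficients 1 and -1.\<close>

lemma linear_dependence_sequence:
  fixes f :: "nat \<Rightarrow> 'a::euclidean_space"
  shows "\<exists>N c. (\<exists>i\<le>N. c i \<noteq> 0) \<and> (\<Sum>i\<le>N. c i *\<^sub>R f i) = 0"
proof (cases "inj_on f {..DIM('a)}")
  case True
  then have "card (f ` {..DIM('a)}) > DIM('a)" by (simp add: card_image)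
  then have "dependent (f ` {..DIM('a)})" by (intro dependent_biggerset) auto
  then obtain u where u: "\<exists>v\<in>f ` {..DIM('a)}. u v \<noteq> 0" "(\<Sum>v\<in>f ` {..DIM('a)}. u v *\<^sub>R v) = 0"
    by (auto simp: dependent_finite)
  have "(\<Sum>i\<le>DIM('a). u (f i) *\<^sub>R f i) = 0"
    using u(2) by (simp add: sum.reindex[OF True])
  then show ?thesis using u(1) by (intro exI[of _ "DIM('a)"] exI[of _ "u \<circ> f"]) auto
next
  case False
  then obtain i j where ij: "i \<noteq> j" "f i = f j" "i \<le> DIM('a)" "j \<le> DIM('a)"
    by (auto simp: inj_on_def)
  define c where "c k = (if k = i then 1 else if k = j then -1 else (0::real))" for k
  have "(\<Sum>k\<le>DIM('a). c k *\<^sub>R f k) = (\<Sum>k\<in>{i, j}. c k *\<^sub>R f k)"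
    using ij by (intro sum.mono_neutral_right) (auto simp: c_def)
  also have "\<dots> = 0" using ij by (simp add: c_def)
  finally show ?thesis using ij by (intro exI[of _ "DIM('a)"] exI[of _ c]) (auto simp: c_def)
qed

section \<open>Polynomials in an operator, split into linear factors\<close>

definition poly_act :: "(complex^'n \<Rightarrow> complex^'n) \<Rightarrow> complex poly \<Rightarrow> complex^'n \<Rightarrow> complex^'n" where
  "poly_act T p v = (\<Sum>i\<le>degree p. coeff p i *s (T ^^ i) v)"

lemma poly_act_bound:
  assumes "degree p \<le> N"
  shows "poly_act T p v = (\<Sum>i\<le>N. coeff p i *s (T ^^ i) v)"
  unfolding poly_act_def using assms
  by (intro sum.mono_neutral_left) (auto simp: coeff_eq_0)

lemma poly_act_linear_factor:
  assumes "complex_linear T"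
  shows "poly_act T ([:-z, 1:] * q) v = poly_act T q (vdiff T z v)"
proof -
  define N where "N = Suc (degree q)"
  define a where "a i = (T ^^ i) v" for i
  have deg: "degree ([:-z, 1:] * q) \<le> Suc (degree q)"
    using degree_mult_le[of "[:-z, 1:]" q] by simp
  have co: "coeff ([:-z, 1:] * q) i = (case i of 0 \<Rightarrow> 0 | Suc j \<Rightarrow> coeff q j) - z * coeff q i" for i
    by (simp add: coeff_pCons split: nat.split)
  have "poly_act T ([:-z, 1:] * q) v = (\<Sum>i\<le>Suc (degree q). coeff ([:-z, 1:] * q) i *s a i)"
    unfolding a_def by (rule poly_act_bound[OF deg])
  also have "\<dots> = (\<Sum>i\<le>Suc (degree q). (case i of 0 \<Rightarrow> 0 | Suc j \<Rightarrow> coeff q j) *s a i)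
      - (\<Sum>i\<le>Suc (degree q). (z * coeff q i) *s a i)"
    unfolding co by (simp only: vector_sub_rdistrib sum_subtractf)
  also have "(\<Sum>i\<le>Suc (degree q). (case i of 0 \<Rightarrow> 0 | Suc j \<Rightarrow> coeff q j) *s a i)
      = (\<Sum>i\<le>degree q. coeff q i *s a (Suc i))"
    unfolding sum.atMost_Suc_shift by simp
  also have "(\<Sum>i\<le>Suc (degree q). (z * coeff q i) *s a i) = (\<Sum>i\<le>degree q. (z * coeff q i) *s a i)"
    by (simp add: coeff_eq_0)
  also have "(\<Sum>i\<le>degree q. coeff q i *s a (Suc i)) - (\<Sum>i\<le>degree q. (z * coeff q i) *s a i)
      = (\<Sum>i\<le>degree q. coeff q i *s (T ^^ i) (vdiff T z v))"
    unfolding sum_subtractf[symmetric]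
  proof (intro sum.cong refl)
    fix i
    have "(T ^^ i) (vdiff T z v) = a (Suc i) - z *s a i"
      unfolding vdiff_def a_def
      by (simp add: complex_linearD[OF complex_linear_funpow[OF assms]] funpow_swap1)
    then show "coeff q i *s a (Suc i) - (z * coeff q i) *s a i = coeff q i *s (T ^^ i) (vdiff T z v)"
      by (simp add: vector_ssub_ldistrib vector_smult_assoc mult.commute)
  qed
  finally show ?thesis by (simp add: poly_act_def)
qed

text \<open>The fundamental theorem of algebra splits off one linear factor per degree; the
  remaining nonzero constant is invertible.\<close>

lemma poly_act_eq_0_imp_vdiffs:
  assumes "complex_linear T" "p \<noteq> 0" "poly_act T p v = 0"
  shows "\<exists>zs. vdiffs T zs v = 0"
  using assms(2,3)
proof (induction "degree p" arbitrary: p v)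
  case 0
  then obtain c where "p = [:c:]" by (metis degree_eq_zeroE)
  then have "v = 0" using 0 by (auto simp: poly_act_def vec_eq_iff)
  then show ?case by (intro exI[of _ "[]"]) simp
next
  case (Suc d)
  have "\<not> constant (poly p)" using Suc.hyps(2) by (simp add: constant_degree)
  then obtain z where "poly p z = 0" using fundamental_theorem_of_algebra by blast
  then obtain q where q: "p = [:-z, 1:] * q" unfolding poly_eq_0_iff_dvd by (auto elim: dvdE)
  have "q \<noteq> 0" using q Suc by auto
  have "degree p = Suc (degree q)"
    unfolding q using \<open>q \<noteq> 0\<close> by (subst degree_mult_eq) auto
  then have "d = degree q" using Suc.hyps by simp
  moreover have "poly_act T q (vdiff T z v) = 0"
    using Suc.prems(2) unfolding q poly_act_linear_factor[OF assms(1)] .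
  ultimately obtain zs where "vdiffs T zs (vdiff T z v) = 0" using Suc.hyps(1) \<open>q \<noteq> 0\<close> by blast
  then show ?case by (intro exI[of _ "z # zs"]) simp
qed

text \<open>As a real Euclidean space \<open>complex^'n\<close> has finite dimension, so the
  iterates of v satisfy a relation with real coefficients, which is read as a complex
  polynomial.\<close>

lemma vdiffs_annihilate_vector:
  fixes T :: "complex^'n \<Rightarrow> complex^'n"
  assumes "complex_linear T"
  shows "\<exists>zs. vdiffs T zs v = 0"
proof -
  obtain N c where c: "\<exists>i\<le>N. c i \<noteq> 0" "(\<Sum>i\<le>N. c i *\<^sub>R (T ^^ i) v) = 0"
    using linear_dependence_sequence[of "\<lambda>i. (T ^^ i) v"] by blast
  define p where "p = (\<Sum>i\<le>N. monom (complex_of_real (c i)) i)"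
  have co: "coeff p j = (if j \<le> N then complex_of_real (c j) else 0)" for j
    by (simp add: p_def coeff_sum)
  have p0: "p \<noteq> 0" using c(1) co by (metis coeff_0 of_real_eq_0_iff)
  have deg: "degree p \<le> N" by (rule degree_le) (simp add: co)
  have "poly_act T p v = (\<Sum>i\<le>N. c i *\<^sub>R (T ^^ i) v)"
    unfolding poly_act_bound[OF deg]
    by (intro sum.cong refl) (simp add: co vec_eq_iff scaleR_conv_of_real[where 'a = complex])
  then show ?thesis using poly_act_eq_0_imp_vdiffs[OF assms p0] c(2) by simp
qed

text \<open>For z not an eigenvalue T - z is injective; the factors commute, so it can be moved to
  the outside and cancelled.\<close>

lemma vdiffs_filter_eigenvalues:
  assumes "complex_linear T" "vdiffs T zs v = 0"
  shows "vdiffs T (filter (\<lambda>z. \<exists>w. w \<noteq> 0 \<and> T w = z *s w) zs) v = 0"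
  using assms(2)
proof (induction zs arbitrary: v)
  case (Cons z zs)
  define zs' where "zs' = filter (\<lambda>z. \<exists>w. w \<noteq> 0 \<and> T w = z *s w) zs"
  have IH: "vdiffs T zs' (vdiff T z v) = 0" using Cons by (simp add: zs'_def)
  show ?case
  proof (cases "\<exists>w. w \<noteq> 0 \<and> T w = z *s w")
    case True
    then show ?thesis using IH by (simp add: zs'_def)
  next
    case False
    have "vdiff T z (vdiffs T zs' v) = 0" using IH vdiffs_vdiff[OF assms(1)] by metis
    then have "T (vdiffs T zs' v) = z *s vdiffs T zs' v" by (simp add: vdiff_def)
    then show ?thesis using False by (auto simp: zs'_def)
  qed
qed simp

text \<open>Takes the place of the characteristic polynomial: the basis vectors are annihilated one
  after another by concatenated lists. That all roots are eigenvalues is what later brings in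
  hyperbolicity.\<close>

lemma vdiffs_annihilate:
  fixes T :: "complex^'n \<Rightarrow> complex^'n"
  assumes T: "complex_linear T"
  shows "\<exists>zs. (\<forall>v. vdiffs T zs v = 0) \<and> (\<forall>z\<in>set zs. \<exists>w. w \<noteq> 0 \<and> T w = z *s w)"
proof -
  have "\<exists>zs. \<forall>i\<in>I. vdiffs T zs (axis i 1) = 0" if "finite I" for I :: "'n set"
    using that
  proof (induction I)
    case (insert i I)
    then obtain zs where zs: "\<forall>i\<in>I. vdiffs T zs (axis i 1) = 0" by blast
    obtain ys where ys: "vdiffs T ys (axis i 1) = 0" using vdiffs_annihilate_vector[OF T] by blast
    have "vdiffs T (zs @ ys) (axis k 1) = 0" if "k \<in> insert i I" for k
      using that zs ys unfolding vdiffs_append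
      by (metis T complex_linearD(3) complex_linear_vdiffs insertE vdiffs_vdiffs)
    then show ?case by blast
  qed auto
  then obtain zs where zs: "\<And>i. vdiffs T zs (axis i 1) = 0" by (metis UNIV_I finite)
  have "vdiffs T zs v = 0" for v
  proof -
    have "vdiffs T zs v = vdiffs T zs (\<Sum>i\<in>UNIV. v $ i *s axis i 1)" by (simp add: basis_expansion)
    also have "\<dots> = 0"
      by (simp add: complex_linear_sum[OF complex_linear_vdiffs[OF T]]
          complex_linearD[OF complex_linear_vdiffs[OF T]] zs)
    finally show ?thesis .
  qed
  then show ?thesis
    using vdiffs_filter_eigenvalues[OF T]
    by (intro exI[of _ "filter (\<lambda>z. \<exists>w. w \<noteq> 0 \<and> T w = z *s w) zs"]) auto
qed

text \<open>The factorisation of X^m - z^m through X - z. It shows that m-th powers of the roots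
  annihilate T^m.\<close>

lemma vdiff_funpow:
  assumes "complex_linear T"
  shows "vdiff (T ^^ m) (z ^ m) v = (\<Sum>i<m. z ^ (m - 1 - i) *s (T ^^ i) (vdiff T z v))"
proof (induction m)
  case (Suc m)
  have "(\<Sum>i<Suc m. z ^ (Suc m - 1 - i) *s (T ^^ i) (vdiff T z v))
     = (\<Sum>i<m. z ^ (m - i) *s (T ^^ i) (vdiff T z v)) + (T ^^ m) (vdiff T z v)"
    by simp
  also have "(\<Sum>i<m. z ^ (m - i) *s (T ^^ i) (vdiff T z v))
     = (\<Sum>i<m. z *s (z ^ (m - 1 - i) *s (T ^^ i) (vdiff T z v)))"
  proof (intro sum.cong refl)
    fix i assume "i \<in> {..<m}"
    then have "m - i = Suc (m - 1 - i)" by auto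
    then show "z ^ (m - i) *s (T ^^ i) (vdiff T z v) = z *s (z ^ (m - 1 - i) *s (T ^^ i) (vdiff T z v))"
      by (simp add: vector_smult_assoc)
  qed
  also have "\<dots> = z *s vdiff (T ^^ m) (z ^ m) v"
    unfolding Suc by (simp add: vec_eq_iff sum_distrib_left mult.assoc)
  also have "(T ^^ m) (vdiff T z v) = (T ^^ Suc m) v - z *s (T ^^ m) v"
    by (simp add: vdiff_def complex_linearD[OF complex_linear_funpow[OF assms]] funpow_swap1)
  finally show ?case by (simp add: vdiff_def vec_eq_iff algebra_simps)
qed (simp add: vdiff_def)

lemma vdiffs_funpow:
  assumes T: "complex_linear T" and "vdiffs T zs v = 0"
  shows "vdiffs (T ^^ m) (map (\<lambda>z. z ^ m) zs) v = 0"
  using assms(2)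
proof (induction zs arbitrary: v)
  case (Cons z zs)
  define D where "D = vdiffs (T ^^ m) (map (\<lambda>z. z ^ m) zs)"
  have D: "complex_linear D" unfolding D_def by (intro complex_linear_vdiffs complex_linear_funpow T)
  have IH: "D (vdiff T z v) = 0" using Cons by (simp add: D_def)
  have "D ((T ^^ i) w) = (T ^^ i) (D w)" for i w
    unfolding D_def
  proof (rule vdiffs_commute[symmetric])
    show "complex_linear (T ^^ i)" by (rule complex_linear_funpow[OF T])
    show "(T ^^ i) ((T ^^ m) v) = (T ^^ m) ((T ^^ i) v)" for v
      by (metis add.commute comp_apply funpow_add)
  qed
  then have "D (vdiff (T ^^ m) (z ^ m) v) = 0"
    by (simp add: vdiff_funpow[OF T] complex_linear_sum[OF D] complex_linearD[OF D] IH
        complex_linearD[OF complex_linear_funpow[OF T]])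
  then show ?case by (simp add: D_def)
qed simp

text \<open>The kernel of a product of coprime polynomials is the sum of the two kernels. The
  induction removes one root from either list and thereby avoids Bezout coefficients.\<close>

lemma vdiffs_split:
  assumes T: "complex_linear T"
  shows "vdiffs T (xs @ ys) v = 0 \<Longrightarrow> set xs \<inter> set ys = {} \<Longrightarrow>
    \<exists>x y. v = x + y \<and> vdiffs T xs x = 0 \<and> vdiffs T ys y = 0"
proof (induction "length xs + length ys" arbitrary: xs ys v)
  case 0
  then show ?case by (intro exI[of _ 0]) simp
next
  case (Suc n)
  note Z = complex_linearD(3)[OF complex_linear_vdiffs[OF T]]
  note Lin = complex_linearD[OF complex_linear_vdiffs[OF T]]
  show ?case
  proof (cases "xs = [] \<or> ys = []")
    case True
    then show ?thesis
    proof
      assume "xs = []"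
      then show ?thesis using Suc.prems by (intro exI[of _ 0] exI[of _ v]) simp
    next
      assume "ys = []"
      then show ?thesis using Suc.prems by (intro exI[of _ v] exI[of _ 0]) (simp add: Z)
    qed
  next
    case False
    then obtain a xs' b ys' where ab: "xs = a # xs'" "ys = b # ys'" by (meson list.exhaust)
    have neq: "a \<noteq> b" using Suc.prems ab by auto
    have "vdiffs T (xs' @ ys) (vdiff T a v) = 0" using Suc.prems ab by simp
    then obtain x1 y1 where 1: "vdiff T a v = x1 + y1" "vdiffs T xs' x1 = 0" "vdiffs T ys y1 = 0"
      using Suc.hyps(1)[of xs' ys "vdiff T a v"] Suc.hyps(2) Suc.prems(2) ab by auto
    have "vdiffs T (xs @ ys') (vdiff T b v) = vdiffs T ys' (vdiffs T xs (vdiff T b v))"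
      by (simp add: vdiffs_append)
    also have "\<dots> = vdiffs T (xs @ ys) v"
      using vdiffs_vdiff[OF T, of b xs v] by (simp add: vdiffs_append ab)
    finally have "vdiffs T (xs @ ys') (vdiff T b v) = 0" using Suc.prems by simp
    then obtain x2 y2 where 2: "vdiff T b v = x2 + y2" "vdiffs T xs x2 = 0" "vdiffs T ys' y2 = 0"
      using Suc.hyps(1)[of xs ys' "vdiff T b v"] Suc.hyps(2) Suc.prems(2) ab by auto
    have x1: "vdiffs T xs x1 = 0"
      using vdiffs_vdiff[OF T, of a xs' x1] 1(2) ab complex_linearD(3)[OF complex_linear_vdiff[OF T]]
      by simp
    have y2: "vdiffs T ys y2 = 0"
      using vdiffs_vdiff[OF T, of b ys' y2] 2(3) ab complex_linearD(3)[OF complex_linear_vdiff[OF T]]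
      by simp
    \<comment> \<open>From (T - a) v - (T - b) v = (b - a) v: both vectors on the left are already
      split by the induction hypothesis.\<close>
    define c where "c = inverse (b - a)"
    have c: "c * (b - a) = 1" using neq by (simp add: c_def)
    have "(x1 - x2) + (y1 - y2) = vdiff T a v - vdiff T b v" using 1(1) 2(1) by simp
    also have "\<dots> = (b - a) *s v" by (simp add: vdiff_def vec_eq_iff algebra_simps)
    finally have e: "(x1 - x2) + (y1 - y2) = (b - a) *s v" .
    have "c *s ((x1 - x2) + (y1 - y2)) = c *s ((b - a) *s v)" unfolding e ..
    also have "\<dots> = v" by (simp only: vector_smult_assoc c vector_smult_lid)
    finally have "v = c *s (x1 - x2) + c *s (y1 - y2)" by (simp add: vector_add_ldistrib)
    moreover have "vdiffs T xs (c *s (x1 - x2)) = 0" "vdiffs T ys (c *s (y1 - y2)) = 0"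
      using x1 y2 1 2 by (simp_all add: Lin)
    ultimately show ?thesis by blast
  qed
qed

text \<open>Converts a polynomial annihilating the operator into a recurrence for every linear
  observation of its orbits.\<close>

lemma sdiffs_functional:
  assumes T: "complex_linear T"
    and h: "\<And>x y. h (x + y) = h x + h y" "\<And>c x. h (c *s x) = c * h x"
  shows "sdiffs zs (\<lambda>k. h ((T ^^ k) v)) = (\<lambda>k. h ((T ^^ k) (vdiffs T zs v)))"
proof (induction zs arbitrary: v)
  case (Cons z zs)
  have hd: "h (x - y) = h x - h y" for x y using h(1)[of "x - y" y] by simp
  have "sdiff z (\<lambda>k. h ((T ^^ k) v)) = (\<lambda>k. h ((T ^^ k) (vdiff T z v)))"
    by (simp add: fun_eq_iff sdiff_def vdiff_def complex_linearD[OF complex_linear_funpow[OF T]]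
        hd h funpow_swap1)
  then show ?case using Cons by simp
qed simp

section \<open>Oscillatory integrals\<close>

text \<open>Integration by parts against \<open>\<phi>' / (\<phi>'\<^sup>2 + h\<^sup>2)\<close>, which regularises \<open>1 / \<phi>'\<close> near the
  stationary points of the phase.\<close>

lemma oscillatory_integral_cos:
  fixes \<phi> \<phi>' \<phi>'' :: "real \<Rightarrow> real"
  assumes "a \<le> b" "h > 0"
    and d1: "\<And>t. t \<in> {a..b} \<Longrightarrow> (\<phi> has_real_derivative \<phi>' t) (at t)"
    and d2: "\<And>t. t \<in> {a..b} \<Longrightarrow> (\<phi>' has_real_derivative \<phi>'' t) (at t)"
    and c: "continuous_on {a..b} \<phi>''"
    and B: "\<And>t. t \<in> {a..b} \<Longrightarrow> \<bar>\<phi>'' t\<bar> \<le> B"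
  shows "\<bar>integral {a..b} (\<lambda>t. cos (\<phi> t))\<bar>
     \<le> 1 / h + (b - a) * (B / h\<^sup>2) + integral {a..b} (\<lambda>t. h\<^sup>2 / ((\<phi>' t)\<^sup>2 + h\<^sup>2))"
proof -
  define D where "D t = (\<phi>' t)\<^sup>2 + h\<^sup>2" for t
  have D: "D t > 0" "D t \<ge> h\<^sup>2" for t using \<open>h > 0\<close> by (auto simp: D_def add_nonneg_pos)
  define \<psi> where "\<psi> t = \<phi>' t / D t" for t
  define \<psi>' where "\<psi>' t = \<phi>'' t * (h\<^sup>2 - (\<phi>' t)\<^sup>2) / (D t)\<^sup>2" for t
  have c1: "continuous_on {a..b} \<phi>" "continuous_on {a..b} \<phi>'"
    using d1 d2 by (meson DERIV_isCont continuous_at_imp_continuous_on)+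
  have cD: "continuous_on {a..b} D" unfolding D_def by (intro continuous_intros c1)
  have D0: "\<forall>t\<in>{a..b}. D t \<noteq> 0" using D(1) by (metis less_irrefl)
  have c2: "continuous_on {a..b} \<psi>" "continuous_on {a..b} \<psi>'"
    unfolding \<psi>_def \<psi>'_def using D0 by (intro continuous_intros c c1 cD; simp)+
  have \<psi>: "(\<psi> has_real_derivative \<psi>' t) (at t)" if "t \<in> {a..b}" for t
  proof -
    have dd: "(D has_real_derivative 2 * \<phi>' t * \<phi>'' t) (at t)"
      unfolding D_def using d2[OF that] by (auto intro!: derivative_eq_intros)
    have "(\<psi> has_real_derivative (\<phi>'' t * D t - \<phi>' t * (2 * \<phi>' t * \<phi>'' t)) / (D t * D t)) (at t)"
      unfolding \<psi>_def using d2[OF that] dd D(1)[of t] by (intro DERIV_divide) auto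
    moreover have "\<phi>'' t * D t - \<phi>' t * (2 * \<phi>' t * \<phi>'' t) = \<phi>'' t * (h\<^sup>2 - (\<phi>' t)\<^sup>2)"
      by (simp add: D_def algebra_simps power2_eq_square)
    ultimately show ?thesis by (simp add: \<psi>'_def power2_eq_square)
  qed
  define F where "F t = sin (\<phi> t) * \<psi> t" for t
  define F' where "F' t = cos (\<phi> t) * \<phi>' t * \<psi> t + sin (\<phi> t) * \<psi>' t" for t
  have F: "(F has_real_derivative F' t) (at t)" if "t \<in> {a..b}" for t
    unfolding F_def F'_def using d1[OF that] \<psi>[OF that]
    by (auto intro!: derivative_eq_intros simp: algebra_simps)
  have iF: "(F' has_integral F b - F a) {a..b}"
    using F by (intro fundamental_theorem_of_calculus \<open>a \<le> b\<close>)
      (simp add: has_real_derivative_iff_has_vector_derivative[symmetric] has_field_derivative_at_within)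
  define E1 where "E1 t = sin (\<phi> t) * \<psi>' t" for t
  define E2 where "E2 t = cos (\<phi> t) * (h\<^sup>2 / D t)" for t
  have i1: "E1 integrable_on {a..b}" unfolding E1_def
    by (intro integrable_continuous_real continuous_intros c1 c2)
  have i2: "E2 integrable_on {a..b}" unfolding E2_def
    using D0 by (intro integrable_continuous_real continuous_intros c1 c2 cD) 
  have i3: "(\<lambda>t. h\<^sup>2 / D t) integrable_on {a..b}"
    using D0 by (intro integrable_continuous_real continuous_intros cD)
  \<comment> \<open>The defect 1 - \<phi>' \<psi> equals h^2 / D. It is 1 at stationary points of
    the phase and small where \<phi>' is large compared with h.\<close>
  have eq: "cos (\<phi> t) = F' t - E1 t + E2 t" for t
  proof -
    have "\<phi>' t * \<psi> t + h\<^sup>2 / D t = ((\<phi>' t)\<^sup>2 + h\<^sup>2) / D t"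
      by (simp add: \<psi>_def power2_eq_square add_divide_distrib)
    also have "\<dots> = D t / D t" by (simp add: D_def)
    also have "\<dots> = 1" using D(1)[of t] by simp
    finally have "cos (\<phi> t) = cos (\<phi> t) * (\<phi>' t * \<psi> t + h\<^sup>2 / D t)" by simp
    then show ?thesis by (simp add: F'_def E1_def E2_def algebra_simps)
  qed
  have "((\<lambda>t. F' t - E1 t + E2 t) has_integral
      (F b - F a) - integral {a..b} E1 + integral {a..b} E2) {a..b}"
    by (intro has_integral_add has_integral_diff iF integrable_integral i1 i2)
  then have I: "integral {a..b} (\<lambda>t. cos (\<phi> t)) = (F b - F a) - integral {a..b} E1 + integral {a..b} E2"
    unfolding eq by (rule integral_unique)
  have Fb: "\<bar>F t\<bar> \<le> 1 / (2 * h)" for t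
  proof -
    \<comment> \<open>By the inequality of the means \<psi> is at most 1 / (2 h) in size, so the two
      boundary terms together give 1 / h.\<close>
    have "2 * h * \<bar>\<phi>' t\<bar> \<le> D t"
      using sum_squares_bound[of h "\<bar>\<phi>' t\<bar>"] by (simp add: D_def)
    then have "\<bar>\<psi> t\<bar> \<le> 1 / (2 * h)"
      using D(1)[of t] \<open>h > 0\<close> by (simp add: \<psi>_def abs_divide field_simps)
    then have "\<bar>sin (\<phi> t)\<bar> * \<bar>\<psi> t\<bar> \<le> 1 * (1 / (2 * h))"
      by (intro mult_mono) auto
    then show ?thesis by (simp add: F_def abs_mult)
  qed
  have Eb: "\<bar>E1 t\<bar> \<le> B / h\<^sup>2" if "t \<in> {a..b}" for t
  proof -
    have "\<bar>h\<^sup>2 - (\<phi>' t)\<^sup>2\<bar> \<le> D t" unfolding D_def by (simp add: abs_le_iff)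
    then have "\<bar>\<phi>'' t\<bar> * \<bar>h\<^sup>2 - (\<phi>' t)\<^sup>2\<bar> / (D t)\<^sup>2 \<le> B * D t / (D t)\<^sup>2"
      using B[OF that] by (intro divide_right_mono mult_mono) auto
    also have "\<dots> = B / D t" using D(1)[of t] by (simp add: power2_eq_square)
    also have "\<dots> \<le> B / h\<^sup>2"
      using D[of t] \<open>h > 0\<close> B[OF that] by (intro divide_left_mono) auto
    finally have "\<bar>\<psi>' t\<bar> \<le> B / h\<^sup>2" by (simp add: \<psi>'_def abs_divide abs_mult)
    then have "\<bar>sin (\<phi> t)\<bar> * \<bar>\<psi>' t\<bar> \<le> 1 * (B / h\<^sup>2)" by (intro mult_mono) auto
    then show ?thesis by (simp add: E1_def abs_mult)
  qed
  have "norm (integral {a..b} E1) \<le> integral {a..b} (\<lambda>t. B / h\<^sup>2)"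
    by (rule integral_norm_bound_integral[OF i1]) (use Eb in auto)
  then have b1: "\<bar>integral {a..b} E1\<bar> \<le> (b - a) * (B / h\<^sup>2)" using \<open>a \<le> b\<close> by simp
  have "norm (integral {a..b} E2) \<le> integral {a..b} (\<lambda>t. h\<^sup>2 / D t)"
  proof (rule integral_norm_bound_integral[OF i2 i3])
    fix t
    have "\<bar>cos (\<phi> t)\<bar> * (h\<^sup>2 / D t) \<le> 1 * (h\<^sup>2 / D t)"
      using D(1)[of t] by (intro mult_right_mono) auto
    then show "norm (E2 t) \<le> h\<^sup>2 / D t" using D(1)[of t] by (simp add: E2_def abs_mult)
  qed
  then have b2: "\<bar>integral {a..b} E2\<bar> \<le> integral {a..b} (\<lambda>t. h\<^sup>2 / D t)" by simp
  have "1 / (2 * h) + 1 / (2 * h) = 1 / h" using \<open>h > 0\<close> by (simp add: field_simps)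
  then show ?thesis using I Fb[of a] Fb[of b] b1 b2 unfolding D_def by linarith
qed

text \<open>The bad k depend on t; therefore the defects h^2 / (\<phi>'^2 + h^2) are summed over k
  at fixed t, and integrated afterwards. With h proportional to L^k the boundary and curvature terms
  form convergent geometric series, the latter because \<rho> < L^2.\<close>

lemma cesaro_oscillation:
  fixes \<phi> \<phi>' \<phi>'' :: "nat \<Rightarrow> real \<Rightarrow> real"
  assumes ab: "a \<le> b" and L: "L > 1" and \<rho>: "\<rho> > 0" "\<rho> < L\<^sup>2"
    and d1: "\<And>k t. t \<in> {a..b} \<Longrightarrow> (\<phi> k has_real_derivative \<phi>' k t) (at t)"
    and d2: "\<And>k t. t \<in> {a..b} \<Longrightarrow> (\<phi>' k has_real_derivative \<phi>'' k t) (at t)"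
    and c: "\<And>k. continuous_on {a..b} (\<phi>'' k)"
    and B: "\<And>k t. t \<in> {a..b} \<Longrightarrow> \<bar>\<phi>'' k t\<bar> \<le> C * \<rho> ^ k"
    and dens: "\<And>\<eta>. \<eta> > 0 \<Longrightarrow> \<exists>\<delta>>0. \<exists>N0. \<forall>t\<in>{a..b}. \<forall>N\<ge>N0.
       real (card {k. k < N \<and> \<bar>\<phi>' k t\<bar> < \<delta> * L ^ k}) \<le> \<eta> * real N"
  shows "(\<lambda>N. (\<Sum>k<N. integral {a..b} (\<lambda>t. cos (\<phi> k t))) / real N) \<longlonglongrightarrow> 0"
proof (rule LIMSEQ_I)
  fix \<epsilon> :: real assume "\<epsilon> > 0"
  \<comment> \<open>Makes 2 \<eta> (b - a) N at most \<epsilon> N / 2; the added 1 keeps the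
    denominator positive when a = b.\<close>
  define \<eta> where "\<eta> = \<epsilon> / (4 * (b - a + 1))"
  have \<eta>: "\<eta> > 0" using ab \<open>\<epsilon> > 0\<close> by (simp add: \<eta>_def)
  obtain \<delta> N0 where \<delta>: "\<delta> > 0" and dn: "\<And>t N. t \<in> {a..b} \<Longrightarrow> N \<ge> N0 \<Longrightarrow>
      real (card {k. k < N \<and> \<bar>\<phi>' k t\<bar> < \<delta> * L ^ k}) \<le> \<eta> * real N"
    using dens[OF \<eta>] by blast
  \<comment> \<open>With d^2 = \<delta>^2 \<eta> the defect is at most \<eta> as soon as |\<phi>'|
    \<ge> \<delta> L^k. The remaining times contribute at most 1 each, and at most \<eta> N of them
    lie below N.\<close>
  define d where "d = \<delta> * sqrt \<eta>"
  have d: "d > 0" "d\<^sup>2 = \<delta>\<^sup>2 * \<eta>" using \<delta> \<eta> by (auto simp: d_def power_mult_distrib)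
  define h where "h k = d * L ^ k" for k
  have h: "h k > 0" for k using d L by (simp add: h_def)
  define g where "g k t = (h k)\<^sup>2 / ((\<phi>' k t)\<^sup>2 + (h k)\<^sup>2)" for k t
  have cg: "continuous_on {a..b} (g k)" for k
  proof -
    have "continuous_on {a..b} (\<phi>' k)"
      using d2 by (meson DERIV_isCont continuous_at_imp_continuous_on)
    moreover have "(\<phi>' k t)\<^sup>2 + (h k)\<^sup>2 \<noteq> 0" for t
      using h[of k] by (metis add_nonneg_pos less_irrefl zero_le_power2 zero_less_power)
    ultimately show ?thesis unfolding g_def by (intro continuous_intros) auto
  qed
  have ig: "g k integrable_on {a..b}" for k by (intro integrable_continuous_real cg)
  define e where "e k = 1 / d * (1 / L) ^ k + (b - a) * (C / d\<^sup>2) * (\<rho> / L\<^sup>2) ^ k" for k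
  have "summable e" unfolding e_def using L \<rho>
    by (intro summable_add summable_mult summable_geometric) auto
  moreover have C: "C \<ge> 0" using B[of a 0] ab by auto
  then have e0: "e k \<ge> 0" for k 
    using d(1) L \<rho> ab unfolding e_def by (intro add_nonneg_nonneg mult_nonneg_nonneg) auto
  ultimately have es: "(\<Sum>k<N. e k) \<le> suminf e" for N by (intro sum_le_suminf) auto
  have I: "\<bar>integral {a..b} (\<lambda>t. cos (\<phi> k t))\<bar> \<le> e k + integral {a..b} (g k)" for k
  proof -
    have "\<bar>integral {a..b} (\<lambda>t. cos (\<phi> k t))\<bar>
        \<le> 1 / h k + (b - a) * (C * \<rho> ^ k / (h k)\<^sup>2) + integral {a..b} (\<lambda>t. (h k)\<^sup>2 / ((\<phi>' k t)\<^sup>2 + (h k)\<^sup>2))"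
      using d1 d2 c B by (intro oscillatory_integral_cos ab h) auto
    also have "1 / h k + (b - a) * (C * \<rho> ^ k / (h k)\<^sup>2) = e k"
      by (simp add: e_def h_def power_mult_distrib power_divide power_mult[symmetric] mult.commute)
    finally show ?thesis by (simp add: g_def[abs_def])
  qed
  have gs: "(\<Sum>k<N. g k t) \<le> 2 * \<eta> * real N" if t: "t \<in> {a..b}" and N: "N \<ge> N0" for t N
  proof -
    define S where "S = {k. k < N \<and> \<bar>\<phi>' k t\<bar> < \<delta> * L ^ k}"
    have g1: "g k t \<le> 1" for k
      using h[of k] by (simp add: g_def divide_le_eq add_nonneg_pos)
    have g2: "g k t \<le> \<eta>" if "k < N" "k \<notin> S" for k
    proof -
      have Lk: "L ^ k > 0" using L by simp
      have "\<delta> * L ^ k \<le> \<bar>\<phi>' k t\<bar>" using that by (auto simp: S_def)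
      then have "(\<delta> * L ^ k)\<^sup>2 \<le> (\<phi>' k t)\<^sup>2"
        using \<delta> Lk by (metis abs_le_square_iff abs_of_pos mult_pos_pos)
      then have "\<eta> * (\<delta> * L ^ k)\<^sup>2 \<le> \<eta> * ((\<phi>' k t)\<^sup>2 + (h k)\<^sup>2)"
        using \<eta> by (intro mult_left_mono) (auto intro: add_increasing2)
      moreover have "\<eta> * (\<delta> * L ^ k)\<^sup>2 = (h k)\<^sup>2"
        by (simp add: h_def power_mult_distrib d(2) mult_ac)
      ultimately show ?thesis
        using h[of k] by (simp add: g_def divide_le_eq add_nonneg_pos)
    qed
    have "(\<Sum>k<N. g k t) \<le> (\<Sum>k<N. \<eta> + (if k \<in> S then 1 else 0))"
      using g1 g2 \<eta> by (intro sum_mono) (force intro: order_trans[OF g1])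
    also have "\<dots> = real N * \<eta> + real (card ({..<N} \<inter> S))"
      by (simp add: sum.distrib sum.If_cases)
    also have "{..<N} \<inter> S = S" by (auto simp: S_def)
    also have "real (card S) \<le> \<eta> * real N" unfolding S_def by (rule dn[OF t N])
    finally show ?thesis by (simp add: algebra_simps)
  qed
  obtain N1 :: nat where N1: "suminf e / (\<epsilon> / 2) < real N1" using reals_Archimedean2 by blast
  have "norm ((\<Sum>k<N. integral {a..b} (\<lambda>t. cos (\<phi> k t))) / real N - 0) < \<epsilon>"
    if N: "N \<ge> Suc (max N0 N1)" for N
  proof -
    have "\<bar>\<Sum>k<N. integral {a..b} (\<lambda>t. cos (\<phi> k t))\<bar> \<le> (\<Sum>k<N. e k + integral {a..b} (g k))"
      by (intro order_trans[OF sum_abs] sum_mono I)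
    also have "\<dots> = (\<Sum>k<N. e k) + integral {a..b} (\<lambda>t. \<Sum>k<N. g k t)"
      by (simp add: sum.distrib integral_sum ig)
    also have "integral {a..b} (\<lambda>t. \<Sum>k<N. g k t) \<le> integral {a..b} (\<lambda>t. 2 * \<eta> * real N)"
      using N by (intro integral_le integrable_sum ig gs) auto
    also have "integral {a..b} (\<lambda>t. 2 * \<eta> * real N) = (b - a) * (2 * \<eta> * real N)"
      using ab by simp
    finally have "\<bar>\<Sum>k<N. integral {a..b} (\<lambda>t. cos (\<phi> k t))\<bar> \<le> suminf e + (b - a) * (2 * \<eta> * real N)"
      using es[of N] by linarith
    also have "(b - a) * (2 * \<eta> * real N) \<le> (b - a + 1) * (2 * \<eta> * real N)"
      using \<eta> by (intro mult_right_mono) auto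
    also have "(b - a + 1) * (2 * \<eta> * real N) = \<epsilon> / 2 * real N"
      using ab by (simp add: \<eta>_def field_simps)
    also have "suminf e < \<epsilon> / 2 * real N"
    proof -
      have "suminf e / (\<epsilon> / 2) < real N" using N N1 by linarith
      then show ?thesis using \<open>\<epsilon> > 0\<close> by (simp add: field_simps)
    qed
    finally have "\<bar>\<Sum>k<N. integral {a..b} (\<lambda>t. cos (\<phi> k t))\<bar> < \<epsilon> * real N" by simp
    then show ?thesis using N by (simp add: divide_less_eq abs_divide)
  qed
  then show "\<exists>no. \<forall>N\<ge>no. norm ((\<Sum>k<N. integral {a..b} (\<lambda>t. cos (\<phi> k t))) / real N - 0) < \<epsilon>"
    by blast
qed

lemma has_vector_derivative_sdiffs:
  assumes "\<And>k. (s k has_vector_derivative s' k) (at t)"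
  shows "((\<lambda>t. sdiffs zs (\<lambda>k. s k t) k) has_vector_derivative sdiffs zs s' k) (at t)"
  using assms
proof (induction zs arbitrary: s s' k)
  case (Cons z zs)
  have "((\<lambda>t. sdiffs zs (\<lambda>k. sdiff z (\<lambda>k. s k t) k) k) has_vector_derivative sdiffs zs (sdiff z s') k) (at t)"
    unfolding sdiff_def by (rule Cons.IH) (intro derivative_intros Cons.prems)
  then show ?case by simp
qed simp

text \<open>If all roots of a recurrence valid on a subinterval lay inside the unit circle, a would
  tend to 0 there, against \<open>nostable\<close>. So a dominant root outside the circle exists,
  and its coefficient is bounded below on a smaller interval. The conclusion covers all subintervals
  and all phases: the former allows finitely many frequencies to be treated by nesting, the latter
  allows a kernel to be centred anywhere.\<close>

lemma oscillation_subinterval: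
  fixes a a' \<phi> :: "nat \<Rightarrow> real \<Rightarrow> real"
  assumes hyp: "\<And>z. z \<in> set zs \<Longrightarrow> cmod z \<noteq> 1"
    and nondeg: "\<And>z w q. z \<in> set zs \<Longrightarrow> w \<in> set zs \<Longrightarrow> q \<ge> (1::nat) \<Longrightarrow> z ^ q = w ^ q \<Longrightarrow> z = w"
    and kill: "\<And>t. sdiffs zs (\<lambda>k. complex_of_real (a k t)) = (\<lambda>_. 0)"
    and da: "\<And>k t. (a k has_real_derivative a' k t) (at t)"
    and ca: "\<And>k. continuous_on UNIV (a' k)"
    and d\<phi>: "\<And>k t. (\<phi> k has_real_derivative 2 * pi * a k t) (at t)"
    and nostable: "\<And>p q. \<alpha> \<le> p \<Longrightarrow> p < q \<Longrightarrow> q \<le> \<beta> \<Longrightarrow> \<exists>t\<in>{p<..<q}. \<not> (\<lambda>k. a k t) \<longlonglongrightarrow> 0"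
    and ab: "\<alpha> < \<beta>"
  shows "\<exists>p q. \<alpha> \<le> p \<and> p < q \<and> q \<le> \<beta> \<and> (\<forall>p' q' \<theta>. p \<le> p' \<longrightarrow> p' < q' \<longrightarrow> q' \<le> q \<longrightarrow>
     (\<lambda>N. (\<Sum>k<N. integral {p'..q'} (\<lambda>t. cos (\<phi> k t + \<theta>))) / real N) \<longlonglongrightarrow> 0)"
proof -
  define s where "s t = (\<lambda>k. complex_of_real (a k t))" for t
  define s' where "s' t = (\<lambda>k. complex_of_real (a' k t))" for t
  \<comment> \<open>a shortest recurrence valid on some subinterval has a leading term without zeros on a smaller one\<close>
  define P where "P n \<longleftrightarrow> (\<exists>ys p q. length ys = n \<and> set ys \<subseteq> set zs \<and> \<alpha> \<le> p \<and> p < q \<and> q \<le> \<beta> \<and>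
     (\<forall>t\<in>{p<..<q}. sdiffs ys (s t) = (\<lambda>_. 0)))" for n
  have "P (length zs)" unfolding P_def s_def using kill ab by (intro exI[of _ zs] exI[of _ \<alpha>] exI[of _ \<beta>]) auto
  then have PL: "P (LEAST n. P n)" by (rule LeastI)
  then obtain ys p q where ys: "length ys = (LEAST n. P n)" "set ys \<subseteq> set zs"
    and pq: "\<alpha> \<le> p" "p < q" "q \<le> \<beta>" and kys: "\<And>t. t \<in> {p<..<q} \<Longrightarrow> sdiffs ys (s t) = (\<lambda>_. 0)"
    unfolding P_def by blast
  have "\<exists>z\<in>set ys. cmod z > 1"
  proof (rule ccontr)
    assume "\<not> (\<exists>z\<in>set ys. cmod z > 1)"
    then have lt: "\<forall>z\<in>set ys. cmod z < 1" using hyp ys(2) by (meson linorder_neqE_linordered_idom subsetD)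
    have "(\<lambda>k. a k t) \<longlonglongrightarrow> 0" if "t \<in> {p<..<q}" for t
    proof -
      have "s t \<longlonglongrightarrow> 0" using sdiffs_eq_0_tendsto_0[OF kys[OF that] lt] .
      then show ?thesis using tendsto_of_real_iff[of "\<lambda>k. a k t" 0, where 'a = complex] by (simp add: s_def)
    qed
    then show False using nostable[OF pq] by blast
  qed
  then obtain z1 where z1: "z1 \<in> set ys" "cmod z1 > 1" by blast
  have "Max (cmod ` set ys) \<in> cmod ` set ys" using z1 by (intro Max_in) auto
  then obtain l where l: "l \<in> set ys" "cmod l = Max (cmod ` set ys)" by auto
  have lmax: "cmod z \<le> cmod l" if "z \<in> set ys" for z using that unfolding l(2) by (intro Max_ge) auto
  define \<Lambda> where "\<Lambda> = cmod l"
  have \<Lambda>: "\<Lambda> > 1" using lmax[OF z1(1)] z1(2) by (simp add: \<Lambda>_def)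
  \<comment> \<open>Only one copy of l is removed. Further copies may remain, which is why the
    nondegeneracy condition concludes z = l instead of forbidding it.\<close>
  define ls where "ls = remove1 l ys"
  have ls: "length ls < length ys" "set ls \<subseteq> set ys"
    using l(1) length_pos_if_in_set[OF l(1)] set_remove1_subset[of l ys]
    by (simp_all add: ls_def length_remove1)
  have kl: "sdiff l (sdiffs ls (s t)) = (\<lambda>_. 0)" if "t \<in> {p<..<q}" for t
    using kys[OF that] sdiffs_remove1[OF l(1), of "s t"] by (simp add: ls_def sdiffs_sdiff)
  define u where "u t = sdiffs ls (s t) 0" for t
  have "\<exists>t0\<in>{p<..<q}. u t0 \<noteq> 0"
  proof (rule ccontr)
    assume "\<not> ?thesis"
    then have u0: "u t = 0" if "t \<in> {p<..<q}" for t using that by blast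
    have "sdiffs ls (s t) = (\<lambda>_. 0)" if "t \<in> {p<..<q}" for t
    proof
      fix k
      show "sdiffs ls (s t) k = 0" using sdiff_eq_0_geometric[OF kl[OF that], of k] u0[OF that] by (simp add: u_def)
    qed
    then have "P (length ls)" unfolding P_def using ls ys(2) pq by blast
    then show False using ls(1) ys(1) by (metis not_less_Least)
  qed
  then obtain t0 where t0: "t0 \<in> {p<..<q}" "u t0 \<noteq> 0" by blast
  have ds: "((\<lambda>t. s t k) has_vector_derivative s' t k) (at t)" for k t
    unfolding s_def s'_def
    by (intro derivative_intros) (use da in \<open>simp add: has_real_derivative_iff_has_vector_derivative\<close>)
  have dsd: "((\<lambda>t. sdiffs xs (s t) k) has_vector_derivative sdiffs xs (s' t) k) (at t)" for xs k t
    using has_vector_derivative_sdiffs[of "\<lambda>k t. s t k" "s' t" t xs k] ds by simp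
  \<comment> \<open>The recurrence holds on an open interval and can be differentiated in t, so a'
    obeys the same growth bound as a.\<close>
  have kys': "sdiffs ys (s' t) = (\<lambda>_. 0)" if t: "t \<in> {p<..<q}" for t
  proof
    fix k
    have "eventually (\<lambda>x. x \<in> {p<..<q}) (nhds t)" using t by (intro eventually_nhds_in_open) auto
    then have "eventually (\<lambda>x. sdiffs ys (s x) k = 0) (nhds t)"
      by (rule eventually_mono) (simp add: kys)
    then have "((\<lambda>t. sdiffs ys (s t) k) has_vector_derivative 0) (at t)"
      by (subst has_vector_derivative_cong_ev[where g = "\<lambda>_. 0"]) (use t kys in auto)
    then show "sdiffs ys (s' t) k = 0"
      using dsd vector_derivative_unique_at by metis
  qed
  have "isCont u t0" unfolding u_def using dsd has_vector_derivative_continuous by blast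
  then have "((\<lambda>t. cmod (u t)) \<longlongrightarrow> cmod (u t0)) (at t0)" by (intro tendsto_norm) (simp add: isCont_def)
  then have "eventually (\<lambda>t. cmod (u t) > cmod (u t0) / 2) (at t0)"
    by (rule order_tendstoD) (use t0 in simp)
  then obtain d where d: "d > 0" "\<And>t. t \<noteq> t0 \<Longrightarrow> dist t t0 < d \<Longrightarrow> cmod (u t) > cmod (u t0) / 2"
    unfolding eventually_at by blast
  define c where "c = cmod (u t0) / 2"
  have c: "c > 0" using t0 by (simp add: c_def)
  define e where "e = Min {d, t0 - p, q - t0} / 2"
  have e: "e > 0" "e < d" "e < t0 - p" "e < q - t0" using d t0 by (auto simp: e_def min_def)
  define p1 where "p1 = t0 - e"
  define q1 where "q1 = t0 + e"
  have pq1: "p1 < q1" "\<alpha> \<le> p1" "q1 \<le> \<beta>" using e pq by (auto simp: p1_def q1_def)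
  have in1: "t \<in> {p<..<q}" "cmod (u t) \<ge> c" if "t \<in> {p1..q1}" for t
  proof -
    show "t \<in> {p<..<q}" using that e by (auto simp: p1_def q1_def)
    have "dist t t0 < d" using that e by (auto simp: p1_def q1_def dist_real_def)
    then show "cmod (u t) \<ge> c" using d(2)[of t] by (cases "t = t0") (auto simp: c_def)
  qed
  have "\<exists>K. \<forall>t\<in>{p1..q1}. \<bar>a' k t\<bar> \<le> K" for k
  proof -
    have "bounded (a' k ` {p1..q1})"
      by (intro compact_imp_bounded compact_continuous_image) (auto intro: continuous_on_subset[OF ca])
    then show ?thesis by (auto simp: bounded_iff)
  qed
  then obtain K where K: "\<And>k t. t \<in> {p1..q1} \<Longrightarrow> \<bar>a' k t\<bar> \<le> K k" by metis
  define M where "M = (\<Sum>i<length ys. \<bar>K i\<bar>)"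
  have M: "cmod (s' t i) \<le> M" if "t \<in> {p1..q1}" "i < length ys" for t i
  proof -
    have "cmod (s' t i) \<le> \<bar>K i\<bar>" using K[OF that(1), of i] by (simp add: s'_def)
    also have "\<dots> \<le> M" unfolding M_def using that by (intro member_le_sum) auto
    finally show ?thesis .
  qed
  have M0: "M \<ge> 0" by (auto simp: M_def intro: sum_nonneg)
  \<comment> \<open>Strictly above \<Lambda> to absorb multiple roots, strictly below its square as
    \<open>cesaro_oscillation\<close> requires.\<close>
  define \<rho> where "\<rho> = (\<Lambda> + \<Lambda>\<^sup>2) / 2"
  have LL: "\<Lambda> < \<Lambda>\<^sup>2" using \<Lambda> by (simp add: power2_eq_square)
  have \<rho>: "\<rho> > \<Lambda>" "\<rho> < \<Lambda>\<^sup>2" "\<rho> > 0" using LL \<Lambda> by (auto simp: \<rho>_def)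
  have "\<forall>z\<in>set ys. cmod z < \<rho>" using lmax \<rho>(1) by (force simp: \<Lambda>_def)
  from sdiffs_bound[OF this \<rho>(3)] obtain C where
    C: "\<And>s M k. M \<ge> 0 \<Longrightarrow> sdiffs ys s = (\<lambda>_. 0) \<Longrightarrow> (\<forall>i<length ys. cmod (s i) \<le> M) \<Longrightarrow>
           cmod (s k) \<le> C * M * \<rho> ^ k" by metis
  have a'b: "\<bar>a' k t\<bar> \<le> C * M * \<rho> ^ k" if "t \<in> {p1..q1}" for k t
    using C[OF M0 kys'[OF in1(1)[OF that]], of k] M[OF that] by (simp add: s'_def)
  have dens: "\<exists>\<delta>>0. \<exists>N0. \<forall>t\<in>{p1..q1}. \<forall>N\<ge>N0.
       real (card {k. k < N \<and> \<bar>2 * pi * a k t\<bar> < \<delta> * \<Lambda> ^ k}) \<le> \<eta> * real N" if \<eta>: "\<eta> > 0" for \<eta>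
  proof -
    have "cmod l > 0" using \<Lambda> unfolding \<Lambda>_def by linarith
    moreover have "\<forall>z\<in>set ls. cmod z \<le> cmod l" using lmax ls(2) by blast
    moreover have "\<forall>z\<in>set ls. \<forall>q\<ge>1. z ^ q = l ^ q \<longrightarrow> z = l"
      using nondeg ls(2) ys(2) l(1) by blast
    ultimately obtain \<delta> N0 where \<delta>: "\<delta> > 0" and D: "\<forall>s. sdiff l (sdiffs ls s) = (\<lambda>_. 0) \<longrightarrow> cmod (sdiffs ls s 0) \<ge> c \<longrightarrow>
       (\<forall>N\<ge>N0. real (card {k. k < N \<and> cmod (s k) < \<delta> * cmod l ^ k}) \<le> \<eta> * real N)"
      using sdiffs_density[OF _ _ _ \<eta> c, of l ls] by blast
    have "real (card {k. k < N \<and> \<bar>2 * pi * a k t\<bar> < \<delta> * \<Lambda> ^ k}) \<le> \<eta> * real N"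
      if t: "t \<in> {p1..q1}" and N: "N \<ge> N0" for t N
    proof -
      have "\<bar>a k t\<bar> \<le> \<bar>2 * pi * a k t\<bar>" for k
      proof -
        have "1 * \<bar>a k t\<bar> \<le> (2 * pi) * \<bar>a k t\<bar>" using pi_gt3 by (intro mult_right_mono) auto
        then show ?thesis by (simp add: abs_mult)
      qed
      then have "{k. k < N \<and> \<bar>2 * pi * a k t\<bar> < \<delta> * \<Lambda> ^ k} \<subseteq> {k. k < N \<and> cmod (s t k) < \<delta> * cmod l ^ k}"
        by (auto simp: s_def \<Lambda>_def intro: le_less_trans)
      then have "card {k. k < N \<and> \<bar>2 * pi * a k t\<bar> < \<delta> * \<Lambda> ^ k} \<le> card {k. k < N \<and> cmod (s t k) < \<delta> * cmod l ^ k}"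
        by (intro card_mono) auto
      also have "real \<dots> \<le> \<eta> * real N"
        using D kl[OF in1(1)[OF t]] in1(2)[OF t] N by (auto simp: u_def)
      finally show ?thesis by simp
    qed
    then show ?thesis using \<delta> by blast
  qed
  have "(\<lambda>N. (\<Sum>k<N. integral {p'..q'} (\<lambda>t. cos (\<phi> k t + \<theta>))) / real N) \<longlonglongrightarrow> 0"
    if pq': "p1 \<le> p'" "p' < q'" "q' \<le> q1" for p' q' \<theta>
  proof (rule cesaro_oscillation[where \<phi>' = "\<lambda>k t. 2 * pi * a k t" and \<phi>'' = "\<lambda>k t. 2 * pi * a' k t"
        and L = \<Lambda> and \<rho> = \<rho> and C = "2 * pi * (C * M)"])
    show "((\<lambda>t. \<phi> k t + \<theta>) has_real_derivative 2 * pi * a k t) (at t)" for k t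
      by (auto intro!: derivative_eq_intros d\<phi>)
    show "((\<lambda>t. 2 * pi * a k t) has_real_derivative 2 * pi * a' k t) (at t)" for k t
      by (rule DERIV_cmult[OF da])
    show "continuous_on {p'..q'} (\<lambda>t. 2 * pi * a' k t)" for k
      by (intro continuous_intros continuous_on_subset[OF ca]) auto
    show "\<bar>2 * pi * a' k t\<bar> \<le> 2 * pi * (C * M) * \<rho> ^ k" if "t \<in> {p'..q'}" for k t
    proof -
      have "\<bar>a' k t\<bar> \<le> C * M * \<rho> ^ k" using that pq' by (intro a'b) auto
      then have "(2 * pi) * \<bar>a' k t\<bar> \<le> (2 * pi) * (C * M * \<rho> ^ k)" by (intro mult_left_mono) auto
      then show ?thesis by (simp add: abs_mult mult.assoc)
    qed
    show "\<exists>\<delta>>0. \<exists>N0. \<forall>t\<in>{p'..q'}. \<forall>N\<ge>N0.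
       real (card {k. k < N \<and> \<bar>2 * pi * a k t\<bar> < \<delta> * \<Lambda> ^ k}) \<le> \<eta> * real N" if "\<eta> > 0" for \<eta>
      using dens[OF that] pq' by (meson atLeastAtMost_iff order_trans)
  qed (use pq' \<Lambda> \<rho> in auto)
  then show ?thesis using pq1 by blast
qed

section \<open>Ordinary differential equations\<close>

text \<open>The squared distance q is differentiable even where the solutions meet and satisfies
  |q'| \<le> 2 L q. Multiplied by the matching exponential it is monotone; the sign of the exponent
  is reversed for negative times.\<close>

lemma gronwall_lipschitz:
  fixes F :: "'a::real_inner \<Rightarrow> 'a"
  assumes lip: "\<And>x y. norm (F x - F y) \<le> L * norm (x - y)" and "L \<ge> 0"
    and u: "\<And>t. (u has_vector_derivative F (u t)) (at t)"
    and w: "\<And>t. (w has_vector_derivative F (w t)) (at t)"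
  shows "norm (u t - w t) \<le> exp (L * \<bar>t\<bar>) * norm (u 0 - w 0)"
proof -
  define q where "q t = (u t - w t) \<bullet> (u t - w t)" for t
  define q' where "q' t = 2 * ((u t - w t) \<bullet> (F (u t) - F (w t)))" for t
  have q: "(q has_real_derivative q' t) (at t)" for t
  proof -
    have "((\<lambda>t. u t - w t) has_vector_derivative F (u t) - F (w t)) (at t)"
      by (intro derivative_intros u w)
    then have d: "((\<lambda>t. u t - w t) has_derivative (\<lambda>h. h *\<^sub>R (F (u t) - F (w t)))) (at t)"
      by (simp add: has_vector_derivative_def)
    have "(q has_derivative (\<lambda>h. (u t - w t) \<bullet> (h *\<^sub>R (F (u t) - F (w t)))
        + (h *\<^sub>R (F (u t) - F (w t))) \<bullet> (u t - w t))) (at t)"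
      unfolding q_def by (rule has_derivative_inner[OF d d])
    then show ?thesis
      unfolding has_field_derivative_def q'_def
      by (rule has_derivative_eq_rhs) (simp add: fun_eq_iff inner_commute algebra_simps)
  qed
  have q'b: "\<bar>q' t\<bar> \<le> 2 * L * q t" for t
  proof -
    have "\<bar>(u t - w t) \<bullet> (F (u t) - F (w t))\<bar> \<le> norm (u t - w t) * norm (F (u t) - F (w t))"
      by (rule Cauchy_Schwarz_ineq2)
    also have "\<dots> \<le> norm (u t - w t) * (L * norm (u t - w t))" by (intro mult_left_mono lip) auto
    also have "\<dots> = L * q t" by (simp add: q_def power2_norm_eq_inner[symmetric] power2_eq_square)
    finally show ?thesis by (simp add: q'_def abs_mult)
  qed
  have "q t \<le> exp (2 * L * \<bar>t\<bar>) * q 0"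
  proof (cases "t \<ge> 0")
    case True
    define G where "G s = exp (- (2 * L * s)) * q s" for s
    have "(G has_real_derivative exp (- (2 * L * s)) * (q' s - 2 * L * q s)) (at s)" for s
      unfolding G_def by (rule derivative_eq_intros q refl | simp add: algebra_simps)+
    moreover have "exp (- (2 * L * s)) * (q' s - 2 * L * q s) \<le> 0" for s
      using q'b[of s] by (intro mult_nonneg_nonpos) auto
    ultimately have "G t \<le> G 0"
      using DERIV_nonpos_imp_nonincreasing[OF True, of G] by blast
    then have "exp (- (2 * L * t)) * q t \<le> q 0" by (simp add: G_def)
    then have "exp (2 * L * t) * (exp (- (2 * L * t)) * q t) \<le> exp (2 * L * t) * q 0"
      by (intro mult_left_mono) auto
    then show ?thesis using True by (simp add: mult.assoc[symmetric] exp_add[symmetric])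
  next
    case False
    define G where "G s = exp (2 * L * s) * q s" for s
    have "(G has_real_derivative exp (2 * L * s) * (q' s + 2 * L * q s)) (at s)" for s
      unfolding G_def by (rule derivative_eq_intros q refl | simp add: algebra_simps)+
    moreover have "exp (2 * L * s) * (q' s + 2 * L * q s) \<ge> 0" for s
      using q'b[of s] by (intro mult_nonneg_nonneg) auto
    ultimately have "G t \<le> G 0"
      using DERIV_nonneg_imp_nondecreasing[of t 0 G] False by auto
    then have "exp (2 * L * t) * q t \<le> q 0" by (simp add: G_def)
    then have "exp (- (2 * L * t)) * (exp (2 * L * t) * q t) \<le> exp (- (2 * L * t)) * q 0"
      by (intro mult_left_mono) auto
    then show ?thesis using False by (simp add: mult.assoc[symmetric] exp_add[symmetric])
  qed
  also have "exp (2 * L * \<bar>t\<bar>) * q 0 = (exp (L * \<bar>t\<bar>) * norm (u 0 - w 0))\<^sup>2"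
    by (simp add: q_def power2_norm_eq_inner[symmetric] power_mult_distrib exp_double[symmetric] mult.assoc)
  finally have "(norm (u t - w t))\<^sup>2 \<le> (exp (L * \<bar>t\<bar>) * norm (u 0 - w 0))\<^sup>2"
    by (simp add: q_def power2_norm_eq_inner)
  then show ?thesis by (rule power2_le_imp_le) simp
qed

text \<open>The oriented interval integral covers both signs of t with a single formula.\<close>

lemma exists_primitive:
  fixes f :: "real \<Rightarrow> 'a::euclidean_space"
  assumes "continuous_on UNIV f"
  shows "\<exists>F. F 0 = 0 \<and> (\<forall>t. (F has_vector_derivative f t) (at t))"
proof (intro exI conjI allI)
  define F where "F u = (LBINT y=0..u. f y)" for u :: real
  show "F 0 = 0" unfolding F_def zero_ereal_def by (rule interval_integral_endpoints_same)
  fix t :: real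
  define a where "a = min 0 t - 1"
  define b where "b = max 0 t + 1"
  have "(F has_vector_derivative f t) (at t within {a..b})"
    unfolding F_def zero_ereal_def
    by (rule interval_integral_FTC2)
      (use assms continuous_on_subset in \<open>auto simp: a_def b_def\<close>)
  moreover have "t \<in> interior {a..b}" by (auto simp: a_def b_def)
  ultimately show "(F has_vector_derivative f t) (at t)"
    using at_within_interior[of t "{a..b}"] by (simp only:)
qed

lemma ode_global_solution:
  fixes F :: "'a::euclidean_space \<Rightarrow> 'a"
  assumes lip: "\<And>x y. norm (F x - F y) \<le> L * norm (x - y)" and L: "L > 0"
    and bd: "\<And>x. norm (F x) \<le> K"
  shows "\<exists>u. u 0 = x0 \<and> (\<forall>t. (u has_vector_derivative F (u t)) (at t))"
proof -
  have contF: "continuous_on UNIV F"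
  proof (rule continuous_onI)
    fix x and e :: real assume "e > 0"
    then show "\<exists>d>0. \<forall>x'\<in>UNIV. dist x' x < d \<longrightarrow> dist (F x') (F x) \<le> e"
      using lip L by (intro exI[of _ "e / L"])
        (auto simp: dist_norm field_simps intro: order_trans[OF lip])
  qed
  \<comment> \<open>with this weight the Picard map is a contraction on the whole line at once\<close>
  define E where "E t = exp (2 * L * \<bar>t\<bar>)" for t :: real
  have E: "E t > 0" for t by (simp add: E_def)
  have contE: "continuous_on UNIV E" unfolding E_def by (intro continuous_intros)
  define curve where "curve w t = x0 + E t *\<^sub>R (apply_bcontfun w t)" for w :: "real \<Rightarrow>\<^sub>C 'a" and t
  have contc: "continuous_on UNIV (\<lambda>t. F (curve w t))" for w
    unfolding curve_def
    by (intro continuous_on_compose2[OF contF] continuous_intros contE) auto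
  define P where "P w = (SOME G. G 0 = 0 \<and> (\<forall>t. (G has_vector_derivative F (curve w t)) (at t)))" for w
  have P: "P w 0 = 0" "(P w has_vector_derivative F (curve w t)) (at t)" for w t
    using someI_ex[OF exists_primitive[OF contc[of w]]] by (auto simp: P_def)
  have K: "K \<ge> 0" using bd[of 0] norm_ge_zero order_trans by blast
  have Pb: "norm (P w t) \<le> K * \<bar>t\<bar>" for w t
  proof -
    have "norm (P w t - P w 0) \<le> K * norm (t - 0)"
    proof (rule differentiable_bound[of UNIV "P w" "\<lambda>t h. h *\<^sub>R F (curve w t)"])
      show "(P w has_derivative (\<lambda>h. h *\<^sub>R F (curve w s))) (at s within UNIV)" for s
        using P(2) by (simp add: has_vector_derivative_def)
      show "onorm (\<lambda>h. h *\<^sub>R F (curve w s)) \<le> K" for s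
        using bd by (intro onorm_bound K) (simp add: mult.commute[of K] mult_left_mono)
    qed auto
    then show ?thesis by (simp add: P)
  qed
  define Q where "Q w t = inverse (E t) *\<^sub>R P w t" for w t
  \<comment> \<open>The Picard image grows at most like K |t|, which the exponential weight
    dominates; so Q w is bounded and the map stays in the space of bounded continuous
    functions.\<close>
  have Eb: "\<bar>t\<bar> / E t \<le> 1 / (2 * L)" for t
  proof -
    have "2 * L * \<bar>t\<bar> \<le> E t" using exp_ge_add_one_self[of "2 * L * \<bar>t\<bar>"] unfolding E_def by linarith
    then show ?thesis using L E[of t] by (simp add: field_simps)
  qed
  have Qc: "Q w \<in> bcontfun" for w
  proof -
    have "continuous_on UNIV (Q w)"
    proof -
      have "continuous_on UNIV (P w)"
        using P(2) by (meson continuous_at_imp_continuous_on has_vector_derivative_continuous)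
      then show ?thesis unfolding Q_def using E
        by (intro continuous_intros contE) (metis less_irrefl)
    qed
    moreover have "norm (Q w t) \<le> K * (1 / (2 * L))" for t
    proof -
      have "norm (Q w t) = norm (P w t) / E t" using E[of t] by (simp add: Q_def divide_inverse)
      also have "\<dots> \<le> K * \<bar>t\<bar> / E t" using E[of t] Pb by (intro divide_right_mono) auto
      also have "\<dots> = K * (\<bar>t\<bar> / E t)" by simp
      also have "\<dots> \<le> K * (1 / (2 * L))" by (intro mult_left_mono Eb K)
      finally show ?thesis .
    qed
    ultimately show ?thesis by (intro bcontfun_normI) auto
  qed
  define T where "T w = Bcontfun (Q w)" for w
  have T: "apply_bcontfun (T w) t = Q w t" for w t by (simp add: T_def Bcontfun_inverse Qc)
  have "dist (T w) (T v) \<le> 1/2 * dist w v" for w v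
  proof (rule dist_bound)
    fix t
    define d where "d = dist w v"
    have d: "norm (apply_bcontfun w s - apply_bcontfun v s) \<le> d" for s
      unfolding d_def using dist_bounded[of w s v] by (simp add: dist_norm)
    have Fd: "norm (F (curve w s) - F (curve v s)) \<le> L * (E s * d)" for s
    proof -
      have "norm (curve w s - curve v s) = E s * norm (apply_bcontfun w s - apply_bcontfun v s)"
        using E[of s] by (simp add: curve_def scaleR_diff_right[symmetric])
      also have "\<dots> \<le> E s * d" using E[of s] d[of s] by (intro mult_left_mono) auto
      finally have "L * norm (curve w s - curve v s) \<le> L * (E s * d)" using L by (intro mult_left_mono) auto
      then show ?thesis using lip order_trans by blast
    qed
    define D where "D s = P w s - P v s" for s
    have D: "(D has_vector_derivative F (curve w s) - F (curve v s)) (at s)" for s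
      unfolding D_def by (intro derivative_intros P)
    have D0: "D 0 = 0" by (simp add: D_def P)
    have dn: "d \<ge> 0" by (simp add: d_def)
    have "norm (D t) \<le> E t * d / 2"
    proof (cases "t \<ge> 0")
      case True
      \<comment> \<open>The derivative of g bounds that of D, and g t is E t * d / 2. The
        contraction factor 1/2 comes from the weight having twice the Lipschitz constant as its
        rate.\<close>
      define g where "g s = exp (2 * L * s) * d / 2" for s
      have g: "(g has_vector_derivative L * (exp (2 * L * s) * d)) (at s)" for s
        unfolding g_def has_real_derivative_iff_has_vector_derivative[symmetric]
        by (rule derivative_eq_intros refl | simp)+
      have "norm (D t - D 0) \<le> g t - g 0"
      proof (cases "t = 0")
        case False
        show ?thesis
        proof (rule differentiable_bound_general[where f = D and \<phi> = g])
          show "0 < t" using True False by simp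
          show "continuous_on {0..t} g" "continuous_on {0..t} D"
            using g D by (meson continuous_at_imp_continuous_on has_vector_derivative_continuous)+
          show "norm (F (curve w s) - F (curve v s)) \<le> L * (exp (2 * L * s) * d)" if "0 < s" for s
            using Fd[of s] that by (simp add: E_def)
        qed (use g D in auto)
      qed simp
      also have "\<dots> \<le> g t" using dn by (simp add: g_def)
      finally show ?thesis using True D0 by (simp add: g_def E_def)
    next
      case False
      define g where "g s = exp (2 * L * s) * d / 2" for s
      have g: "(g has_vector_derivative L * (exp (2 * L * s) * d)) (at s)" for s
        unfolding g_def has_real_derivative_iff_has_vector_derivative[symmetric]
        by (rule derivative_eq_intros refl | simp)+
      \<comment> \<open>Negative times are reflected, since
        \<open>differentiable_bound_general\<close> runs forward from 0.\<close>
      define D' where "D' s = D (- s)" for s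
      have D': "(D' has_vector_derivative - (F (curve w (- s)) - F (curve v (- s)))) (at s)" for s
      proof -
        have "((D \<circ> uminus) has_vector_derivative (-1) *\<^sub>R (F (curve w (- s)) - F (curve v (- s)))) (at s)"
          by (rule vector_diff_chain_at) (auto intro!: derivative_eq_intros D)
        then show ?thesis by (simp add: D'_def[abs_def] o_def)
      qed
      have "norm (D' (- t) - D' 0) \<le> g (- t) - g 0"
      proof (rule differentiable_bound_general[where f = "D'" and \<phi> = g])
        show "0 < - t" using False by simp
        show "continuous_on {0..- t} g" "continuous_on {0..- t} D'"
          using g D' by (meson continuous_at_imp_continuous_on has_vector_derivative_continuous)+
        show "norm (- (F (curve w (- s)) - F (curve v (- s)))) \<le> L * (exp (2 * L * s) * d)" if "0 < s" for s
          using Fd[of "- s"] that by (simp add: E_def norm_minus_commute)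
      qed (use g D' in auto)
      also have "\<dots> \<le> g (- t)" using dn by (simp add: g_def)
      finally show ?thesis using False D0 by (simp add: g_def E_def D'_def)
    qed
    then have "inverse (E t) * norm (D t) \<le> inverse (E t) * (E t * d / 2)"
      using E[of t] by (intro mult_left_mono) auto
    also have "\<dots> = d / 2" using E[of t] by simp
    finally show "dist (apply_bcontfun (T w) t) (apply_bcontfun (T v) t) \<le> 1/2 * dist w v"
      using E[of t] by (simp add: T Q_def dist_norm D_def d_def scaleR_diff_right[symmetric])
  qed
  then obtain w where w: "T w = w"
    using banach_fix_type[of "1/2" T] by auto
  have "P w t = E t *\<^sub>R apply_bcontfun w t" for t
  proof -
    have "apply_bcontfun w t = Q w t" using T[of w t] w by simp
    then show ?thesis using E[of t] by (simp add: Q_def)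
  qed
  then have cw: "curve w t = x0 + P w t" for t by (simp add: curve_def)
  show ?thesis
  proof (intro exI[of _ "curve w"] conjI allI)
    show "curve w 0 = x0" by (simp add: cw P)
    have "((\<lambda>t. x0 + P w t) has_vector_derivative 0 + F (curve w t)) (at t)" for t
      by (intro derivative_intros P)
    then show "(curve w has_vector_derivative F (curve w t)) (at t)" for t
      unfolding cw[abs_def] by simp
  qed
qed

section \<open>The torus and the flow of a vector field\<close>

lemma to_torus_diff: "to_torus (a - b) = to_torus a - to_torus b"
  by (simp add: minus_torus.abs_eq)

lemma to_torus_0: "to_torus 0 = 0"
  by (simp add: zero_torus_def)

lemma to_torus_add_int:
  assumes "\<forall>i. z $ i \<in> \<int>"
  shows "to_torus (v + z) = to_torus v"
  using assms by (simp add: to_torus_eq_iff)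

text \<open>The distance is an infimum over lifts of both points; an integer translation carries the
  first lift to the prescribed one.\<close>

lemma dist_torus_less_lift:
  assumes "dist (to_torus a) y < e"
  shows "\<exists>b. to_torus b = y \<and> dist a b < e"
proof -
  have "{dist a' b | a' b. to_torus a' = to_torus a \<and> to_torus b = y} \<noteq> {}"
    using to_torus_surj[of y] by auto
  then obtain a' b where ab: "to_torus a' = to_torus a" "to_torus b = y" "dist a' b < e"
    using cInf_lessD[of "{dist a' b | a' b. to_torus a' = to_torus a \<and> to_torus b = y}" e] assms
    unfolding dist_torus_def by auto
  have "to_torus (b + (a - a')) = to_torus b"
    using ab(1) by (intro to_torus_add_int) (metis to_torus_eq_iff vector_minus_component)
  moreover have "dist a (b + (a - a')) = dist a' b" by (simp add: dist_norm)
  ultimately show ?thesis using ab by (intro exI[of _ "b + (a - a')"]) auto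
qed

lemma open_image_to_torus:
  assumes "open S"
  shows "open (to_torus ` S)"
  unfolding open_dist
proof
  fix x assume "x \<in> to_torus ` S"
  then obtain a where a: "a \<in> S" "x = to_torus a" by auto
  then obtain e where e: "e > 0" "\<And>b. dist b a < e \<Longrightarrow> b \<in> S" using assms unfolding open_dist by blast
  have "y \<in> to_torus ` S" if "dist y x < e" for y
    using dist_torus_less_lift[of a y e] that e a by (metis dist_commute imageI)
  then show "\<exists>e>0. \<forall>y. dist y x < e \<longrightarrow> y \<in> to_torus ` S" using e by blast
qed

text \<open>The topology of the metric is the quotient topology, so openness, closedness and
  continuity can be tested on lifts.\<close>

lemma open_torus_iff: "open S \<longleftrightarrow> open {v. to_torus v \<in> S}"
proof
  assume "open S"
  then show "open {v. to_torus v \<in> S}"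
    using continuous_on_open_vimage[of UNIV to_torus] continuous_on_to_torus[of UNIV]
    by (auto simp: vimage_def)
next
  assume "open {v. to_torus v \<in> S}"
  then have "open (to_torus ` {v. to_torus v \<in> S})" by (rule open_image_to_torus)
  moreover have "to_torus ` {v. to_torus v \<in> S} = S"
  proof
    show "S \<subseteq> to_torus ` {v. to_torus v \<in> S}"
    proof
      fix x assume "x \<in> S"
      moreover obtain v where "to_torus v = x" using to_torus_surj by blast
      ultimately show "x \<in> to_torus ` {v. to_torus v \<in> S}" by blast
    qed
  qed auto
  ultimately show "open S" by simp
qed

text \<open>Makes \<open>borel_prod\<close> available for the torus times the real line, so that the
  time sections of Borel sets depend measurably on the base point.\<close>

instance torus :: (finite) second_countable_topology
proof
  obtain B :: "(real^'a) set set" where B: "countable B" "topological_basis B"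
    using ex_countable_basis by blast
  have "topological_basis ((`) to_torus ` B)"
  proof (rule topological_basisI)
    fix U assume "U \<in> (`) to_torus ` B"
    then show "open U" using B(2) by (auto intro: open_image_to_torus topological_basis_open)
  next
    fix U :: "'a torus set" and x assume U: "open U" "x \<in> U"
    obtain a where a: "to_torus a = x" using to_torus_surj by blast
    have "open {v. to_torus v \<in> U}" "a \<in> {v. to_torus v \<in> U}"
      using U a open_torus_iff by auto
    then obtain C where "C \<in> B" "a \<in> C" "C \<subseteq> {v. to_torus v \<in> U}"
      by (rule topological_basisE[OF B(2)])
    then show "\<exists>C\<in>(`) to_torus ` B. x \<in> C \<and> C \<subseteq> U" using a by (intro bexI[of _ "to_torus ` C"]) auto
  qed
  then have "open = generate_topology ((`) to_torus ` B)"
    by (rule topological_basis_imp_subbasis)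
  then show "\<exists>B::'a torus set set. countable B \<and> open = generate_topology B"
    using B(1) by blast
qed

lemma compact_UNIV_torus: "compact (UNIV :: ('n::finite) torus set)"
proof -
  have "to_torus ` cbox 0 (1 :: real^'n) = UNIV"
  proof (intro set_eqI iffI UNIV_I)
    fix x :: "'n torus"
    obtain a where a: "to_torus a = x" using to_torus_surj by blast
    define z :: "real^'n" where "z = (\<chi> i. - of_int \<lfloor>a $ i\<rfloor>)"
    have "to_torus (a + z) = x" using a by (subst to_torus_add_int) (auto simp: z_def)
    moreover have "a + z \<in> cbox 0 1"
      by (auto simp: mem_box_cart z_def) linarith+
    ultimately show "x \<in> to_torus ` cbox 0 1" by blast
  qed
  then show ?thesis
    using compact_continuous_image[OF continuous_on_to_torus compact_cbox] by metis
qed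

lemma measurable_to_torus [measurable]: "to_torus \<in> borel_measurable borel"
  by (rule borel_measurable_continuous_onI) (rule continuous_on_to_torus)

lemma sets_torus_measure [simp]: "sets torus_measure = sets borel"
  by (simp add: torus_measure_def)

text \<open>The full preimage is covered by countably many integer translates of its part in the
  fundamental cube.\<close>

lemma null_sets_torus_measure_iff:
  fixes N :: "('n::finite) torus set"
  assumes [measurable]: "N \<in> sets borel"
  shows "N \<in> null_sets torus_measure \<longleftrightarrow> {v. to_torus v \<in> N} \<in> null_sets lborel"
proof -
  define Q where "Q = {v :: real^'n. \<forall>i. 0 \<le> v $ i \<and> v $ i < 1}"
  have Q: "Q \<in> sets borel" unfolding Q_def by measurable
  have [measurable]: "{v. to_torus v \<in> N} \<in> sets borel" by measurable
  have mt: "to_torus \<in> restrict_space lborel Q \<rightarrow>\<^sub>M borel"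
    by (rule measurable_restrict_space1) simp
  have "emeasure torus_measure N = emeasure (restrict_space lborel Q) (to_torus -` N \<inter> space (restrict_space lborel Q))"
    unfolding torus_measure_def Q_def[symmetric] by (rule emeasure_distr[OF mt]) simp
  also have "to_torus -` N \<inter> space (restrict_space lborel Q) = {v. to_torus v \<in> N} \<inter> Q"
    by (auto simp: space_restrict_space)
  also have "emeasure (restrict_space lborel Q) ({v. to_torus v \<in> N} \<inter> Q) = emeasure lborel ({v. to_torus v \<in> N} \<inter> Q)"
    using Q by (intro emeasure_restrict_space) auto
  finally have e: "emeasure torus_measure N = emeasure lborel ({v. to_torus v \<in> N} \<inter> Q)" .
  show ?thesis
  proof
    assume "{v. to_torus v \<in> N} \<in> null_sets lborel"
    then have "{v. to_torus v \<in> N} \<inter> Q \<in> null_sets lborel" using Q by (simp add: null_set_Int2)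
    then show "N \<in> null_sets torus_measure" using e by (simp add: null_sets_def)
  next
    assume "N \<in> null_sets torus_measure"
    then have n: "{v. to_torus v \<in> N} \<inter> Q \<in> null_sets lborel" using e Q by (auto simp: null_sets_def)
    define z :: "('n \<Rightarrow> int) \<Rightarrow> real^'n" where "z g = (\<chi> i. of_int (g i))" for g
    have "{v. v - z g \<in> {v. to_torus v \<in> N} \<inter> Q} \<in> null_sets lborel" for g
      by (rule null_sets_translation[OF n])
    then have "(\<Union>g. {v. v - z g \<in> {v. to_torus v \<in> N} \<inter> Q}) \<in> null_sets lborel"
      by (intro null_sets_UN)
    moreover have "{v. to_torus v \<in> N} = (\<Union>g. {v. v - z g \<in> {v. to_torus v \<in> N} \<inter> Q})"
    proof (intro set_eqI iffI)
      fix v assume v: "v \<in> {v. to_torus v \<in> N}"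
      define g where "g i = \<lfloor>v $ i\<rfloor>" for i
      have "to_torus (v + (- z g)) = to_torus v" by (rule to_torus_add_int) (simp add: z_def)
      moreover have "v - z g \<in> Q" unfolding Q_def z_def g_def by (auto; linarith)
      ultimately show "v \<in> (\<Union>g. {v. v - z g \<in> {v. to_torus v \<in> N} \<inter> Q})"
        using v by (intro UN_I[of g]) auto
    next
      fix v assume "v \<in> (\<Union>g. {v. v - z g \<in> {v. to_torus v \<in> N} \<inter> Q})"
      then obtain g where "to_torus (v - z g) \<in> N" by auto
      moreover have "to_torus (v + (- z g)) = to_torus v" by (rule to_torus_add_int) (simp add: z_def)
      ultimately show "v \<in> {v. to_torus v \<in> N}" by simp
    qed
    ultimately show "{v. to_torus v \<in> N} \<in> null_sets lborel" by simp
  qed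
qed

lemma continuous_on_lipschitz_flow:
  fixes F :: "'a::metric_space \<Rightarrow> real \<Rightarrow> 'b::metric_space"
  assumes F: "\<And>x y s t. dist (F x t) (F y s) \<le> exp (L * \<bar>t\<bar>) * dist x y + \<bar>t - s\<bar>"
  shows "continuous_on S (\<lambda>(x, t). F x t)"
proof -
  have "isCont (\<lambda>(x, t). F x t) p" for p
  proof -
    obtain x t where p: "p = (x, t)" by (cases p)
    have "((\<lambda>q. exp (L * \<bar>t\<bar>) * dist x (fst q) + \<bar>t - snd q\<bar>) \<longlongrightarrow> exp (L * \<bar>t\<bar>) * dist x (fst p) + \<bar>t - snd p\<bar>) (at p)"
      by (intro tendsto_intros)
    then have lim: "((\<lambda>q. exp (L * \<bar>t\<bar>) * dist x (fst q) + \<bar>t - snd q\<bar>) \<longlongrightarrow> 0) (at p)"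
      by (simp add: p)
    have bd: "norm (dist ((\<lambda>(x, t). F x t) q) (F x t)) \<le> exp (L * \<bar>t\<bar>) * dist x (fst q) + \<bar>t - snd q\<bar>" for q
      using F[of x t "fst q" "snd q"] by (simp add: case_prod_beta dist_commute)
    have "((\<lambda>q. dist ((\<lambda>(x, t). F x t) q) (F x t)) \<longlongrightarrow> 0) (at p)"
      by (rule Lim_null_comparison[OF always_eventually[OF allI] lim]) (rule bd)
    then have "((\<lambda>(x, t). F x t) \<longlongrightarrow> F x t) (at p)" by (rule iffD2[OF tendsto_dist_iff])
    then show ?thesis by (simp add: isCont_def p)
  qed
  then show ?thesis by (simp add: continuous_at_imp_continuous_on)
qed

section \<open>The flow of a Lipschitz unit field, on the lift and on the torus\<close>

locale torus_field =
  fixes V :: "('n::finite) torus \<Rightarrow> real^'n" and L :: real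
  assumes norm_V: "norm (V x) = 1"
    and L_pos: "L > 0"
    and lipschitz: "norm (V (to_torus v) - V (to_torus w)) \<le> L * norm (v - w)"
begin

definition lift_flow :: "real^'n \<Rightarrow> real \<Rightarrow> real^'n" where
  "lift_flow v = (SOME u. u 0 = v \<and> (\<forall>t. (u has_vector_derivative V (to_torus (u t))) (at t)))"

lemma lift_flow: "lift_flow v 0 = v" "(lift_flow v has_vector_derivative V (to_torus (lift_flow v t))) (at t)"
proof -
  have "\<exists>u. u 0 = v \<and> (\<forall>t. (u has_vector_derivative V (to_torus (u t))) (at t))"
    by (rule ode_global_solution[of "\<lambda>v. V (to_torus v)" L 1]) (auto simp: norm_V L_pos lipschitz)
  from someI_ex[OF this] show "lift_flow v 0 = v"
    "(lift_flow v has_vector_derivative V (to_torus (lift_flow v t))) (at t)"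
    by (auto simp: lift_flow_def)
qed

lemma lift_flow_gronwall:
  assumes "\<And>t. (u has_vector_derivative V (to_torus (u t))) (at t)"
    "\<And>t. (w has_vector_derivative V (to_torus (w t))) (at t)"
  shows "norm (u t - w t) \<le> exp (L * \<bar>t\<bar>) * norm (u 0 - w 0)"
  by (rule gronwall_lipschitz[of "\<lambda>v. V (to_torus v)"]) (use assms lipschitz L_pos in auto)

lemma lift_flow_unique:
  assumes "\<And>t. (u has_vector_derivative V (to_torus (u t))) (at t)"
  shows "u t = lift_flow (u 0) t"
  using lift_flow_gronwall[OF assms lift_flow(2), of t "u 0"] by (simp add: lift_flow(1))

lemma lift_flow_lipschitz: "norm (lift_flow v t - lift_flow w t) \<le> exp (L * \<bar>t\<bar>) * norm (v - w)"
  using lift_flow_gronwall[OF lift_flow(2) lift_flow(2), of v t w] by (simp add: lift_flow(1))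

lemma lift_flow_speed: "norm (lift_flow v t - lift_flow v s) \<le> \<bar>t - s\<bar>"
proof -
  have "norm (lift_flow v t - lift_flow v s) \<le> 1 * norm (t - s)"
  proof (rule differentiable_bound[of UNIV "lift_flow v" "\<lambda>t h. h *\<^sub>R V (to_torus (lift_flow v t))"])
    show "(lift_flow v has_derivative (\<lambda>h. h *\<^sub>R V (to_torus (lift_flow v t)))) (at t within UNIV)" for t
      using lift_flow(2) by (simp add: has_vector_derivative_def)
    show "onorm (\<lambda>h. h *\<^sub>R V (to_torus (lift_flow v t))) \<le> 1" for t
      by (intro onorm_bound) (auto simp: norm_V)
  qed auto
  then show ?thesis by simp
qed

lemma lift_flow_add: "lift_flow (lift_flow v s) t = lift_flow v (s + t)"
proof -
  have "((lift_flow v \<circ> (\<lambda>t. s + t)) has_vector_derivative 1 *\<^sub>R V (to_torus (lift_flow v (s + t)))) (at t)" for t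
    by (rule vector_diff_chain_at) (auto intro!: derivative_eq_intros lift_flow(2))
  then have "((\<lambda>t. lift_flow v (s + t)) has_vector_derivative V (to_torus (lift_flow v (s + t)))) (at t)" for t
    by (simp add: o_def)
  from lift_flow_unique[OF this] show ?thesis by simp
qed

lemma lift_flow_inverse: "lift_flow (lift_flow v t) (- t) = v"
  by (simp add: lift_flow_add lift_flow(1))

lemma lift_flow_joint:
  "norm (lift_flow v t - lift_flow w s) \<le> exp (L * \<bar>t\<bar>) * norm (v - w) + \<bar>t - s\<bar>"
proof -
  have "norm (lift_flow v t - lift_flow w s) \<le> norm (lift_flow v t - lift_flow w t) + norm (lift_flow w t - lift_flow w s)"
    using norm_triangle_ineq[of "lift_flow v t - lift_flow w t" "lift_flow w t - lift_flow w s"] by simp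
  then show ?thesis using lift_flow_lipschitz[of v t w] lift_flow_speed[of w t s] by linarith
qed

text \<open>Justifies the definite description in \<open>flow_line\<close>. A lift of an integral
  curve through the point starts at v + z with z integral, and by periodicity of V and uniqueness it
  is the solution from v translated by z.\<close>

lemma flow_line_eq: "flow_line V (to_torus v) = (\<lambda>t. to_torus (lift_flow v t))"
  unfolding flow_line_def
proof (rule the_equality)
  show "integral_curve V (\<lambda>t. to_torus (lift_flow v t)) \<and> to_torus (lift_flow v 0) = to_torus v"
    unfolding integral_curve_def using lift_flow by (auto intro!: exI[of _ "lift_flow v"])
  fix g assume "integral_curve V g \<and> g 0 = to_torus v"
  then obtain c where c: "\<And>t. g t = to_torus (c t)" "\<And>t. (c has_vector_derivative V (g t)) (at t)"
    and g0: "g 0 = to_torus v" by (auto simp: integral_curve_def)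
  define z where "z = c 0 - v"
  have "to_torus (c 0) = to_torus v" using c(1)[of 0] g0 by simp
  then have z: "\<forall>i. z $ i \<in> \<int>" by (simp add: to_torus_eq_iff z_def)
  have per: "to_torus (w + z) = to_torus w" for w by (rule to_torus_add_int[OF z])
  have "((\<lambda>t. lift_flow v t + z) has_vector_derivative V (to_torus (lift_flow v t)) + 0) (at t)" for t
    by (intro derivative_intros lift_flow(2))
  then have "((\<lambda>t. lift_flow v t + z) has_vector_derivative V (to_torus (lift_flow v t + z))) (at t)" for t
    by (simp add: per)
  from lift_flow_unique[OF this] have a: "lift_flow v t + z = lift_flow (v + z) t" for t
    by (simp add: lift_flow(1))
  have "c t = lift_flow (c 0) t" for t by (rule lift_flow_unique) (use c in simp)
  moreover have "c 0 = v + z" by (simp add: z_def)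
  ultimately have "c t = lift_flow v t + z" for t by (simp add: a)
  then show "g = (\<lambda>t. to_torus (lift_flow v t))" using c(1) per by (simp add: fun_eq_iff)
qed

lemma dist_flow_line: "dist (flow_line V x t) (flow_line V y s) \<le> exp (L * \<bar>t\<bar>) * dist x y + \<bar>t - s\<bar>"
proof (rule field_le_epsilon)
  fix e :: real assume "e > 0"
  obtain v where v: "to_torus v = x" using to_torus_surj by blast
  have "dist (to_torus v) y < dist x y + e / exp (L * \<bar>t\<bar>)" using v \<open>e > 0\<close> by simp
  then obtain w where w: "to_torus w = y" "dist v w < dist x y + e / exp (L * \<bar>t\<bar>)"
    using dist_torus_less_lift by blast
  have "dist (flow_line V x t) (flow_line V y s) \<le> dist (lift_flow v t) (lift_flow w s)"
    unfolding v[symmetric] w(1)[symmetric] flow_line_eq by (rule dist_to_torus_le)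
  also have "\<dots> \<le> exp (L * \<bar>t\<bar>) * dist v w + \<bar>t - s\<bar>" using lift_flow_joint by (simp add: dist_norm)
  also have "exp (L * \<bar>t\<bar>) * dist v w \<le> exp (L * \<bar>t\<bar>) * (dist x y + e / exp (L * \<bar>t\<bar>))"
    using w by (intro mult_left_mono) auto
  also have "\<dots> = exp (L * \<bar>t\<bar>) * dist x y + e" by (simp add: algebra_simps)
  finally show "dist (flow_line V x t) (flow_line V y s) \<le> exp (L * \<bar>t\<bar>) * dist x y + \<bar>t - s\<bar> + e" by simp
qed

lemma continuous_on_flow_line: "continuous_on S (\<lambda>(x, t). flow_line V x t)"
  by (rule continuous_on_lipschitz_flow) (rule dist_flow_line)

lemma continuous_on_lift_flow: "continuous_on S (\<lambda>(v, t). lift_flow v t)"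
  by (rule continuous_on_lipschitz_flow[where L = L]) (simp add: dist_norm lift_flow_joint)

text \<open>Mean value estimate for the curve minus its linear motion. Two arbitrary times are
  compared, instead of one with 0, because local injectivity and the charts need strict
  differentiability.\<close>

lemma lift_flow_almost_straight:
  assumes "\<And>\<tau>. \<bar>\<tau>\<bar> < r \<Longrightarrow> norm (V (to_torus (lift_flow v \<tau>)) - w) \<le> \<eta>" "\<bar>t\<bar> < r" "\<bar>s\<bar> < r"
  shows "norm (lift_flow v t - lift_flow v s - (t - s) *\<^sub>R w) \<le> \<eta> * \<bar>t - s\<bar>"
proof -
  define g where "g t = lift_flow v t - t *\<^sub>R w" for t
  have \<eta>: "\<eta> \<ge> 0" using assms(1)[of t] assms(2) norm_ge_zero order_trans by blast
  have "norm (g t - g s) \<le> \<eta> * norm (t - s)"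
  proof (rule differentiable_bound[of "{-r<..<r}" g "\<lambda>t h. h *\<^sub>R (V (to_torus (lift_flow v t)) - w)"])
    fix \<tau> assume \<tau>: "\<tau> \<in> {-r<..<r}"
    have "(g has_vector_derivative V (to_torus (lift_flow v \<tau>)) - 1 *\<^sub>R w) (at \<tau>)"
      unfolding g_def by (auto intro!: derivative_eq_intros lift_flow(2))
    then show "(g has_derivative (\<lambda>h. h *\<^sub>R (V (to_torus (lift_flow v \<tau>)) - w))) (at \<tau> within {-r<..<r})"
      by (simp add: has_vector_derivative_def has_derivative_at_withinI)
    have "norm (V (to_torus (lift_flow v \<tau>)) - w) \<le> \<eta>" using \<tau> by (intro assms(1)) auto
    then show "onorm (\<lambda>h. h *\<^sub>R (V (to_torus (lift_flow v \<tau>)) - w)) \<le> \<eta>"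
      by (intro onorm_bound \<eta>) (simp add: mult.commute[of \<eta>] mult_left_mono)
  qed (use assms in auto)
  then show ?thesis by (simp add: g_def algebra_simps)
qed

end

text \<open>The derivative of the lift is continuous and periodic, so its bound on the unit cube is
  global. The maximum with 1 makes the constant positive.\<close>

lemma C2_unit_vector_field_lipschitz:
  assumes "C2_unit_vector_field V"
  shows "\<exists>L. torus_field V L"
proof -
  define F where "F v = V (to_torus v)" for v
  obtain F' F'' where F': "\<And>x. (F has_derivative blinfun_apply (F' x)) (at x)"
    and F'': "\<And>x. (F' has_derivative blinfun_apply (F'' x)) (at x)"
    using assms unfolding C2_unit_vector_field_def C2_def F_def[abs_def] by blast
  have "continuous_on UNIV F'" using F'' by (meson has_derivative_continuous continuous_at_imp_continuous_on)
  then have "bounded (F' ` cbox 0 1)"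
    by (intro compact_imp_bounded compact_continuous_image compact_cbox) (auto intro: continuous_on_subset)
  then obtain K where K: "\<And>x. x \<in> cbox 0 1 \<Longrightarrow> norm (F' x) \<le> K" by (auto simp: bounded_iff)
  have per: "F' (x + z) = F' x" if "\<forall>i. z $ i \<in> \<int>" for x z
  proof -
    have "((\<lambda>x. F (x + z)) has_derivative (\<lambda>h. blinfun_apply (F' (x + z)) (h + 0))) (at x)"
      by (rule has_derivative_compose[of "\<lambda>x. x + z", OF _ F', unfolded o_def])
        (auto intro!: derivative_eq_intros)
    moreover have "F (x + z) = F x" for x unfolding F_def using to_torus_add_int[OF that] by metis
    ultimately have "blinfun_apply (F' (x + z)) = blinfun_apply (F' x)"
      using has_derivative_unique[OF _ F'] by (simp add: F_def[abs_def])
    then show ?thesis by (simp add: blinfun_apply_inject)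
  qed
  have Kb: "norm (F' x) \<le> K" for x
  proof -
    define z :: "real^'a" where "z = (\<chi> i. - of_int \<lfloor>x $ i\<rfloor>)"
    have "x + z \<in> cbox 0 1" by (auto simp: mem_box_cart z_def) linarith+
    moreover have "F' (x + z) = F' x" by (rule per) (simp add: z_def)
    ultimately show ?thesis using K by metis
  qed
  have "norm (F x - F y) \<le> max K 1 * norm (x - y)" for x y
    by (rule differentiable_bound[of UNIV F "\<lambda>x. blinfun_apply (F' x)"])
      (use F' Kb in \<open>auto simp: norm_blinfun.rep_eq[symmetric] simp: le_max_iff_disj\<close>)
  then show ?thesis using assms
    by (intro exI[of _ "max K 1"]) (auto simp: torus_field_def F_def C2_unit_vector_field_def)
qed

section \<open>Hyperbolic automorphisms\<close>

definition complexify :: "real^'n \<Rightarrow> complex^'n" where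
  "complexify v = (\<chi> i. complex_of_real (v $ i))"

definition real_part :: "complex^'n \<Rightarrow> real^'n" where
  "real_part v = (\<chi> i. Re (v $ i))"

definition complex_op :: "real^('n::finite)^'n \<Rightarrow> complex^'n \<Rightarrow> complex^'n" where
  "complex_op A = (*v) (\<chi> i j. complex_of_real (A $ i $ j))"

lemma complex_linear_complex_op: "complex_linear (complex_op A)"
  unfolding complex_op_def by (rule complex_linear_matrix)

lemma complex_op_complexify: "complex_op A (complexify v) = complexify (A *v v)"
  by (simp add: complex_op_def complexify_def matrix_vector_mult_def vec_eq_iff)

lemma real_part_complex_op: "real_part (complex_op A v) = A *v real_part v"
  by (simp add: complex_op_def real_part_def matrix_vector_mult_def vec_eq_iff)

lemma funpow_funpow:
  fixes f :: "'a \<Rightarrow> 'a"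
  shows "((f ^^ m) ^^ k) v = (f ^^ (m * k)) v"
  by (induction k) (simp_all add: funpow_add)

lemma complex_op_pow_complexify:
  "((complex_op A ^^ m) ^^ k) (complexify v) = complexify (((((*v) A) ^^ m) ^^ k) v)"
proof -
  have "(complex_op A ^^ k) (complexify v) = complexify ((((*v) A) ^^ k) v)" for k
    by (induction k) (simp_all add: complex_op_complexify)
  then show ?thesis by (simp only: funpow_funpow)
qed

lemma real_part_complex_op_pow:
  "real_part (((complex_op A ^^ m) ^^ k) v) = ((((*v) A) ^^ m) ^^ k) (real_part v)"
proof -
  have "real_part ((complex_op A ^^ k) v) = (((*v) A) ^^ k) (real_part v)" for k
    by (induction k) (simp_all add: real_part_complex_op)
  then show ?thesis by (simp only: funpow_funpow)
qed

text \<open>The power \<open>m\<close> removes all roots of unity among the ratios of distinct eigenvalues.\<close>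

lemma hyperbolic_annihilating_roots:
  fixes A :: "real^('n::finite)^'n"
  assumes "hyperbolic_toral_automorphism A f"
  shows "\<exists>m zs. m \<ge> (1::nat) \<and> (\<forall>v. vdiffs (complex_op A ^^ m) zs v = 0) \<and>
    (\<forall>z\<in>set zs. cmod z \<noteq> 1) \<and>
    (\<forall>z\<in>set zs. \<forall>w\<in>set zs. \<forall>q\<ge>(1::nat). z ^ q = w ^ q \<longrightarrow> z = w)"
proof -
  note T = complex_linear_complex_op[of A]
  obtain es where es: "\<And>v. vdiffs (complex_op A) es v = 0"
    "\<And>z. z \<in> set es \<Longrightarrow> \<exists>w. w \<noteq> 0 \<and> complex_op A w = z *s w"
    using vdiffs_annihilate[OF T] by blast
  have e1: "cmod z \<noteq> 1" if "z \<in> set es" for z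
    using es(2)[OF that] assms
    unfolding hyperbolic_toral_automorphism_def complex_eigenvalue_def complex_op_def by blast
  define r where "r = (\<lambda>(x::complex, y). if \<exists>q\<ge>1. x ^ q = y ^ q then SOME q. q \<ge> (1::nat) \<and> x ^ q = y ^ q else 1)"
  have r: "x ^ r (x, y) = y ^ r (x, y)" if "x ^ q = y ^ q" "q \<ge> 1" for x y q
    using someI[of "\<lambda>q. q \<ge> (1::nat) \<and> x ^ q = y ^ q" q] that by (auto simp: r_def)
  have r1: "r p \<ge> 1" for p
  proof (cases p)
    case (Pair x y)
    show ?thesis
    proof (cases "\<exists>q\<ge>1. x ^ q = y ^ q")
      case True
      then show ?thesis using someI_ex[of "\<lambda>q. q \<ge> (1::nat) \<and> x ^ q = y ^ q"] by (auto simp: r_def Pair)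
    qed (auto simp: r_def Pair)
  qed
  \<comment> \<open>r (x, y) is an exponent at which x and y have equal powers, if there is one, and
    1 otherwise. As a common multiple, m gives x^m = y^m whenever some positive powers of x and y
    agree.\<close>
  define m where "m = (\<Prod>p\<in>set es \<times> set es. r p)"
  have m: "m \<ge> 1" unfolding m_def using r1 by (intro prod_ge_1) auto
  have "x ^ m = y ^ m" if xy: "x \<in> set es" "y \<in> set es" "q \<ge> 1" "(x ^ m) ^ q = (y ^ m) ^ q" for x y q
  proof -
    have "x ^ (m * q) = y ^ (m * q)" "m * q \<ge> 1" using xy m by (simp_all add: power_mult)
    then have "x ^ r (x, y) = y ^ r (x, y)" by (rule r)
    moreover have "r (x, y) dvd m" unfolding m_def using xy by (intro dvd_prodI) auto
    ultimately show ?thesis by (auto simp: power_mult elim!: dvdE)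
  qed
  moreover have "cmod (z ^ m) \<noteq> 1" if "z \<in> set es" for z
    
  proof
    assume "cmod (z ^ m) = 1"
    then have "cmod z ^ m = 1 ^ m" by (simp add: norm_power)
    then have "cmod z = 1" using m by (intro power_eq_imp_eq_base[of "cmod z" m 1]) auto
    then show False using e1[OF that] by simp
  qed
  moreover have "vdiffs (complex_op A ^^ m) (map (\<lambda>z. z ^ m) es) v = 0" for v
    by (rule vdiffs_funpow[OF T es(1)])
  ultimately show ?thesis using m by (intro exI[of _ m] exI[of _ "map (\<lambda>z. z ^ m) es"]) auto
qed

section \<open>Orbits observed through a single frequency\<close>

definition pairing :: "real^'n \<Rightarrow> complex^'n \<Rightarrow> complex" where
  "pairing \<xi> z = (\<Sum>i\<in>UNIV. complex_of_real (\<xi> $ i) * z $ i)"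

lemma pairing_linear: "pairing \<xi> (x + y) = pairing \<xi> x + pairing \<xi> y" "pairing \<xi> (c *s x) = c * pairing \<xi> x"
  by (simp_all add: pairing_def algebra_simps sum.distrib sum_distrib_left)

lemma pairing_complexify: "pairing \<xi> (complexify v) = complex_of_real (\<xi> \<bullet> v)"
  by (simp add: pairing_def complexify_def inner_vec_def)

lemma Re_pairing: "Re (pairing \<xi> z) = \<xi> \<bullet> real_part z"
  by (simp add: pairing_def real_part_def inner_vec_def)

lemma sdiffs_pairing:
  "sdiffs zs (\<lambda>k. pairing \<xi> (((complex_op A ^^ m) ^^ k) v))
     = (\<lambda>k. pairing \<xi> (((complex_op A ^^ m) ^^ k) (vdiffs (complex_op A ^^ m) zs v)))"
  by (rule sdiffs_functional) (auto simp: complex_linear_funpow complex_linear_complex_op pairing_linear)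

lemma vdiffs_filter_split:
  assumes "complex_linear T"
  shows "vdiffs T zs v = vdiffs T (filter P zs @ filter (\<lambda>z. \<not> P z) zs) v"
  by (induction zs arbitrary: v) (simp_all add: vdiffs_append vdiffs_vdiff[OF assms])

lemma linear_matrix_funpow: "linear (((*v) (A :: real^('n::finite)^'n)) ^^ k)"
proof (induction k)
  case (Suc k)
  then show ?case using linear_compose[OF Suc, of "(*v) A"] by (simp add: o_def)
qed (simp add: linear_id[unfolded id_def] id_def)

text \<open>Division with remainder: A^k is A^(k mod m) applied after (A^m)^(k div m), and the
  finitely many remainders have a common bound. This leads from A^m back to
  \<open>stable_subspace A\<close>.\<close>

lemma tendsto_0_funpow:
  fixes A :: "real^('n::finite)^'n"
  assumes "(\<lambda>k. ((((*v) A) ^^ m) ^^ k) v) \<longlonglongrightarrow> 0" "m \<ge> 1"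
  shows "(\<lambda>k. (((*v) A) ^^ k) v) \<longlonglongrightarrow> 0"
proof -
  define g where "g = (*v) A"
  have "\<exists>C. \<forall>x. norm ((g ^^ r) x) \<le> C * norm x" for r
    using linear_bounded[OF linear_matrix_funpow] unfolding g_def by blast
  then obtain C where C: "\<And>r x. norm ((g ^^ r) x) \<le> C r * norm x" by metis
  define K where "K = (\<Sum>r<m. \<bar>C r\<bar>)"
  have bd: "norm ((g ^^ k) v) \<le> K * norm (((g ^^ m) ^^ (k div m)) v)" for k
  proof -
    have "(g ^^ k) v = (g ^^ (k mod m)) (((g ^^ m) ^^ (k div m)) v)"
      unfolding funpow_funpow by (metis comp_apply funpow_add mod_mult_div_eq)
    then have "norm ((g ^^ k) v) \<le> C (k mod m) * norm (((g ^^ m) ^^ (k div m)) v)" using C by metis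
    also have "C (k mod m) \<le> \<bar>C (k mod m)\<bar>" by simp
    also have "\<bar>C (k mod m)\<bar> \<le> K" unfolding K_def using assms(2) by (intro member_le_sum) auto
    finally show ?thesis by (simp add: mult_right_mono)
  qed
  have lim: "(\<lambda>k. K * norm (((g ^^ m) ^^ (k div m)) v)) \<longlonglongrightarrow> 0"
  proof -
    have "filterlim (\<lambda>k. k div m) sequentially sequentially"
      using assms(2) by (intro filterlim_at_top_div_const_nat) auto
    then have "(\<lambda>k. ((g ^^ m) ^^ (k div m)) v) \<longlonglongrightarrow> 0"
      using filterlim_compose[OF assms(1)] unfolding g_def by blast
    then show ?thesis by (intro tendsto_mult_right_zero tendsto_norm_zero)
  qed
  show ?thesis unfolding g_def[symmetric]
    by (rule Lim_null_comparison[OF always_eventually[OF allI] lim]) (rule bd)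
qed

text \<open>With B = A^m, the largest B-invariant subspace of the hyperplane orthogonal to \<xi>; in
  control theory, the unobservable subspace of the output \<xi>.\<close>

definition unobservable :: "real^('n::finite)^'n \<Rightarrow> nat \<Rightarrow> real^'n \<Rightarrow> (real^'n) set" where
  "unobservable A m \<xi> = {v. \<forall>k. \<xi> \<bullet> ((((*v) A) ^^ m) ^^ k) v = 0}"

text \<open>The complexified vector splits into a contracting part x and an expanding part y. The
  observation of y tends to 0 like those of v and x, yet obeys an expanding recurrence, so it is
  identically 0. Real parts carry the splitting back to real vectors, as \<xi> and A are
  real.\<close>

lemma pairing_tendsto_0_imp_stable:
  fixes A :: "real^('n::finite)^'n"
  assumes m: "m \<ge> 1" and zs: "\<And>v. vdiffs (complex_op A ^^ m) zs v = 0"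
    and z1: "\<And>z. z \<in> set zs \<Longrightarrow> cmod z \<noteq> 1"
    and lim: "(\<lambda>k. \<xi> \<bullet> ((((*v) A) ^^ m) ^^ k) v) \<longlonglongrightarrow> 0"
  shows "v \<in> span (unobservable A m \<xi> \<union> stable_subspace A)"
proof -
  define T where "T = complex_op A ^^ m"
  have T: "complex_linear T" unfolding T_def by (intro complex_linear_funpow complex_linear_complex_op)
  define xs where "xs = filter (\<lambda>z. cmod z < 1) zs"
  define ys where "ys = filter (\<lambda>z. \<not> cmod z < 1) zs"
  have "vdiffs T (xs @ ys) (complexify v) = 0"
    using zs vdiffs_filter_split[OF T, of zs "complexify v" "\<lambda>z. cmod z < 1"]
    unfolding T_def[symmetric] xs_def ys_def by simp
  moreover have "set xs \<inter> set ys = {}" by (auto simp: xs_def ys_def)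
  ultimately obtain x y where xy: "complexify v = x + y" "vdiffs T xs x = 0" "vdiffs T ys y = 0"
    using vdiffs_split[OF T] by blast
  have v: "v = real_part x + real_part y"
  proof -
    have "real_part (complexify v) = real_part x + real_part y"
      unfolding xy(1) by (simp add: real_part_def vec_eq_iff)
    then show ?thesis by (simp add: real_part_def complexify_def vec_eq_iff)
  qed
  have Tk0: "(T ^^ k) 0 = 0" for k by (rule complex_linearD(3)[OF complex_linear_funpow[OF T]])
  have x_lim: "(\<lambda>k. (T ^^ k) x $ i) \<longlonglongrightarrow> 0" for i
  proof (rule sdiffs_eq_0_tendsto_0)
    have "sdiffs xs (\<lambda>k. (T ^^ k) x $ i) = (\<lambda>k. (T ^^ k) (vdiffs T xs x) $ i)"
      by (rule sdiffs_functional[OF T, where h = "\<lambda>z. z $ i"]) auto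
    then show "sdiffs xs (\<lambda>k. (T ^^ k) x $ i) = (\<lambda>_. 0)" by (simp add: xy Tk0)
  qed (auto simp: xs_def)
  have "(\<lambda>k. ((((*v) A) ^^ m) ^^ k) (real_part x)) \<longlonglongrightarrow> 0"
  proof (rule vec_tendstoI)
    fix i
    have "(\<lambda>k. Re ((T ^^ k) x $ i)) \<longlonglongrightarrow> 0" using tendsto_Re[OF x_lim] by simp
    moreover have "((((*v) A) ^^ m) ^^ k) (real_part x) $ i = Re ((T ^^ k) x $ i)" for k
      unfolding T_def real_part_complex_op_pow[symmetric] by (simp add: real_part_def)
    ultimately show "(\<lambda>k. ((((*v) A) ^^ m) ^^ k) (real_part x) $ i) \<longlonglongrightarrow> 0 $ i" by simp
  qed
  then have 1: "real_part x \<in> stable_subspace A"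
    unfolding stable_subspace_def using tendsto_0_funpow m by blast
  have py: "(\<lambda>k. pairing \<xi> ((T ^^ k) y)) = (\<lambda>_. 0)"
  proof (rule sdiffs_expanding_eq_0)
    have "sdiffs ys (\<lambda>k. pairing \<xi> ((T ^^ k) y)) = (\<lambda>k. pairing \<xi> ((T ^^ k) (vdiffs T ys y)))"
      unfolding T_def by (rule sdiffs_pairing)
    then show "sdiffs ys (\<lambda>k. pairing \<xi> ((T ^^ k) y)) = (\<lambda>_. 0)" by (simp add: xy Tk0 pairing_def)
    show "\<forall>z\<in>set ys. 1 < cmod z" using z1 by (force simp: ys_def)
    have "(T ^^ k) (complexify v) = (T ^^ k) x + (T ^^ k) y" for k
      unfolding xy(1) by (rule complex_linearD(1)[OF complex_linear_funpow[OF T]])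
    then have "complex_of_real (\<xi> \<bullet> ((((*v) A) ^^ m) ^^ k) v) = pairing \<xi> ((T ^^ k) x) + pairing \<xi> ((T ^^ k) y)" for k
      by (simp add: T_def complex_op_pow_complexify pairing_complexify[symmetric] pairing_linear(1)[symmetric])
    then have "pairing \<xi> ((T ^^ k) y) = complex_of_real (\<xi> \<bullet> ((((*v) A) ^^ m) ^^ k) v) - pairing \<xi> ((T ^^ k) x)" for k
      by (simp add: algebra_simps)
    moreover have "(\<lambda>k. complex_of_real (\<xi> \<bullet> ((((*v) A) ^^ m) ^^ k) v) - pairing \<xi> ((T ^^ k) x)) \<longlonglongrightarrow> complex_of_real 0 - (\<Sum>i\<in>UNIV. complex_of_real (\<xi> $ i) * 0)"
      unfolding pairing_def by (intro tendsto_intros x_lim lim)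
    ultimately show "(\<lambda>k. pairing \<xi> ((T ^^ k) y)) \<longlonglongrightarrow> 0" by simp
  qed
  have "\<xi> \<bullet> ((((*v) A) ^^ m) ^^ k) (real_part y) = 0" for k
    unfolding real_part_complex_op_pow[symmetric] Re_pairing[symmetric]
    using fun_cong[OF py, of k] by (simp add: T_def)
  then have 2: "real_part y \<in> unobservable A m \<xi>" by (simp add: unobservable_def)
  show ?thesis unfolding v using 1 2 by (intro span_add span_base) auto
qed

lemma subspace_unobservable: "subspace (unobservable A m \<xi>)"
proof -
  have "linear ((((*v) A) ^^ m) ^^ k)" for k
    using linear_matrix_funpow[where A = A and k = "m * k"] by (simp only: funpow_funpow[abs_def])
  then show ?thesis
    by (auto simp: subspace_def unobservable_def linear_0 linear_add linear_scale inner_add_right)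
qed

lemma integer_matrix_pow:
  fixes A :: "real^('n::finite)^'n"
  assumes A: "\<forall>i j. A $ i $ j \<in> \<int>" and z: "\<forall>i. z $ i \<in> \<int>"
  shows "(((*v) A) ^^ k) z $ i \<in> \<int>"
proof -
  have "\<forall>i. (((*v) A) ^^ k) z $ i \<in> \<int>"
  proof (induction k)
    case (Suc k)
    then show ?case using A by (auto simp: matrix_vector_mult_def intro!: Ints_sum Ints_mult)
  qed (use z in simp)
  then show ?thesis by blast
qed

lemma hyperbolic_inj:
  assumes "hyperbolic_toral_automorphism A f"
  shows "inj ((*v) A)"
proof -
  have "det A \<noteq> 0" using assms by (auto simp: hyperbolic_toral_automorphism_def)
  then show ?thesis by (simp add: inj_matrix_vector_mult invertible_det_nz)
qed

text \<open>Closedness is obtained from integrality, without a rational basis of the subspace. If x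
  n - z n lies in it, z n is integral and x n converges, then the integers \<xi> \<bullet> B^k (z n)
  are eventually constant for each k. Finitely many k suffice, because the recurrence determines all
  others.\<close>

lemma unobservable_torus:
  fixes A :: "real^('n::finite)^'n"
  assumes hyp: "hyperbolic_toral_automorphism A f"
    and zs: "\<And>v. vdiffs (complex_op A ^^ m) zs v = 0"
    and \<xi>: "\<forall>i. \<xi> $ i \<in> \<int>" "\<xi> \<noteq> 0"
  defines "G \<equiv> to_torus ` unobservable A m \<xi>"
  shows "toral_subgroup G" "G \<noteq> UNIV" "(f ^^ m) ` G = G"
proof -
  define W where "W = unobservable A m \<xi>"
  define B where "B = ((*v) A) ^^ m"
  have W: "subspace W" unfolding W_def by (rule subspace_unobservable)
  have A: "\<forall>i j. A $ i $ j \<in> \<int>" and fA: "\<And>v. f (to_torus v) = to_torus (A *v v)"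
    using hyp by (auto simp: hyperbolic_toral_automorphism_def)
  have Wi: "v \<in> W \<longleftrightarrow> (\<forall>k. \<xi> \<bullet> (B ^^ k) v = 0)" for v by (simp add: W_def unobservable_def B_def)
  have Blin: "linear (B ^^ k)" for k
    unfolding B_def using linear_matrix_funpow[where A = A and k = "m * k"] by (simp only: funpow_funpow[abs_def])
  have Bint: "\<xi> \<bullet> (B ^^ k) z \<in> \<int>" if "\<forall>i. z $ i \<in> \<int>" for z k
    unfolding inner_vec_def B_def funpow_funpow
    using \<xi>(1) integer_matrix_pow[OF A that] by (intro Ints_sum) (auto intro: Ints_mult)
  have memG: "to_torus v \<in> G \<longleftrightarrow> (\<exists>z. (\<forall>i. z $ i \<in> \<int>) \<and> v - z \<in> W)" for v
  proof
    assume "to_torus v \<in> G"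
    then obtain w where "w \<in> W" "to_torus v = to_torus w" by (auto simp: G_def W_def)
    then show "\<exists>z. (\<forall>i. z $ i \<in> \<int>) \<and> v - z \<in> W"
      by (intro exI[of _ "v - w"]) (auto simp: to_torus_eq_iff)
  next
    assume "\<exists>z. (\<forall>i. z $ i \<in> \<int>) \<and> v - z \<in> W"
    then obtain z where z: "\<forall>i. z $ i \<in> \<int>" "v - z \<in> W" by blast
    have "to_torus ((v - z) + z) = to_torus (v - z)" by (rule to_torus_add_int[OF z(1)])
    then show "to_torus v \<in> G" using z(2) by (simp add: G_def W_def)
  qed
  have seq0: "sdiffs zs (\<lambda>k. complex_of_real (\<xi> \<bullet> (B ^^ k) v)) = (\<lambda>_. 0)" for v
    using sdiffs_pairing[where zs = zs and \<xi> = \<xi> and A = A and m = m and v = "complexify v"]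
    by (simp add: zs complex_op_pow_complexify pairing_complexify B_def
        complex_linearD(3)[OF complex_linear_funpow[OF complex_linear_funpow[OF complex_linear_complex_op]]]
        pairing_def[of _ 0])
  have "closed {v. to_torus v \<in> G}"
    unfolding closed_sequential_limits
  proof (intro allI impI, elim conjE)
    fix x v assume x: "\<forall>n. x n \<in> {v. to_torus v \<in> G}" and lim: "x \<longlonglongrightarrow> v"
    then obtain z where z: "\<And>n i. z n $ i \<in> \<int>" "\<And>n. x n - z n \<in> W" using memG by simp metis
    have eq: "\<xi> \<bullet> (B ^^ k) (z n) = \<xi> \<bullet> (B ^^ k) (x n)" for k n
    proof -
      have "\<xi> \<bullet> (B ^^ k) (x n - z n) = 0" using z(2) Wi by blast
      then show ?thesis by (simp add: linear_diff[OF Blin] inner_diff_right)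
    qed
    have "(\<lambda>n. \<xi> \<bullet> (B ^^ k) (x n)) \<longlonglongrightarrow> \<xi> \<bullet> (B ^^ k) v" for k
      using Blin[of k] lim
      by (intro tendsto_inner tendsto_const bounded_linear.tendsto[of "B ^^ k"])
        (simp_all add: linear_conv_bounded_linear)
    then have l: "(\<lambda>n. \<xi> \<bullet> (B ^^ k) (z n)) \<longlonglongrightarrow> \<xi> \<bullet> (B ^^ k) v" for k by (simp add: eq)
    have vint: "\<xi> \<bullet> (B ^^ k) v \<in> \<int>" for k
      by (rule closed_sequentially[OF closed_Ints _ l]) (use Bint z in blast)
    have "\<forall>\<^sub>F n in sequentially. \<xi> \<bullet> (B ^^ k) (z n) = \<xi> \<bullet> (B ^^ k) v" for k
    proof (rule eventually_mono[OF tendstoD[OF l[of k], of 1]])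
      fix n assume "dist (\<xi> \<bullet> (B ^^ k) (z n)) (\<xi> \<bullet> (B ^^ k) v) < 1"
      then have "\<xi> \<bullet> (B ^^ k) (z n) - \<xi> \<bullet> (B ^^ k) v = 0"
        using Bint z vint by (intro Ints_nonzero_abs_less1 Ints_diff) (auto simp: dist_real_def)
      then show "\<xi> \<bullet> (B ^^ k) (z n) = \<xi> \<bullet> (B ^^ k) v" by simp
    qed simp
    then have "\<forall>\<^sub>F n in sequentially. \<forall>k\<in>{..<length zs}. \<xi> \<bullet> (B ^^ k) (z n) = \<xi> \<bullet> (B ^^ k) v"
      by (intro eventually_ball_finite ballI) auto
    then obtain n where "\<forall>k\<in>{..<length zs}. \<xi> \<bullet> (B ^^ k) (z n) = \<xi> \<bullet> (B ^^ k) v"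
      using eventually_happens[of _ sequentially] by auto
    then have n: "\<forall>k<length zs. \<xi> \<bullet> (B ^^ k) (z n) = \<xi> \<bullet> (B ^^ k) v" by simp
    have "complex_of_real (\<xi> \<bullet> (B ^^ k) (v - z n)) = 0" for k
      by (rule sdiffs_initial_zero[OF seq0]) (use n in \<open>simp add: linear_diff[OF Blin] inner_diff_right\<close>)
    then have "v - z n \<in> W" by (simp add: Wi)
    then show "v \<in> {v. to_torus v \<in> G}" using memG z by blast
  qed
  then have "open {v. to_torus v \<in> - G}" by (simp add: closed_def Collect_neg_eq[symmetric])
  then have "closed G" using open_torus_iff[of "- G"] by (simp add: closed_def)
  then have "compact G" using compact_Int_closed[OF compact_UNIV_torus, of G] by simp
  moreover have "connected G"
    unfolding G_def W_def[symmetric]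
    by (intro connected_continuous_image continuous_on_to_torus convex_connected subspace_imp_convex W)
  moreover have "0 \<in> G" using to_torus_0 subspace_0[OF W] by (force simp: G_def W_def)
  moreover have "\<forall>x\<in>G. \<forall>y\<in>G. x - y \<in> G"
    unfolding G_def W_def[symmetric] using subspace_diff[OF W] by (auto simp: to_torus_diff[symmetric])
  ultimately show "toral_subgroup G" by (simp add: toral_subgroup_def)
  show "G \<noteq> UNIV"
  proof
    assume "G = UNIV"
    \<comment> \<open>Here \<xi> \<bullet> v = 1/2, whereas every lift of a point of G has an
      integral product with \<xi>.\<close>
    define v where "v = (1 / (2 * (\<xi> \<bullet> \<xi>))) *\<^sub>R \<xi>"
    have "to_torus v \<in> G" using \<open>G = UNIV\<close> by simp
    then obtain z where z: "\<forall>i. z $ i \<in> \<int>" "v - z \<in> W" using memG by blast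
    have "\<xi> \<bullet> (B ^^ 0) (v - z) = 0" using z(2) Wi by blast
    then have "\<xi> \<bullet> v = \<xi> \<bullet> z" by (simp add: inner_diff_right)
    moreover have "\<xi> \<bullet> v = 1 / 2" using \<xi>(2) by (simp add: v_def)
    ultimately have h: "\<xi> \<bullet> z = 1 / 2" by linarith
    have "\<xi> \<bullet> z \<in> \<int>" using Bint[OF z(1), of 0] by simp
    then have "(1 / 2 :: real) \<in> \<int>" unfolding h .
    then have "(1 / 2 :: real) = 0" by (intro Ints_nonzero_abs_less1) auto
    then show False by simp
  qed
  \<comment> \<open>The definition gives only one inclusion; equality follows because B is injective
    and so preserves the dimension.\<close>
  have "B ` W = W"
  proof (rule subspace_dim_equal)
    have "linear B" using Blin[of 1] by simp
    then show "subspace (B ` W)" by (intro linear_subspace_image W)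
    show "B ` W \<subseteq> W"
    proof (rule image_subsetI)
      fix v assume "v \<in> W"
      then have "\<xi> \<bullet> (B ^^ Suc k) v = 0" for k unfolding Wi by blast
      then show "B v \<in> W" by (simp add: Wi funpow_swap1)
    qed
    have "inj B" unfolding B_def by (intro inj_fn hyperbolic_inj[OF hyp])
    then have "dim (B ` W) = dim W" by (intro dim_image_eq \<open>linear B\<close>) (auto intro: inj_on_subset)
    then show "dim W \<le> dim (B ` W)" by simp
  qed (rule W)
  moreover have "(f ^^ m) (to_torus v) = to_torus (B v)" for v
    unfolding B_def by (induction m) (simp_all add: fA)
  then have "(f ^^ m) ` G = to_torus ` (B ` W)" unfolding G_def W_def image_image by simp
  ultimately show "(f ^^ m) ` G = G" by (simp add: G_def W_def)
qed

section \<open>Density of the orbit of an arc\<close>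

text \<open>The component of c orthogonal to Y has zero derivative. The middle third passes from the
  open interval of the assumption to the closed one in
  \<open>tangential_coincidence\<close>.\<close>

lemma (in torus_field) arc_in_leaf:
  assumes c: "\<And>t. (c has_vector_derivative V (to_torus (c t))) (at t)"
    and Y: "subspace Y" and pq: "p < q" and inY: "\<And>t. t \<in> {p<..<q} \<Longrightarrow> V (to_torus (c t)) \<in> Y"
  shows "tangential_coincidence V (linear_foliation Y)"
proof -
  define p1 where "p1 = p + (q - p) / 3"
  define q1 where "q1 = p + 2 * (q - p) / 3"
  have pq1: "p < p1" "p1 < q1" "q1 < q" using pq by (auto simp: p1_def q1_def field_simps)
  have "c t - c p1 \<in> Y" if t: "t \<in> {p1..q1}" for t
  proof -
    obtain y z where yz: "y \<in> span Y" "\<And>w. w \<in> span Y \<Longrightarrow> orthogonal z w" "c t - c p1 = y + z"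
      using orthogonal_subspace_decomp_exists[of Y "c t - c p1"] by metis
    have d0: "((\<lambda>s. z \<bullet> c s) has_real_derivative 0) (at s within {p1..q1})" if "s \<in> {p1..q1}" for s
    proof -
      have "((\<lambda>s. z \<bullet> c s) has_vector_derivative z \<bullet> V (to_torus (c s))) (at s)"
        by (rule bounded_linear.has_vector_derivative[OF bounded_linear_inner_right c])
      moreover have "z \<bullet> V (to_torus (c s)) = 0"
      proof -
        have "V (to_torus (c s)) \<in> Y" using that pq1 by (intro inY) auto
        then show ?thesis using yz(2)[OF span_base] by (simp add: orthogonal_def)
      qed
      ultimately show ?thesis
        by (simp add: has_real_derivative_iff_has_vector_derivative has_vector_derivative_at_within)
    qed
    then obtain k where "\<And>s. s \<in> {p1..q1} \<Longrightarrow> z \<bullet> c s = k"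
      using has_field_derivative_zero_constant[of "{p1..q1}" "\<lambda>s. z \<bullet> c s"] by auto
    then have "z \<bullet> (c t - c p1) = 0" using t pq1 by (simp add: inner_diff_right)
    moreover have "z \<bullet> y = 0" using yz(2)[OF yz(1)] by (simp add: orthogonal_def)
    ultimately have "z = 0" unfolding yz(3) by (simp add: inner_add_right)
    then show ?thesis using yz Y by (simp add: span_eq_iff[THEN iffD2])
  qed
  then have "(\<lambda>t. to_torus (c t)) ` {p1..q1} \<subseteq> to_torus ` ((+) (c p1) ` Y)"
    by (force simp: image_iff)
  moreover have "integral_curve V (\<lambda>t. to_torus (c t))"
    unfolding integral_curve_def using c by blast
  ultimately show ?thesis
    unfolding tangential_coincidence_def linear_foliation_def using pq1 by blast
qed

text \<open>The free phase \<theta> makes cosines do the work of complex exponentials; the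
  quantifier over subintervals makes the property hereditary.\<close>

definition equidistributing :: "real^('n::finite)^'n \<Rightarrow> nat \<Rightarrow> (real \<Rightarrow> real^'n) \<Rightarrow> real^'n \<Rightarrow> real \<Rightarrow> real \<Rightarrow> bool" where
  "equidistributing A m c \<xi> p q \<longleftrightarrow> (\<forall>p' q' \<theta>. p \<le> p' \<longrightarrow> p' < q' \<longrightarrow> q' \<le> q \<longrightarrow>
     (\<lambda>N. (\<Sum>k<N. integral {p'..q'} (\<lambda>t. cos (2 * pi * (\<xi> \<bullet> ((((*v) A) ^^ m) ^^ k) (c t)) + \<theta>))) / real N) \<longlonglongrightarrow> 0)"

text \<open>The derivative of the phase is 2 \<pi> times the observation of the velocity F (c t),
  and the next one observes the derivative of F along itself. If the first observation tended to 0
  on a subarc, V would be tangent there to the span of \<open>unobservable\<close> and the stable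
  subspace, that is, the subarc would lie in a leaf excluded by \<open>coinc\<close>.\<close>

lemma arc_equidistributing_subinterval:
  fixes A :: "real^('n::finite)^'n"
  assumes hyp: "hyperbolic_toral_automorphism A f"
    and V: "C2_unit_vector_field V"
    and coinc: "\<And>G W. toral_subgroup G \<Longrightarrow> G \<noteq> UNIV \<Longrightarrow> (\<exists>k\<ge>1. (f ^^ k) ` G = G) \<Longrightarrow>
           subspace W \<Longrightarrow> to_torus ` W = G \<Longrightarrow>
           \<not> tangential_coincidence V (linear_foliation (span (W \<union> stable_subspace A)))"
    and m: "m \<ge> 1" and zs: "\<And>v. vdiffs (complex_op A ^^ m) zs v = 0"
    and z1: "\<And>z. z \<in> set zs \<Longrightarrow> cmod z \<noteq> 1"
    and nondeg: "\<And>z w q. z \<in> set zs \<Longrightarrow> w \<in> set zs \<Longrightarrow> q \<ge> (1::nat) \<Longrightarrow> z ^ q = w ^ q \<Longrightarrow> z = w"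
    and c: "\<And>t. (c has_vector_derivative V (to_torus (c t))) (at t)"
    and \<xi>: "\<forall>i. \<xi> $ i \<in> \<int>" "\<xi> \<noteq> 0" and ab: "\<alpha> < \<beta>"
  shows "\<exists>p q. \<alpha> \<le> p \<and> p < q \<and> q \<le> \<beta> \<and> equidistributing A m c \<xi> p q"
  unfolding equidistributing_def
proof -
  obtain L where "torus_field V L" using C2_unit_vector_field_lipschitz[OF V] by blast
  then interpret torus_field V L .
  define B where "B = ((*v) A) ^^ m"
  define F where "F v = V (to_torus v)" for v
  obtain F' F'' where F': "\<And>x. (F has_derivative blinfun_apply (F' x)) (at x)"
    and F'': "\<And>x. (F' has_derivative blinfun_apply (F'' x)) (at x)"
    using V unfolding C2_unit_vector_field_def C2_def F_def[abs_def] by blast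
  have contF': "continuous_on UNIV F'" using F'' by (meson has_derivative_continuous continuous_at_imp_continuous_on)
  have contF: "continuous_on UNIV F" using F' by (meson has_derivative_continuous continuous_at_imp_continuous_on)
  have contc: "continuous_on UNIV c" using c by (meson has_vector_derivative_continuous continuous_at_imp_continuous_on)
  have Blin: "bounded_linear (B ^^ k)" for k
    unfolding B_def using linear_matrix_funpow[where A = A and k = "m * k"]
    by (simp only: funpow_funpow[abs_def] linear_conv_bounded_linear)
  have bl: "bounded_linear (\<lambda>v. \<xi> \<bullet> (B ^^ k) v)" for k
    by (rule bounded_linear_compose[OF bounded_linear_inner_right Blin])
  define a where "a k t = \<xi> \<bullet> (B ^^ k) (F (c t))" for k t
  define a' where "a' k t = \<xi> \<bullet> (B ^^ k) (blinfun_apply (F' (c t)) (F (c t)))" for k t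
  define \<phi> where "\<phi> k t = 2 * pi * (\<xi> \<bullet> (B ^^ k) (c t))" for k t
  have dF: "((\<lambda>t. F (c t)) has_vector_derivative blinfun_apply (F' (c t)) (F (c t))) (at t)" for t
  proof -
    have "((F \<circ> c) has_derivative (blinfun_apply (F' (c t)) \<circ> (\<lambda>h. h *\<^sub>R F (c t)))) (at t)"
      using c[of t] by (intro diff_chain_at F') (simp add: has_vector_derivative_def F_def)
    then show ?thesis
      by (simp add: has_vector_derivative_def o_def blinfun.scaleR_right)
  qed
  show "\<exists>p q. \<alpha> \<le> p \<and> p < q \<and> q \<le> \<beta> \<and> (\<forall>p' q' \<theta>. p \<le> p' \<longrightarrow> p' < q' \<longrightarrow> q' \<le> q \<longrightarrow>
     (\<lambda>N. (\<Sum>k<N. integral {p'..q'} (\<lambda>t. cos (2 * pi * (\<xi> \<bullet> ((((*v) A) ^^ m) ^^ k) (c t)) + \<theta>))) / real N) \<longlonglongrightarrow> 0)"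
    unfolding B_def[symmetric] \<phi>_def[symmetric]
  proof (rule oscillation_subinterval[where a = a and a' = a', OF z1 nondeg])
    show "sdiffs zs (\<lambda>k. complex_of_real (a k t)) = (\<lambda>_. 0)" for t
      using sdiffs_pairing[where zs = zs and \<xi> = \<xi> and A = A and m = m and v = "complexify (F (c t))"]
      by (simp add: zs complex_op_pow_complexify pairing_complexify B_def a_def
        complex_linearD(3)[OF complex_linear_funpow[OF complex_linear_funpow[OF complex_linear_complex_op]]]
        pairing_def[of _ 0])
    show "(a k has_real_derivative a' k t) (at t)" for k t
      unfolding a_def a'_def has_real_derivative_iff_has_vector_derivative
      by (rule bounded_linear.has_vector_derivative[OF bl dF])
    show "continuous_on UNIV (a' k)" for k
      unfolding a'_def
      by (intro bounded_linear.continuous_on[OF bl] continuous_intros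
          continuous_on_compose2[OF contF' contc] continuous_on_compose2[OF contF contc]) auto
    show "(\<phi> k has_real_derivative 2 * pi * a k t) (at t)" for k t
      unfolding \<phi>_def a_def F_def
      by (intro DERIV_cmult) (simp only: has_real_derivative_iff_has_vector_derivative
          bounded_linear.has_vector_derivative[OF bl c])
    show "\<exists>t\<in>{p<..<q}. \<not> (\<lambda>k. a k t) \<longlonglongrightarrow> 0" if pq: "\<alpha> \<le> p" "p < q" "q \<le> \<beta>" for p q
    proof (rule ccontr)
      assume "\<not> (\<exists>t\<in>{p<..<q}. \<not> (\<lambda>k. a k t) \<longlonglongrightarrow> 0)"
      then have "V (to_torus (c t)) \<in> span (unobservable A m \<xi> \<union> stable_subspace A)" if "t \<in> {p<..<q}" for t
        using that unfolding a_def F_def B_def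
        by (intro pairing_tendsto_0_imp_stable[OF m zs z1]) auto
      then have "tangential_coincidence V (linear_foliation (span (unobservable A m \<xi> \<union> stable_subspace A)))"
        by (intro arc_in_leaf[OF c _ pq(2)]) auto
      then show False
        using coinc[OF unobservable_torus(1,2)[OF hyp zs \<xi>] _ subspace_unobservable refl]
          unobservable_torus(3)[OF hyp zs \<xi>] m by blast
    qed
  qed (use ab in auto)
qed

lemma equidistributing_mono:
  assumes "equidistributing A m c \<xi> p q" "p \<le> p'" "q' \<le> q"
  shows "equidistributing A m c \<xi> p' q'"
  using assms unfolding equidistributing_def by (meson order_trans)

lemma arc_equidistributing_finite:
  assumes "finite X"
    and step: "\<And>\<xi> \<alpha> \<beta>. \<xi> \<in> X \<Longrightarrow> \<alpha> < \<beta> \<Longrightarrow> \<exists>p q. \<alpha> \<le> p \<and> p < q \<and> q \<le> \<beta> \<and> equidistributing A m c \<xi> p q"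
    and "\<alpha> < \<beta>"
  shows "\<exists>p q. \<alpha> \<le> p \<and> p < q \<and> q \<le> \<beta> \<and> (\<forall>\<xi>\<in>X. equidistributing A m c \<xi> p q)"
  using assms
proof (induction X)
  case (insert \<xi> X)
  then obtain p q where pq: "\<alpha> \<le> p" "p < q" "q \<le> \<beta>" "\<forall>\<xi>\<in>X. equidistributing A m c \<xi> p q" by auto
  obtain p' q' where pq': "p \<le> p'" "p' < q'" "q' \<le> q" "equidistributing A m c \<xi> p' q'"
    using insert.prems(1)[of \<xi> p q] pq(2) by auto
  have "\<alpha> \<le> p'" "q' \<le> \<beta>" using pq pq' by linarith+
  moreover have "equidistributing A m c \<zeta> p' q'" if "\<zeta> \<in> X" for \<zeta>
    using equidistributing_mono pq(4) pq'(1,3) that by blast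
  ultimately show ?case using pq'(2,4) by blast
qed auto

section \<open>A trigonometric kernel concentrated at the integer points\<close>

lemma cosine_power_expansion:
  "complex_of_real (((1 + cos x) / 2) ^ M)
    = (\<Sum>j\<le>2*M. complex_of_real (real ((2*M) choose j) / 4 ^ M) * cis ((real j - real M) * x))"
proof -
  \<comment> \<open>This is the square of cos (x / 2), written so that its powers are binomial
    sums.\<close>
  have e: "complex_of_real ((1 + cos x) / 2) = (1 + cis x)\<^sup>2 * cis (- x) / 4"
  proof -
    have "(1 + cis x)\<^sup>2 * cis (- x) = cis (- x) + 2 + cis x"
      by (simp add: power2_eq_square algebra_simps cis_mult)
    also have "\<dots> = complex_of_real (2 + 2 * cos x)" by (simp add: complex_eq_iff)
    finally show ?thesis by (simp add: field_simps)
  qed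
  have "complex_of_real (((1 + cos x) / 2) ^ M) = (complex_of_real ((1 + cos x) / 2)) ^ M" by simp
  also have "\<dots> = (1 + cis x) ^ (2 * M) * cis (- x) ^ M / 4 ^ M"
    unfolding e by (simp add: power_mult_distrib power_divide power_mult)
  also have "cis (- x) ^ M = cis (- (real M * x))" by (simp add: Complex.DeMoivre)
  also have "(1 + cis x) ^ (2 * M) = (\<Sum>j\<le>2*M. of_nat ((2*M) choose j) * cis (real j * x))"
    using binomial_ring[of "cis x" 1 "2 * M"] by (simp add: add.commute Complex.DeMoivre)
  also have "(\<Sum>j\<le>2*M. of_nat ((2*M) choose j) * cis (real j * x)) * cis (- (real M * x)) / 4 ^ M
     = (\<Sum>j\<le>2*M. of_nat ((2*M) choose j) * cis (real j * x) * cis (- (real M * x)) / 4 ^ M)"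
    by (simp add: sum_distrib_right sum_divide_distrib)
  also have "\<dots> = (\<Sum>j\<le>2*M. complex_of_real (real ((2*M) choose j) / 4 ^ M) * cis ((real j - real M) * x))"
    by (intro sum.cong refl) (simp add: cis_mult mult.assoc left_diff_distrib)
  finally show ?thesis .
qed

lemma prod_cis: "finite I \<Longrightarrow> (\<Prod>i\<in>I. cis (x i)) = cis (\<Sum>i\<in>I. x i)"
  by (induction I rule: finite_induct) (simp_all add: cis_mult)

definition fejer_coeff :: "nat \<Rightarrow> ('n::finite \<Rightarrow> nat) \<Rightarrow> real" where
  "fejer_coeff M g = (\<Prod>i\<in>UNIV. real ((2*M) choose (g i)) / 4 ^ M)"

definition fejer_freq :: "nat \<Rightarrow> ('n::finite \<Rightarrow> nat) \<Rightarrow> real^'n" where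
  "fejer_freq M g = (\<chi> i. real (g i) - real M)"

definition fejer_index :: "nat \<Rightarrow> ('n::finite \<Rightarrow> nat) set" where
  "fejer_index M = PiE UNIV (\<lambda>_. {..2*M})"

text \<open>Each factor is the 2 M-th power of cos (\<pi> w_i), so this is an unnormalised de la
  Vallee Poussin kernel in every coordinate. It equals 1 at integer points, and its mean is a power
  of a normalised central binomial coefficient.\<close>

definition fejer :: "nat \<Rightarrow> real^('n::finite) \<Rightarrow> real" where
  "fejer M w = (\<Prod>i\<in>UNIV. ((1 + cos (2 * pi * w $ i)) / 2) ^ M)"

lemma finite_fejer_index: "finite (fejer_index M :: ('n::finite \<Rightarrow> nat) set)"
  unfolding fejer_index_def by (intro finite_PiE) auto

lemma fejer_expansion:
  fixes w :: "real^('n::finite)"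
  shows "fejer M w = (\<Sum>g\<in>fejer_index M. fejer_coeff M g * cos (2 * pi * (fejer_freq M g \<bullet> w)))"
proof -
  define x where "x i = 2 * pi * w $ i" for i
  have "complex_of_real (fejer M w) = (\<Prod>i\<in>UNIV. complex_of_real (((1 + cos (x i)) / 2) ^ M))"
    by (simp only: fejer_def x_def of_real_prod)
  also have "\<dots> = (\<Prod>i\<in>UNIV. \<Sum>j\<le>2*M. complex_of_real (real ((2*M) choose j) / 4 ^ M) * cis ((real j - real M) * x i))"
    by (simp only: cosine_power_expansion)
  also have "\<dots> = (\<Sum>g\<in>fejer_index M. \<Prod>i\<in>UNIV. complex_of_real (real ((2*M) choose (g i)) / 4 ^ M) * cis ((real (g i) - real M) * x i))"
    unfolding fejer_index_def by (rule prod_sum_PiE) auto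
  also have "\<dots> = (\<Sum>g\<in>fejer_index M. complex_of_real (fejer_coeff M g) * cis (2 * pi * (fejer_freq M g \<bullet> w)))"
  proof (intro sum.cong refl)
    fix g :: "'n \<Rightarrow> nat"
    have "(\<Sum>i\<in>UNIV. (real (g i) - real M) * x i) = 2 * pi * (fejer_freq M g \<bullet> w)"
      by (simp add: fejer_freq_def inner_vec_def x_def sum_distrib_left mult_ac)
    then show "(\<Prod>i\<in>UNIV. complex_of_real (real ((2*M) choose (g i)) / 4 ^ M) * cis ((real (g i) - real M) * x i))
      = complex_of_real (fejer_coeff M g) * cis (2 * pi * (fejer_freq M g \<bullet> w))"
      by (simp only: prod.distrib prod_cis finite fejer_coeff_def of_real_prod)
  qed
  finally have "Re (complex_of_real (fejer M w))
     = Re (\<Sum>g\<in>fejer_index M. complex_of_real (fejer_coeff M g) * cis (2 * pi * (fejer_freq M g \<bullet> w)))" by simp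
  then show ?thesis by simp
qed

lemma half_one_plus_cos: "0 \<le> (1 + cos x) / 2" "(1 + cos x) / 2 \<le> (1::real)"
proof -
  have "0 \<le> (1 + y) / 2" "(1 + y) / 2 \<le> 1" if "-1 \<le> y" "y \<le> 1" for y :: real using that by auto
  then show "0 \<le> (1 + cos x) / 2" "(1 + cos x) / 2 \<le> 1" using cos_ge_minus_one cos_le_one by blast+
qed

text \<open>Some coordinate keeps distance r from its nearest integer and makes its factor small, as
  cos decreases on [0, \<pi>]; the other factors are at most 1.\<close>

lemma fejer_small:
  fixes w :: "real^('n::finite)"
  assumes r: "0 < r" "r \<le> 1/2" and no: "\<And>z. (\<forall>i. z $ i \<in> \<int>) \<Longrightarrow> \<exists>i. \<bar>w $ i - z $ i\<bar> \<ge> r"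
  shows "fejer M w \<le> ((1 + cos (2 * pi * r)) / 2) ^ M"
proof -
  define z :: "real^'n" where "z = (\<chi> i. of_int (round (w $ i)))"
  have "\<forall>i. z $ i \<in> \<int>" by (simp add: z_def)
  then obtain i where i: "\<bar>w $ i - z $ i\<bar> \<ge> r" using no by blast
  define y where "y = \<bar>w $ i - z $ i\<bar>"
  have y: "r \<le> y" "y \<le> 1/2"
    using i of_int_round_abs_le[of "w $ i"] by (auto simp: y_def z_def abs_minus_commute)
  have "cos (2 * pi * w $ i) = cos (2 * pi * (w $ i - z $ i))"
  proof -
    have "2 * pi * (w $ i - z $ i) = 2 * pi * w $ i - 2 * pi * of_int (round (w $ i))"
      by (simp add: z_def right_diff_distrib)
    then show ?thesis using cos_int_2pin[of "round (w $ i)"] sin_int_2pin[of "round (w $ i)"]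
      by (simp add: cos_diff)
  qed
  also have "\<dots> = cos (2 * pi * y)"
    unfolding y_def by (metis abs_mult abs_of_pos cos_abs_real mult_pos_pos pi_gt_zero zero_less_numeral)
  also have "\<dots> \<le> cos (2 * pi * r)"
    using y r by (intro cos_monotone_0_pi_le) (auto simp: mult_le_cancel_left_pos)
  finally have ci: "cos (2 * pi * w $ i) \<le> cos (2 * pi * r)" .
  define h where "h j = ((1 + cos (2 * pi * w $ j)) / 2) ^ M" for j
  have h: "0 \<le> h j" "h j \<le> 1" for j
    unfolding h_def by (intro zero_le_power power_le_one half_one_plus_cos)+
  have "fejer M w = h i * (\<Prod>j\<in>UNIV - {i}. h j)"
    unfolding fejer_def h_def by (subst prod.remove[of UNIV i]) auto
  also have "\<dots> \<le> h i * 1" using h by (intro mult_left_mono prod_le_1) auto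
  also have "h i \<le> ((1 + cos (2 * pi * r)) / 2) ^ M"
    unfolding h_def using ci by (intro power_mono half_one_plus_cos) auto
  finally show ?thesis by simp
qed

text \<open>The left side is to be the size of the kernel off its centre, the right side a lower
  bound for its mean. Taking n-th roots reduces the claim to M x^M tending to 0 for x < 1.\<close>

lemma exists_fejer_degree:
  assumes "0 \<le> q" "q < (1::real)" "n > 0"
  shows "\<exists>M>0. q ^ M < (1 / (2 * real M)) ^ n"
proof -
  define x where "x = root n q"
  have x: "0 \<le> x" "x < 1" "x ^ n = q" using assms by (auto simp: x_def)
  have "(\<lambda>M. (2 * (real M * x ^ M)) ^ n) \<longlonglongrightarrow> (2 * 0) ^ n"
    using x powser_times_n_limit_0[of x] by (intro tendsto_intros) auto
  then have "(\<lambda>M. (2 * (real M * x ^ M)) ^ n) \<longlonglongrightarrow> 0" using assms by (simp add: power_0_left)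
  then have "eventually (\<lambda>M. (2 * (real M * x ^ M)) ^ n < 1) sequentially"
    by (rule order_tendstoD) simp
  then have "eventually (\<lambda>M. (2 * (real M * x ^ M)) ^ n < 1 \<and> M > 0) sequentially"
    using eventually_gt_at_top[of 0] by (rule eventually_conj)
  then obtain M where M: "(2 * (real M * x ^ M)) ^ n < 1" "M > 0"
    using eventually_happens[of _ sequentially] by auto
  have "(2 * (real M * x ^ M)) ^ n = (2 * real M) ^ n * q ^ M"
    by (simp add: power_mult_distrib x(3)[symmetric] power_mult[symmetric] mult.commute mult.assoc)
  then have "(2 * real M) ^ n * q ^ M < 1" using M by simp
  then have "q ^ M < 1 / (2 * real M) ^ n" using M by (simp add: pos_less_divide_eq mult.commute)
  then show ?thesis using M by (intro exI[of _ M]) (simp add: power_divide)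
qed

text \<open>If the orbit missed U, the kernel centred at u0 would be at most q^M on all images of
  the arc. On a suitable subarc its Cesaro means tend to the constant coefficient, which is at least
  (1 / (2 M))^n and hence larger.\<close>

theorem arc_orbit_dense:
  fixes A :: "real^('n::finite)^'n"
  assumes hyp: "hyperbolic_toral_automorphism A f"
    and V: "C2_unit_vector_field V"
    and coinc: "\<And>G W. toral_subgroup G \<Longrightarrow> G \<noteq> UNIV \<Longrightarrow> (\<exists>k\<ge>1. (f ^^ k) ` G = G) \<Longrightarrow>
           subspace W \<Longrightarrow> to_torus ` W = G \<Longrightarrow>
           \<not> tangential_coincidence V (linear_foliation (span (W \<union> stable_subspace A)))"
    and c: "\<And>t. (c has_vector_derivative V (to_torus (c t))) (at t)"
    and ab: "\<alpha> < \<beta>" and U: "open U" "U \<noteq> {}"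
  shows "\<exists>k. \<exists>t\<in>{\<alpha>..\<beta>}. (f ^^ k) (to_torus (c t)) \<in> U"
proof (rule ccontr)
  assume neg: "\<not> (\<exists>k. \<exists>t\<in>{\<alpha>..\<beta>}. (f ^^ k) (to_torus (c t)) \<in> U)"
  obtain m zs where m: "m \<ge> 1" and zs: "\<And>v. vdiffs (complex_op A ^^ m) zs v = 0"
    "\<And>z. z \<in> set zs \<Longrightarrow> cmod z \<noteq> 1"
    "\<And>z w q. z \<in> set zs \<Longrightarrow> w \<in> set zs \<Longrightarrow> q \<ge> (1::nat) \<Longrightarrow> z ^ q = w ^ q \<Longrightarrow> z = w"
    using hyperbolic_annihilating_roots[OF hyp] by metis
  define B where "B = ((*v) A) ^^ m"
  have fA: "f (to_torus v) = to_torus (A *v v)" for v using hyp by (auto simp: hyperbolic_toral_automorphism_def)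
  have fB: "to_torus ((B ^^ k) v) = (f ^^ (m * k)) (to_torus v)" for k v
  proof -
    have "to_torus ((((*v) A) ^^ k) v) = (f ^^ k) (to_torus v)" for k v
      by (induction k) (simp_all add: fA[symmetric])
    then show ?thesis unfolding B_def funpow_funpow by simp
  qed
  obtain u0 where u0: "to_torus u0 \<in> U" using U(2) to_torus_surj by (metis all_not_in_conv)
  have "open {v. to_torus v \<in> U}" using U(1) open_torus_iff by blast
  then obtain e where e: "e > 0" "\<And>v. dist v u0 < e \<Longrightarrow> to_torus v \<in> U"
    using u0 unfolding open_dist by blast
  define n where "n = CARD('n)"
  have n: "n > 0" by (simp add: n_def)
  \<comment> \<open>If all n coordinates are closer than r, the sum of their absolute values, and so
    the distance, is below e; the bound 1/2 is the one \<open>fejer_small\<close> asks for.\<close>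
  define r where "r = min (1/2) (e / real n)"
  have r: "0 < r" "r \<le> 1/2" "real n * r \<le> e" using e n by (auto simp: r_def min_def field_simps)
  define q where "q = (1 + cos (2 * pi * r)) / 2"
  have q: "0 \<le> q" "q < 1"
  proof -
    have "cos (2 * pi * r) < cos 0" using r by (intro cos_monotone_0_pi) auto
    then show "q < 1" by (simp add: q_def)
    show "0 \<le> q" unfolding q_def by (rule half_one_plus_cos)
  qed
  obtain M where M: "M > 0" "q ^ M < (1 / (2 * real M)) ^ n" using exists_fejer_degree[OF q n] by blast
  have small: "fejer M ((B ^^ k) (c t) - u0) \<le> q ^ M" if t: "t \<in> {\<alpha>..\<beta>}" for k t
    unfolding q_def
  proof (rule fejer_small[OF r(1,2)])
    fix z :: "real^'n" assume z: "\<forall>i. z $ i \<in> \<int>"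
    show "\<exists>i. \<bar>((B ^^ k) (c t) - u0) $ i - z $ i\<bar> \<ge> r"
    proof (rule ccontr)
      assume "\<not> (\<exists>i. \<bar>((B ^^ k) (c t) - u0) $ i - z $ i\<bar> \<ge> r)"
      then have l: "\<bar>((B ^^ k) (c t) - z - u0) $ i\<bar> < r" for i by (simp add: not_le algebra_simps)
      have "norm ((B ^^ k) (c t) - z - u0) \<le> (\<Sum>i\<in>UNIV. \<bar>((B ^^ k) (c t) - z - u0) $ i\<bar>)"
        by (rule norm_le_l1_cart)
      also have "\<dots> < (\<Sum>i\<in>(UNIV::'n set). r)" by (intro sum_strict_mono l) auto
      also have "\<dots> = real n * r" by (simp add: n_def)
      finally have "to_torus ((B ^^ k) (c t) - z) \<in> U" using r(3) by (intro e(2)) (simp add: dist_norm)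
      moreover have "to_torus ((B ^^ k) (c t) + (- z)) = to_torus ((B ^^ k) (c t))"
        using z by (intro to_torus_add_int) auto
      ultimately have "(f ^^ (m * k)) (to_torus (c t)) \<in> U" by (simp add: fB)
      then show False using neg t by blast
    qed
  qed
  \<comment> \<open>The index of frequency 0, the only term that survives in the Cesaro
    limit.\<close>
  define g0 where "g0 = (\<lambda>_::'n. M)"
  have g0: "g0 \<in> fejer_index M" by (auto simp: g0_def fejer_index_def PiE_iff extensional_def)
  have nz: "fejer_freq M g \<noteq> 0" if "g \<noteq> g0" for g :: "'n \<Rightarrow> nat"
    using that by (auto simp: fejer_freq_def g0_def vec_eq_iff fun_eq_iff)
  have "\<exists>p q. \<alpha> \<le> p \<and> p < q \<and> q \<le> \<beta> \<and> (\<forall>\<xi>\<in>fejer_freq M ` (fejer_index M - {g0}). equidistributing A m c \<xi> p q)"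
  proof (rule arc_equidistributing_finite[OF _ _ ab])
    show "finite (fejer_freq M ` (fejer_index M - {g0}))" using finite_fejer_index by blast
    fix \<xi> \<alpha> \<beta> assume x: "\<xi> \<in> fejer_freq M ` (fejer_index M - {g0})" and ab: "(\<alpha>::real) < \<beta>"
    have i1: "\<forall>i. \<xi> $ i \<in> \<int>" using x by (auto simp: fejer_freq_def)
    have i2: "\<xi> \<noteq> 0" using x nz by auto
    show "\<exists>p q. \<alpha> \<le> p \<and> p < q \<and> q \<le> \<beta> \<and> equidistributing A m c \<xi> p q"
      by (rule arc_equidistributing_subinterval[OF hyp V _ m zs(1) _ _ c i1 i2 ab]) (fact coinc zs)+
  qed
  then obtain p s where ps: "\<alpha> \<le> p" "p < s" "s \<le> \<beta>"
    and equi: "\<And>g. g \<in> fejer_index M - {g0} \<Longrightarrow> equidistributing A m c (fejer_freq M g) p s" by auto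
  define ph where "ph k t = (B ^^ k) (c t)" for k t
  have contc: "continuous_on UNIV c" using c by (meson has_vector_derivative_continuous continuous_at_imp_continuous_on)
  have contph: "continuous_on S (ph k)" for k S
    unfolding ph_def B_def funpow_funpow
    by (rule linear_continuous_on_compose[OF continuous_on_subset[OF contc] linear_matrix_funpow]) simp
  have intg: "(\<lambda>t. cos (2 * pi * (\<xi> \<bullet> (ph k t - u0)))) integrable_on {p..s}" for \<xi> k
    by (intro integrable_continuous_real continuous_intros contph)
  define I where "I g k = integral {p..s} (\<lambda>t. cos (2 * pi * (fejer_freq M g \<bullet> (ph k t - u0))))" for g k
  have le: "(\<Sum>g\<in>fejer_index M. fejer_coeff M g * I g k) \<le> (s - p) * q ^ M" for k
  proof -
    have "(\<Sum>g\<in>fejer_index M. fejer_coeff M g * I g k) = integral {p..s} (\<lambda>t. fejer M (ph k t - u0))"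
      unfolding fejer_expansion I_def
      by (subst integral_sum) (auto intro!: finite_fejer_index integrable_on_mult_right intg)
    also have "\<dots> \<le> integral {p..s} (\<lambda>t. q ^ M)"
      unfolding fejer_expansion
    proof (rule integral_le)
      show "(\<lambda>t. \<Sum>g\<in>fejer_index M. fejer_coeff M g * cos (2 * pi * (fejer_freq M g \<bullet> (ph k t - u0)))) integrable_on {p..s}"
        by (intro integrable_sum finite_fejer_index integrable_on_mult_right intg)
      show "(\<Sum>g\<in>fejer_index M. fejer_coeff M g * cos (2 * pi * (fejer_freq M g \<bullet> (ph k t - u0)))) \<le> q ^ M"
        if "t \<in> {p..s}" for t
        unfolding fejer_expansion[symmetric] ph_def using that ps by (intro small) auto
    qed auto
    finally show ?thesis using ps by simp
  qed
  have lim: "(\<lambda>N. (\<Sum>k<N. I g k) / real N) \<longlonglongrightarrow> (if g = g0 then s - p else 0)" if g: "g \<in> fejer_index M" for g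
  proof (cases "g = g0")
    case True
    have "fejer_freq M g = 0" by (simp add: True g0_def fejer_freq_def vec_eq_iff)
    then have "I g k = s - p" for k using ps by (simp add: I_def)
    then have "eventually (\<lambda>N. s - p = (\<Sum>k<N. I g k) / real N) sequentially"
      by (intro eventually_mono[OF eventually_gt_at_top[of 0]]) simp
    then show ?thesis using True by (auto intro: Lim_transform_eventually[OF tendsto_const])
  next
    case False
    then have "(\<lambda>N. (\<Sum>k<N. integral {p..s} (\<lambda>t. cos (2 * pi * (fejer_freq M g \<bullet> ph k t) + (- (2 * pi * (fejer_freq M g \<bullet> u0)))))) / real N) \<longlonglongrightarrow> 0"
      using equi[of g, unfolded equidistributing_def, rule_format, of p s "- (2 * pi * (fejer_freq M g \<bullet> u0))"] g ps
      by (simp only: ph_def B_def) simp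
    then show ?thesis using False by (simp add: I_def inner_diff_right right_diff_distrib)
  qed
  have "(\<lambda>N. \<Sum>g\<in>fejer_index M. fejer_coeff M g * ((\<Sum>k<N. I g k) / real N))
      \<longlonglongrightarrow> (\<Sum>g\<in>fejer_index M. fejer_coeff M g * (if g = g0 then s - p else 0))"
    by (intro tendsto_sum tendsto_mult_left lim)
  also have "(\<Sum>g\<in>fejer_index M. fejer_coeff M g * (if g = g0 then s - p else 0)) = fejer_coeff M g0 * (s - p)"
    using g0 by (simp add: if_distrib[of "(*) _"] sum.delta[OF finite_fejer_index] cong: if_cong)
  finally have L: "(\<lambda>N. \<Sum>g\<in>fejer_index M. fejer_coeff M g * ((\<Sum>k<N. I g k) / real N)) \<longlonglongrightarrow> fejer_coeff M g0 * (s - p)" .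
  have "(\<Sum>g\<in>fejer_index M. fejer_coeff M g * ((\<Sum>k<N. I g k) / real N)) \<le> (s - p) * q ^ M" if "N \<ge> 1" for N
  proof -
    have "(\<Sum>g\<in>fejer_index M. fejer_coeff M g * ((\<Sum>k<N. I g k) / real N))
        = (\<Sum>k<N. \<Sum>g\<in>fejer_index M. fejer_coeff M g * I g k) / real N"
      by (subst sum.swap) (simp add: sum_distrib_left sum_divide_distrib)
    also have "\<dots> \<le> (\<Sum>k<N. (s - p) * q ^ M) / real N"
      by (intro divide_right_mono sum_mono le) auto
    finally show ?thesis using that by simp
  qed
  then have "fejer_coeff M g0 * (s - p) \<le> (s - p) * q ^ M"
    by (intro LIMSEQ_le_const2[OF L]) blast
  then have "fejer_coeff M g0 \<le> q ^ M" using ps by (simp add: mult.commute)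
  moreover have "(1 / (2 * real M)) ^ n \<le> fejer_coeff M g0"
  proof -
    have "1 / (2 * real M) \<le> real ((2 * M) choose M) / 4 ^ M"
      using central_binomial_lower_bound[OF M(1)] M(1) by (simp add: field_simps)
    then have "(1 / (2 * real M)) ^ n \<le> (real ((2 * M) choose M) / 4 ^ M) ^ n"
      by (intro power_mono) auto
    then show ?thesis by (simp add: fejer_coeff_def g0_def n_def)
  qed
  ultimately show False using M(2) by linarith
qed

section \<open>Singular stationary measures\<close>

text \<open>The integral of a nonmeasurable function is a lower integral, so that the measurability of the
  transition kernel need not be discussed.\<close>

lemma nn_integral_measurable_minorant:
  fixes F :: "'a \<Rightarrow> ennreal"
  shows "\<exists>g \<in> borel_measurable M. g \<le> F \<and> integral\<^sup>N M g = integral\<^sup>N M F"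
proof -
  define A where "A = {g. simple_function M g \<and> g \<le> F}"
  have "A \<noteq> {}" unfolding A_def by (auto intro!: exI[of _ "\<lambda>_. 0"] simp: le_fun_def)
  then obtain h :: "nat \<Rightarrow> ennreal" where h: "range h \<subseteq> (\<lambda>g. integral\<^sup>S M g) ` A"
    "(SUP g\<in>A. integral\<^sup>S M g) = Sup (range h)"
    using ennreal_SUP_countable_SUP[of A "\<lambda>g. integral\<^sup>S M g"] by blast
  then have "\<forall>i. \<exists>g\<in>A. h i = integral\<^sup>S M g" by blast
  then obtain g where g: "\<And>i. g i \<in> A" "\<And>i. h i = integral\<^sup>S M (g i)" by metis
  define G where "G x = (SUP i. g i x)" for x
  have G: "G \<in> borel_measurable M"
    unfolding G_def using g(1) by (intro borel_measurable_SUP) (auto simp: A_def borel_measurable_simple_function)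
  have GF: "G \<le> F" unfolding G_def le_fun_def using g(1) by (auto simp: A_def le_fun_def intro!: SUP_least)
  have "integral\<^sup>N M F = Sup (range h)" unfolding nn_integral_def using h(2) by (simp add: A_def)
  also have "\<dots> \<le> integral\<^sup>N M G"
  proof (rule SUP_least)
    fix i
    have "h i = integral\<^sup>N M (g i)" using g by (simp add: A_def nn_integral_eq_simple_integral)
    also have "\<dots> \<le> integral\<^sup>N M G" by (intro nn_integral_mono) (auto simp: G_def intro: SUP_upper)
    finally show "h i \<le> integral\<^sup>N M G" .
  qed
  finally have "integral\<^sup>N M G = integral\<^sup>N M F"
    using nn_integral_mono[of M G F] GF by (intro antisym) (auto simp: le_fun_def)
  then show ?thesis using G GF by blast
qed

text \<open>The preimage lies in the Lipschitz image of Z under the left inverse h. It serves both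
  the flow maps and the automorphism.\<close>

lemma null_sets_lborel_vimage_lipschitz:
  fixes g h :: "'a::euclidean_space \<Rightarrow> 'a"
  assumes Z: "Z \<in> null_sets lborel" and gh: "\<And>x. h (g x) = x"
    and lip: "\<And>x y. norm (h x - h y) \<le> K * norm (x - y)"
    and meas: "{x. g x \<in> Z} \<in> sets borel"
  shows "{x. g x \<in> Z} \<in> null_sets lborel"
proof -
  have "negligible Z" using Z by (simp add: negligible_iff_null_sets null_sets_completionI)
  then have "negligible (h ` Z)"
    by (rule negligible_locally_Lipschitz_image[rotated]) (use lip in \<open>auto intro!: exI[of _ UNIV] exI[of _ K]\<close>)
  moreover have "{x. g x \<in> Z} \<subseteq> h ` Z" using gh by (auto simp: image_iff) metis
  ultimately have "negligible {x. g x \<in> Z}" by (rule negligible_subset)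
  then have "emeasure lebesgue {x. g x \<in> Z} = 0" by (simp add: negligible_iff_null_sets null_setsD1)
  then show ?thesis using meas by (simp add: null_sets_def)
qed

section \<open>Arcs in the time parameter and their uniform distributions\<close>

context torus_field
begin

lemma flow_line_0 [simp]: "flow_line V x 0 = x"
proof -
  obtain v where "to_torus v = x" using to_torus_surj by blast
  then show ?thesis using flow_line_eq[of v] by (auto simp: lift_flow(1))
qed

lemma dist_flow_line_le: "dist (flow_line V x t) x \<le> \<bar>t\<bar>"
  using dist_flow_line[of x t x 0] by simp

lemma continuous_on_flow_line_time: "continuous_on S (flow_line V x)"
proof -
  have "continuous_on S ((\<lambda>(x, t). flow_line V x t) \<circ> (\<lambda>t. (x, t)))"
    by (intro continuous_on_compose continuous_intros continuous_on_flow_line)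
  then show ?thesis by (simp add: o_def)
qed

lemma measurable_flow_line [measurable]: "flow_line V x \<in> borel_measurable borel"
  by (rule borel_measurable_continuous_onI) (rule continuous_on_flow_line_time)

lemma closed_arc_times: "closed (arc_times V \<epsilon> x)"
proof -
  have "closed {t. dist (flow_line V x t) x \<le> \<epsilon>}"
    by (intro closed_Collect_le continuous_intros continuous_on_flow_line_time)
  then show ?thesis unfolding arc_times_def by (rule closed_connected_component)
qed

lemma small_arc_times: "\<epsilon> > 0 \<Longrightarrow> {-\<epsilon>..\<epsilon>} \<subseteq> arc_times V \<epsilon> x"
  unfolding arc_times_def
  by (rule connected_component_maximal) (auto intro!: order_trans[OF dist_flow_line_le] simp: abs_le_iff)

definition proper_times :: "real \<Rightarrow> 'n torus \<Rightarrow> real set" where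
  "proper_times \<epsilon> x = {t \<in> arc_times V \<epsilon> x.
     \<forall>s \<in> arc_times V \<epsilon> x. flow_line V x s = flow_line V x t \<longrightarrow> \<bar>t\<bar> \<le> \<bar>s\<bar>}"

text \<open>A time fails to be proper if a strictly smaller one reaches the same point. With the
  time bounded by n and the gap at least 1 / (n + 1), these failures become projections of compact
  sets.\<close>

lemma borel_proper_times: "proper_times \<epsilon> x \<in> sets borel"
proof -
  define C where "C n = {p :: real \<times> real. fst p \<in> arc_times V \<epsilon> x \<and> snd p \<in> arc_times V \<epsilon> x \<and>
    flow_line V x (snd p) = flow_line V x (fst p) \<and> \<bar>snd p\<bar> \<le> \<bar>fst p\<bar> - 1 / real (Suc n) \<and> \<bar>fst p\<bar> \<le> real n}" for n
  have "compact (C n)" for n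
  proof -
    have cont: "continuous_on UNIV (\<lambda>p :: real \<times> real. flow_line V x (fst p))"
      "continuous_on UNIV (\<lambda>p :: real \<times> real. flow_line V x (snd p))"
      by (intro continuous_on_compose2[OF continuous_on_flow_line_time[of UNIV]] continuous_intros; simp)+
    have "closed (fst -` arc_times V \<epsilon> x :: (real \<times> real) set)" "closed (snd -` arc_times V \<epsilon> x :: (real \<times> real) set)"
      by (intro closed_vimage closed_arc_times continuous_intros)+
    then have "closed {p :: real \<times> real. fst p \<in> arc_times V \<epsilon> x}" "closed {p :: real \<times> real. snd p \<in> arc_times V \<epsilon> x}"
      by (simp_all add: vimage_def)
    then have "closed (C n)" unfolding C_def
      by (intro closed_Collect_conj closed_Collect_eq closed_Collect_le cont continuous_intros)
    moreover have "C n \<subseteq> {-real n..real n} \<times> {-real n..real n}"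
      by (auto simp: C_def abs_le_iff) (smt (verit) divide_nonneg_nonneg of_nat_0_le_iff)+
    then have "bounded (C n)" by (rule bounded_subset[rotated]) (intro bounded_Times bounded_closed_interval)
    ultimately show ?thesis by (simp add: compact_eq_bounded_closed)
  qed
  then have "compact (fst ` C n)" for n by (intro compact_continuous_image continuous_intros)
  then have "fst ` C n \<in> sets borel" for n by (rule borel_closed[OF compact_imp_closed])
  moreover have "arc_times V \<epsilon> x \<in> sets borel" by (rule borel_closed[OF closed_arc_times])
  moreover have "proper_times \<epsilon> x = arc_times V \<epsilon> x - (\<Union>n. fst ` C n)"
  proof (intro set_eqI iffI)
    fix t assume t: "t \<in> proper_times \<epsilon> x"
    have "t \<notin> fst ` C n" for n
    proof
      assume "t \<in> fst ` C n"
      then obtain s where s: "s \<in> arc_times V \<epsilon> x" "flow_line V x s = flow_line V x t" "\<bar>s\<bar> \<le> \<bar>t\<bar> - 1 / real (Suc n)"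
        by (auto simp: C_def)
      have "1 / real (Suc n) > 0" by simp
      moreover have "\<bar>t\<bar> \<le> \<bar>s\<bar>" using t s unfolding proper_times_def by blast
      ultimately show False using s(3) by linarith
    qed
    then show "t \<in> arc_times V \<epsilon> x - (\<Union>n. fst ` C n)" using t by (auto simp: proper_times_def)
  next
    fix t assume t: "t \<in> arc_times V \<epsilon> x - (\<Union>n. fst ` C n)"
    have "\<bar>t\<bar> \<le> \<bar>s\<bar>" if s: "s \<in> arc_times V \<epsilon> x" "flow_line V x s = flow_line V x t" for s
    proof (rule ccontr)
      assume "\<not> \<bar>t\<bar> \<le> \<bar>s\<bar>"
      then have "0 < \<bar>t\<bar> - \<bar>s\<bar>" by simp
      then obtain n1 where n1: "1 / real (Suc n1) < \<bar>t\<bar> - \<bar>s\<bar>" using nat_approx_posE by blast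
      obtain n2 :: nat where n2: "\<bar>t\<bar> \<le> real n2" using real_arch_simple by blast
      define n where "n = max n1 n2"
      have "1 / real (Suc n) \<le> 1 / real (Suc n1)" by (intro divide_left_mono) (auto simp: n_def)
      moreover have "\<bar>t\<bar> \<le> real n" using n2 by (simp add: n_def)
      ultimately have "(t, s) \<in> C n" using s t n1 by (auto simp: C_def)
      then have "t \<in> fst ` C n" by force
      then show False using t by blast
    qed
    then show "t \<in> proper_times \<epsilon> x" using t by (auto simp: proper_times_def)
  qed
  ultimately show ?thesis by auto
qed

text \<open>Two times below this radius have lifts at distance less than 1, so points equal on the
  torus have equal lifts. But the field turns by at most L r < 1 in this range, so a lift moves on
  from its position and cannot return.\<close>

lemma flow_line_inj_small:
  assumes "flow_line V x s = flow_line V x t" "\<bar>s\<bar> < 1 / (2 * (L + 1))" "\<bar>t\<bar> < 1 / (2 * (L + 1))"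
  shows "s = t"
proof (rule ccontr)
  assume "s \<noteq> t"
  define r where "r = 1 / (2 * (L + 1))"
  have r: "r > 0" "2 * r < 1" "L * r < 1" using L_pos by (auto simp: r_def field_simps)
  obtain v where v: "to_torus v = x" using to_torus_surj by blast
  have "to_torus (lift_flow v s) = to_torus (lift_flow v t)"
    using assms(1) unfolding v[symmetric] flow_line_eq .
  then have int: "(lift_flow v s - lift_flow v t) $ i \<in> \<int>" for i by (simp add: to_torus_eq_iff)
  have "\<bar>s - t\<bar> < 1" using assms(2,3) r(2) unfolding r_def[symmetric] by linarith
  then have "norm (lift_flow v s - lift_flow v t) < 1" using lift_flow_speed[of v s t] by linarith
  then have "\<bar>(lift_flow v s - lift_flow v t) $ i\<bar> < 1" for i
    using component_le_norm_cart[of "lift_flow v s - lift_flow v t" i] by linarith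
  then have "(lift_flow v s - lift_flow v t) $ i = 0" for i
    using Ints_nonzero_abs_less1[OF int] by blast
  then have eq: "lift_flow v s - lift_flow v t = 0" by (simp add: vec_eq_iff)
  have "norm (lift_flow v s - lift_flow v t - (s - t) *\<^sub>R V x) \<le> L * r * \<bar>s - t\<bar>"
  proof (rule lift_flow_almost_straight)
    fix \<tau> assume \<tau>: "\<bar>\<tau>\<bar> < r"
    have "norm (V (to_torus (lift_flow v \<tau>)) - V (to_torus v)) \<le> L * norm (lift_flow v \<tau> - v)" by (rule lipschitz)
    also have "\<dots> \<le> L * r"
      using lift_flow_speed[of v \<tau> 0] \<tau> L_pos by (intro mult_left_mono) (auto simp: lift_flow(1))
    finally show "norm (V (to_torus (lift_flow v \<tau>)) - V x) \<le> L * r" by (simp add: v)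
  qed (use assms in \<open>auto simp: r_def\<close>)
  then have "1 * \<bar>s - t\<bar> \<le> L * r * \<bar>s - t\<bar>" by (simp add: eq norm_V)
  then show False using r(3) \<open>s \<noteq> t\<close> by (simp add: mult_le_cancel_right)
qed

text \<open>A radius independent of the base point within which all times are
  \<open>proper_times\<close>; only this part of an arc is used in what follows.\<close>

definition time_radius :: "real \<Rightarrow> real" where
  "time_radius \<epsilon> = min \<epsilon> (1 / (2 * (L + 1)))"

lemma time_radius_pos: "\<epsilon> > 0 \<Longrightarrow> time_radius \<epsilon> > 0"
  using L_pos by (simp add: time_radius_def)

lemma small_proper_times:
  assumes "\<epsilon> > 0"
  shows "{-time_radius \<epsilon><..<time_radius \<epsilon>} \<subseteq> proper_times \<epsilon> x"
proof
  fix t assume t: "t \<in> {-time_radius \<epsilon><..<time_radius \<epsilon>}"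
  then have ta: "\<bar>t\<bar> < \<epsilon>" "\<bar>t\<bar> < 1 / (2 * (L + 1))" by (auto simp: time_radius_def abs_less_iff)
  have "\<bar>t\<bar> \<le> \<bar>s\<bar>" if "flow_line V x s = flow_line V x t" for s
  proof (rule ccontr)
    assume "\<not> \<bar>t\<bar> \<le> \<bar>s\<bar>"
    then have "s = t" using flow_line_inj_small[OF that] ta by linarith
    then show False using \<open>\<not> \<bar>t\<bar> \<le> \<bar>s\<bar>\<close> by simp
  qed
  moreover have "t \<in> arc_times V \<epsilon> x" using small_arc_times[OF assms] ta by fastforce
  ultimately show "t \<in> proper_times \<epsilon> x" by (simp add: proper_times_def)
qed

lemma emeasure_proper_times_pos:
  assumes "\<epsilon> > 0"
  shows "emeasure lborel (proper_times \<epsilon> x) > 0"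
proof -
  have "0 < emeasure lborel {-time_radius \<epsilon><..<time_radius \<epsilon>}" using time_radius_pos[OF assms] by simp
  also have "\<dots> \<le> emeasure lborel (proper_times \<epsilon> x)"
    using borel_proper_times by (intro emeasure_mono small_proper_times assms) auto
  finally show ?thesis .
qed

lemma emeasure_uniform_on_arc:
  assumes "N \<in> sets borel"
  shows "emeasure (uniform_on_arc V \<epsilon> x) N
    = emeasure lborel (proper_times \<epsilon> x \<inter> {t. flow_line V x t \<in> N}) / emeasure lborel (proper_times \<epsilon> x)"
proof -
  have "flow_line V x -` N \<in> sets borel"
    using measurable_sets[OF measurable_flow_line assms] by simp
  then have b: "{t. flow_line V x t \<in> N} \<in> sets borel" by (simp add: vimage_def)
  have "emeasure (uniform_on_arc V \<epsilon> x) N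
      = emeasure (uniform_measure lborel (proper_times \<epsilon> x)) (flow_line V x -` N \<inter> space (uniform_measure lborel (proper_times \<epsilon> x)))"
    unfolding uniform_on_arc_def proper_times_def[symmetric]
    using assms by (intro emeasure_distr) auto
  also have "\<dots> = emeasure (uniform_measure lborel (proper_times \<epsilon> x)) {t. flow_line V x t \<in> N}"
    by (simp add: vimage_def)
  also have "\<dots> = emeasure lborel (proper_times \<epsilon> x \<inter> {t. flow_line V x t \<in> N}) / emeasure lborel (proper_times \<epsilon> x)"
    using b borel_proper_times by (intro emeasure_uniform_measure) auto
  finally show ?thesis .
qed

lemma emeasure_uniform_on_arc_le_1:
  assumes "N \<in> sets borel" "\<epsilon> > 0"
  shows "emeasure (uniform_on_arc V \<epsilon> x) N \<le> 1"
proof -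
  have "emeasure (uniform_on_arc V \<epsilon> x) N \<le> emeasure lborel (proper_times \<epsilon> x) / emeasure lborel (proper_times \<epsilon> x)"
    unfolding emeasure_uniform_on_arc[OF assms(1)]
    using borel_proper_times by (intro divide_right_mono_ennreal emeasure_mono) auto
  also have "\<dots> \<le> 1"
    using emeasure_proper_times_pos[OF assms(2), of x]
    by (cases "emeasure lborel (proper_times \<epsilon> x) = \<infinity>") (auto simp: less_top ennreal_divide_self)
  finally show ?thesis .
qed

lemma uniform_on_arc_eq_1_imp:
  assumes N: "N \<in> sets borel" and "\<epsilon> > 0" and 1: "emeasure (uniform_on_arc V \<epsilon> x) N = 1"
  shows "AE t in lborel. \<bar>t\<bar> < time_radius \<epsilon> \<longrightarrow> flow_line V x t \<in> N"
proof -
  define T where "T = proper_times \<epsilon> x"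
  define F where "F = {t. flow_line V x t \<in> N}"
  have T: "T \<in> sets borel" unfolding T_def by (rule borel_proper_times)
  have "flow_line V x -` N \<in> sets borel"
    using measurable_sets[OF measurable_flow_line N] by simp
  then have F: "F \<in> sets borel" by (simp add: F_def vimage_def)
  have Tp: "emeasure lborel T > 0" unfolding T_def by (rule emeasure_proper_times_pos) fact
  have e: "emeasure lborel (T \<inter> F) / emeasure lborel T = 1"
    using 1 unfolding emeasure_uniform_on_arc[OF N] T_def F_def .
  \<comment> \<open>An arc of infinite length would make the quotient 0 instead of 1.\<close>
  have fin: "emeasure lborel T \<noteq> \<infinity>" using e by auto
  then have eq: "emeasure lborel (T \<inter> F) = emeasure lborel T"
    using e Tp by (metis ennreal_divide_times ennreal_mult_divide_eq infinity_ennreal_def mult.commute mult_1 not_gr_zero)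
  have "emeasure lborel (T - T \<inter> F) = emeasure lborel T - emeasure lborel (T \<inter> F)"
    using T F fin eq by (intro emeasure_Diff) auto
  also have "\<dots> = 0" using eq fin by simp
  finally have "T - T \<inter> F \<in> null_sets lborel" using T F by (auto simp: null_sets_def)
  then have "AE t in lborel. t \<notin> T - T \<inter> F" by (rule AE_not_in)
  then show ?thesis
  proof (rule AE_mp, intro AE_I2 impI)
    fix t assume "t \<notin> T - T \<inter> F" "\<bar>t\<bar> < time_radius \<epsilon>"
    moreover then have "t \<in> T" unfolding T_def
      using small_proper_times[OF \<open>\<epsilon> > 0\<close>, of x] by (auto simp: abs_less_iff)
    ultimately show "flow_line V x t \<in> N" by (auto simp: F_def)
  qed
qed

text \<open>For each fixed time the flow map has a Lipschitz inverse, so the preimage of N is null.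
  By Fubini almost every flow line spends no time in N.\<close>

lemma flow_null_set:
  assumes N: "N \<in> null_sets torus_measure"
  shows "{x. emeasure lborel {t. flow_line V x t \<in> N} \<noteq> 0} \<in> null_sets torus_measure"
proof -
  have Nb[measurable]: "N \<in> sets borel" using N by auto
  have m1: "(\<lambda>(x, t). flow_line V x t) \<in> borel_measurable (borel \<Otimes>\<^sub>M borel)"
    unfolding borel_prod by (rule borel_measurable_continuous_onI) (rule continuous_on_flow_line)
  have m2: "(\<lambda>(v, t). lift_flow v t) \<in> borel_measurable (borel \<Otimes>\<^sub>M borel)"
    unfolding borel_prod by (rule borel_measurable_continuous_onI) (rule continuous_on_lift_flow)
  define Q where "Q = {p. flow_line V (fst p) (snd p) \<in> N}"
  have "Q = (\<lambda>(x, t). flow_line V x t) -` N \<inter> space (borel \<Otimes>\<^sub>M borel)"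
    by (auto simp: Q_def space_pair_measure case_prod_beta)
  then have "Q \<in> sets (borel \<Otimes>\<^sub>M borel)" using measurable_sets[OF m1 Nb] by simp
  then have Q: "Q \<in> sets (borel \<Otimes>\<^sub>M lborel)" by (simp cong: sets_pair_measure_cong)
  have "(\<lambda>x. emeasure lborel (Pair x -` Q)) \<in> borel_measurable borel"
    by (rule lborel.measurable_emeasure_Pair[OF Q])
  then have em: "(\<lambda>x. emeasure lborel {t. flow_line V x t \<in> N}) \<in> borel_measurable borel"
    by (simp add: Q_def vimage_def)
  define Z where "Z = {x. emeasure lborel {t. flow_line V x t \<in> N} \<noteq> 0}"
  have Z: "Z \<in> sets borel" unfolding Z_def using em by measurable
  define N' where "N' = {v. to_torus v \<in> N}"
  have N': "N' \<in> null_sets lborel" using null_sets_torus_measure_iff[OF Nb] N by (simp add: N'_def)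
  then have N'b: "N' \<in> sets borel" by auto
  have lt: "{v. lift_flow v t \<in> N'} \<in> null_sets lborel" for t
  proof (rule null_sets_lborel_vimage_lipschitz[where h = "\<lambda>v. lift_flow v (- t)", OF N'])
    show "lift_flow (lift_flow v t) (- t) = v" for v by (rule lift_flow_inverse)
    show "norm (lift_flow v (- t) - lift_flow w (- t)) \<le> exp (L * \<bar>- t\<bar>) * norm (v - w)" for v w
      by (rule lift_flow_lipschitz)
    have "continuous_on UNIV ((\<lambda>(v, t). lift_flow v t) \<circ> (\<lambda>v. (v, t)))"
      by (intro continuous_on_compose continuous_intros continuous_on_lift_flow)
    then have "(\<lambda>v. lift_flow v t) \<in> borel_measurable borel"
      by (intro borel_measurable_continuous_onI) (simp add: o_def)
    from measurable_sets[OF this N'b] show "{v. lift_flow v t \<in> N'} \<in> sets borel" by (simp add: vimage_def)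
  qed
  have pair: "pair_sigma_finite (lborel :: (real^'n) measure) (lborel :: real measure)" ..
  have "(\<lambda>(v, t). lift_flow v t) -` (- N') \<inter> space (borel \<Otimes>\<^sub>M borel) \<in> sets (borel \<Otimes>\<^sub>M borel)"
    by (rule measurable_sets[OF m2]) (use N'b in auto)
  then have "{p \<in> space (lborel \<Otimes>\<^sub>M lborel). lift_flow (fst p) (snd p) \<notin> N'} \<in> sets (lborel \<Otimes>\<^sub>M lborel)"
    by (simp add: vimage_def case_prod_beta space_pair_measure cong: sets_pair_measure_cong)
  then have "(AE v in lborel. AE t in lborel. lift_flow v t \<notin> N') = (AE t in lborel. AE v in lborel. lift_flow v t \<notin> N')"
    by (rule pair_sigma_finite.AE_commute[OF pair])
  moreover have "AE t in lborel. AE v in lborel. lift_flow v t \<notin> N'"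
    using AE_not_in[OF lt] by simp
  ultimately have "AE v in lborel. AE t in lborel. lift_flow v t \<notin> N'" by simp
  then have ae: "AE v in lborel. to_torus v \<notin> Z"
  proof (rule AE_mp, intro AE_I2 impI)
    fix v assume "AE t in lborel. lift_flow v t \<notin> N'"
    then have "AE t in lborel. \<not> flow_line V (to_torus v) t \<in> N" by (simp add: N'_def flow_line_eq)
    moreover have "{t. flow_line V (to_torus v) t \<in> N} \<in> sets lborel"
      using measurable_sets[OF measurable_flow_line Nb] by (simp add: vimage_def)
    ultimately have "emeasure lborel {t. flow_line V (to_torus v) t \<in> N} = 0"
      using AE_iff_measurable[of "{t. flow_line V (to_torus v) t \<in> N}" lborel "\<lambda>t. flow_line V (to_torus v) t \<notin> N"] by simp
    then show "to_torus v \<notin> Z" by (simp add: Z_def)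
  qed
  have "{v. to_torus v \<in> Z} \<in> sets lborel" using Z by measurable
  then have "{v. to_torus v \<in> Z} \<in> null_sets lborel"
    using ae AE_iff_measurable[of "{v. to_torus v \<in> Z}" lborel "\<lambda>v. to_torus v \<notin> Z"] by (auto simp: null_sets_def)
  then show ?thesis using null_sets_torus_measure_iff[OF Z] by (simp add: Z_def)
qed

end

lemma hyperbolic_continuous:
  fixes A :: "real^('n::finite)^'n"
  assumes hyp: "hyperbolic_toral_automorphism A f"
  shows "continuous_on UNIV f"
proof -
  have fA: "f (to_torus v) = to_torus (A *v v)" for v using hyp by (auto simp: hyperbolic_toral_automorphism_def)
  have contA: "continuous_on UNIV ((*v) A)" by (intro linear_continuous_on linear_conv_bounded_linear[THEN iffD1]) simp
  show ?thesis
  proof (subst continuous_on_open_vimage, simp, intro allI impI)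
    fix B :: "'n torus set" assume "open B"
    then have "open {v. to_torus v \<in> B}" by (simp add: open_torus_iff[symmetric])
    then have "open ((*v) A -` {v. to_torus v \<in> B})" by (rule open_vimage[OF _ contA])
    then show "open (f -` B \<inter> UNIV)" unfolding open_torus_iff[of "f -` B \<inter> UNIV"] by (simp add: fA vimage_def)
  qed
qed

lemma hyperbolic_vimage_null_set:
  fixes A :: "real^('n::finite)^'n"
  assumes hyp: "hyperbolic_toral_automorphism A f" and Z: "Z \<in> null_sets torus_measure"
  shows "{x. f x \<in> Z} \<in> null_sets torus_measure"
proof -
  have fA: "f (to_torus v) = to_torus (A *v v)" for v using hyp by (auto simp: hyperbolic_toral_automorphism_def)
  have Zb[measurable]: "Z \<in> sets borel" using Z by auto
  have contA: "continuous_on UNIV ((*v) A)" by (intro linear_continuous_on linear_conv_bounded_linear[THEN iffD1]) simp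
  have contf: "continuous_on UNIV f" by (rule hyperbolic_continuous[OF hyp])
  have "f \<in> borel_measurable borel" by (rule borel_measurable_continuous_onI[OF contf])
  from measurable_sets[OF this Zb] have fZ: "{x. f x \<in> Z} \<in> sets borel" by (simp add: vimage_def)
  define Z' where "Z' = {v. to_torus v \<in> Z}"
  have Z': "Z' \<in> null_sets lborel" using null_sets_torus_measure_iff[OF Zb] Z by (simp add: Z'_def)
  have "det A \<noteq> 0" using hyp by (auto simp: hyperbolic_toral_automorphism_def)
  then have "invertible A" by (simp add: invertible_det_nz)
  then obtain B where B: "B ** A = mat 1" by (auto simp: invertible_def)
  obtain K where K: "\<And>v. norm (B *v v) \<le> K * norm v"
    using linear_bounded[of "(*v) B"] by auto
  have "{v. A *v v \<in> Z'} \<in> null_sets lborel"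
  proof (rule null_sets_lborel_vimage_lipschitz[where h = "(*v) B", OF Z'])
    show "B *v (A *v v) = v" for v by (simp add: matrix_vector_mul_assoc B)
    show "norm (B *v v - B *v w) \<le> K * norm (v - w)" for v w
      using K[of "v - w"] by (simp add: matrix_vector_mult_diff_distrib)
    have "(*v) A \<in> borel_measurable borel" by (rule borel_measurable_continuous_onI[OF contA])
    moreover have "Z' \<in> sets borel" using Z' by auto
    ultimately show "{v. A *v v \<in> Z'} \<in> sets borel" using measurable_sets by (fastforce simp: vimage_def)
  qed
  then show ?thesis using null_sets_torus_measure_iff[OF fZ] by (simp add: fA Z'_def)
qed

text \<open>Let N be a null set of maximal \<mu>-mass. Outside a null set Z the chain enters N with
  probability 0, and Z - N carries no mass by maximality. Stationarity then says that the mass of N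
  is supplied by N alone, so almost every point of N moves into N with probability 1.\<close>

lemma (in torus_field) singular_invariant_set:
  fixes A :: "real^'n^'n"
  assumes hyp: "hyperbolic_toral_automorphism A f" and \<epsilon>: "\<epsilon> > 0"
    and inv: "invariant_measure (rank1_perturbation f V \<epsilon>) \<mu>"
    and sing: "\<not> absolutely_continuous torus_measure \<mu>"
  shows "\<exists>S\<in>null_sets torus_measure. S \<noteq> {} \<and>
     (\<forall>x\<in>S. AE t in lborel. \<bar>t\<bar> < time_radius \<epsilon> \<longrightarrow> flow_line V (f x) t \<in> S)"
proof -
  define P where "P = rank1_perturbation f V \<epsilon>"
  interpret prob_space \<mu> using inv by (simp add: invariant_measure_def)
  have sm: "sets \<mu> = sets borel" using inv by (simp add: invariant_measure_def)
  have stat: "(\<integral>\<^sup>+ x. emeasure (P x) N \<partial>\<mu>) = emeasure \<mu> N" if "N \<in> sets borel" for N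
    using inv that by (simp add: invariant_measure_def P_def)
  define NN where "NN = (null_sets torus_measure :: 'n torus set set)"
  have NNb: "N \<in> sets borel" if "N \<in> NN" for N using that by (auto simp: NN_def)
  have bdd: "bdd_above (measure \<mu> ` NN)" by (rule bdd_aboveI2[where M = 1]) simp
  define \<alpha> where "\<alpha> = (SUP N\<in>NN. measure \<mu> N)"
  have le\<alpha>: "measure \<mu> N \<le> \<alpha>" if "N \<in> NN" for N
    unfolding \<alpha>_def by (rule cSUP_upper[OF that bdd])
  have "NN \<noteq> {}" by (auto simp: NN_def)
  have "\<exists>N\<in>NN. \<alpha> - 1 / real (Suc i) < measure \<mu> N" for i
    using less_cSUP_iff[OF \<open>NN \<noteq> {}\<close> bdd, of "\<alpha> - 1 / real (Suc i)"] unfolding \<alpha>_def[symmetric] by simp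
  then obtain N where N: "\<And>i. N i \<in> NN" "\<And>i. \<alpha> - 1 / real (Suc i) < measure \<mu> (N i)" by metis
  \<comment> \<open>The supremum is attained, since a countable union of null sets is null.\<close>
  define N0 where "N0 = (\<Union>i. N i)"
  have N0: "N0 \<in> NN" using N(1) unfolding N0_def NN_def by (intro null_sets_UN) auto
  have "\<alpha> \<le> measure \<mu> N0"
  proof (rule field_le_epsilon)
    fix e :: real assume "e > 0"
    then obtain i where i: "1 / real (Suc i) < e" using nat_approx_posE by blast
    have "measure \<mu> (N i) \<le> measure \<mu> N0"
      using NNb[OF N0] by (intro finite_measure_mono) (auto simp: N0_def sm)
    then show "\<alpha> \<le> measure \<mu> N0 + e" using N(2)[of i] i by linarith
  qed
  then have N0\<alpha>: "measure \<mu> N0 = \<alpha>" using le\<alpha>[OF N0] by simp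
  obtain M where M: "M \<in> NN" "M \<notin> null_sets \<mu>"
    using sing unfolding absolutely_continuous_def NN_def by blast
  have "emeasure \<mu> M \<noteq> 0" using M NNb[OF M(1)] by (auto simp: null_sets_def sm)
  then have "measure \<mu> M > 0" by (simp add: emeasure_eq_measure zero_less_measure_iff)
  then have \<alpha>0: "\<alpha> > 0" using le\<alpha>[OF M(1)] by simp
  have step: "\<exists>N'. N' \<subseteq> N \<and> N' \<in> NN \<and> measure \<mu> N' = \<alpha> \<and> (\<forall>x\<in>N'. emeasure (P x) N = 1)"
    if N: "N \<in> NN" "measure \<mu> N = \<alpha>" for N
  proof -
    note Nb = NNb[OF N(1)]
    obtain g where g: "g \<in> borel_measurable \<mu>" "g \<le> (\<lambda>x. emeasure (P x) N)"
      "integral\<^sup>N \<mu> g = emeasure \<mu> N"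
      using nn_integral_measurable_minorant[of \<mu> "\<lambda>x. emeasure (P x) N"] stat[OF Nb] by metis
    have P1: "emeasure (P x) N \<le> 1" for x
      unfolding P_def rank1_perturbation_def by (rule emeasure_uniform_on_arc_le_1[OF Nb \<epsilon>])
    have g1: "g x \<le> 1" for x using g(2) P1[of x] by (auto simp: le_fun_def intro: order_trans)
    define Z where "Z = {x. f x \<in> {x. emeasure lborel {t. flow_line V x t \<in> N} \<noteq> 0}}"
    have Z: "Z \<in> NN"
      unfolding Z_def NN_def using N(1)
      by (intro hyperbolic_vimage_null_set[OF hyp] flow_null_set) (simp add: NN_def)
    have g0: "g x = 0" if "x \<notin> Z" for x
    proof -
      have z: "emeasure lborel {t. flow_line V (f x) t \<in> N} = 0" using that by (simp add: Z_def)
      have "{t. flow_line V (f x) t \<in> N} \<in> sets lborel"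
        using measurable_sets[OF measurable_flow_line Nb] by (simp add: vimage_def)
      then have "emeasure lborel (proper_times \<epsilon> (f x) \<inter> {t. flow_line V (f x) t \<in> N})
          \<le> emeasure lborel {t. flow_line V (f x) t \<in> N}" by (intro emeasure_mono) auto
      then have "emeasure (P x) N = 0"
        unfolding P_def rank1_perturbation_def emeasure_uniform_on_arc[OF Nb] using z by simp
      then show ?thesis using g(2) by (auto simp: le_fun_def) (metis le_zero_eq)
    qed
    have NZ: "N \<union> Z \<in> NN" using N(1) Z unfolding NN_def by (rule null_sets.Un)
    have "measure \<mu> (N \<union> Z) = measure \<mu> N + measure \<mu> (Z - N)"
      using Nb NNb[OF Z] by (subst finite_measure_Union[symmetric]) (auto simp: sm intro: arg_cong[where f = "measure \<mu>"])
    then have "measure \<mu> (Z - N) \<le> 0" using le\<alpha>[OF NZ] N(2) by simp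
    then have "measure \<mu> (Z - N) = 0" by (simp add: measure_le_0_iff)
    then have "Z - N \<in> null_sets \<mu>" using Nb NNb[OF Z] by (auto simp: null_sets_def sm emeasure_eq_measure)
    then have ae: "AE x in \<mu>. x \<notin> Z - N" by (rule AE_not_in)
    have Nm: "N \<in> sets \<mu>" using Nb sm by simp
    have "integral\<^sup>N \<mu> g = (\<integral>\<^sup>+x. g x * indicator N x \<partial>\<mu>)"
    proof (rule nn_integral_cong_AE)
      show "AE x in \<mu>. g x = g x * indicator N x"
        using ae by (rule AE_mp) (auto intro!: AE_I2 simp: indicator_def g0)
    qed
    then have i1: "(\<integral>\<^sup>+x. g x * indicator N x \<partial>\<mu>) = emeasure \<mu> N" using g(3) by simp
    have "(\<integral>\<^sup>+x. (1 - g x) * indicator N x \<partial>\<mu>) + (\<integral>\<^sup>+x. g x * indicator N x \<partial>\<mu>)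
        = (\<integral>\<^sup>+x. (1 - g x) * indicator N x + g x * indicator N x \<partial>\<mu>)"
      using g(1) Nm by (intro nn_integral_add[symmetric]) auto
    also have "\<dots> = (\<integral>\<^sup>+x. indicator N x \<partial>\<mu>)"
      using g1 by (intro nn_integral_cong) (auto simp: indicator_def diff_add_cancel_ennreal)
    also have "\<dots> = emeasure \<mu> N" using Nm by simp
    finally have "emeasure \<mu> N + (\<integral>\<^sup>+x. (1 - g x) * indicator N x \<partial>\<mu>) = emeasure \<mu> N + 0"
      by (simp add: i1 add.commute)
    then have "(\<integral>\<^sup>+x. (1 - g x) * indicator N x \<partial>\<mu>) = 0"
      by (simp only: ennreal_add_left_cancel) (auto simp: emeasure_eq_measure)
    then have "AE x in \<mu>. (1 - g x) * indicator N x = 0"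
      using g(1) Nm by (subst (asm) nn_integral_0_iff_AE) auto
    then obtain Q where Q: "{x \<in> space \<mu>. \<not> (1 - g x) * indicator N x = 0} \<subseteq> Q" "Q \<in> null_sets \<mu>"
      by (auto elim!: AE_E simp: null_sets_def)
    have Qb: "Q \<in> sets borel" using Q(2) sm by auto
    have "emeasure (P x) N = 1" if "x \<in> N - Q" for x
    proof -
      have "x \<in> space \<mu>" using sets_eq_imp_space_eq[OF sm] by simp
      then have "(1 - g x) * indicator N x = 0" using Q(1) that by blast
      then have "1 - g x = 0" using that by simp
      then have "1 \<le> g x" by (simp add: diff_eq_0_iff_ennreal)
      also have "g x \<le> emeasure (P x) N" using g(2) by (simp add: le_fun_def)
      finally show ?thesis using P1[of x] by simp
    qed
    moreover have "N - Q \<in> NN" using N(1) Qb unfolding NN_def by (intro null_set_Diff) auto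
    moreover have "measure \<mu> (N - Q) = \<alpha>" using measure_Diff_null_set[OF Nm Q(2)] N(2) by simp
    ultimately show ?thesis by (intro exI[of _ "N - Q"]) auto
  qed
  \<comment> \<open>Discarding the exceptional points once gives a set that moves into the old set,
    not into itself. The intersection of the whole decreasing sequence is invariant, and it is
    nonempty because the mass stays \<alpha> > 0.\<close>
  have "\<exists>F. \<forall>i. (F i \<in> NN \<and> measure \<mu> (F i) = \<alpha>) \<and> (F (Suc i) \<subseteq> F i \<and> (\<forall>x\<in>F (Suc i). emeasure (P x) (F i) = 1))"
  proof (rule dependent_nat_choice)
    show "\<exists>x. x \<in> NN \<and> measure \<mu> x = \<alpha>" using N0 N0\<alpha> by blast
  next
    fix x :: "'n torus set" and i :: nat assume "x \<in> NN \<and> measure \<mu> x = \<alpha>"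
    then show "\<exists>y. (y \<in> NN \<and> measure \<mu> y = \<alpha>) \<and> y \<subseteq> x \<and> (\<forall>z\<in>y. emeasure (P z) x = 1)"
      using step[of x] by blast
  qed
  then obtain F where F: "\<And>i. F i \<in> NN" "\<And>i. measure \<mu> (F i) = \<alpha>" "\<And>i. F (Suc i) \<subseteq> F i"
    "\<And>i x. x \<in> F (Suc i) \<Longrightarrow> emeasure (P x) (F i) = 1" by blast
  define S where "S = (\<Inter>i. F i)"
  have "(\<lambda>i. measure \<mu> (F i)) \<longlonglongrightarrow> measure \<mu> S"
    unfolding S_def using F(3) NNb[OF F(1)] by (intro finite_Lim_measure_decseq) (auto simp: sm intro: decseq_SucI)
  then have "measure \<mu> S = \<alpha>" using F(2) LIMSEQ_unique[OF _ tendsto_const] by simp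
  then have "S \<noteq> {}" using \<alpha>0 by auto
  moreover have "S \<in> null_sets torus_measure"
  proof (rule null_sets_subset)
    show "F 0 \<in> null_sets torus_measure" using F(1) by (simp add: NN_def)
    show "S \<in> sets torus_measure" unfolding S_def using NNb[OF F(1)] by auto
  qed (auto simp: S_def)
  moreover have "AE t in lborel. \<bar>t\<bar> < time_radius \<epsilon> \<longrightarrow> flow_line V (f x) t \<in> S" if x: "x \<in> S" for x
  proof -
    have "AE t in lborel. \<bar>t\<bar> < time_radius \<epsilon> \<longrightarrow> flow_line V (f x) t \<in> F i" for i
    proof (rule uniform_on_arc_eq_1_imp[OF NNb[OF F(1)] \<epsilon>])
      have "x \<in> F (Suc i)" using x by (auto simp: S_def)
      then show "emeasure (uniform_on_arc V \<epsilon> (f x)) (F i) = 1"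
        using F(4)[of x i] by (simp add: P_def rank1_perturbation_def)
    qed
    then have "AE t in lborel. \<forall>i. \<bar>t\<bar> < time_radius \<epsilon> \<longrightarrow> flow_line V (f x) t \<in> F i"
      unfolding AE_all_countable by (rule allI)
    then show ?thesis by (rule AE_mp) (auto simp: S_def intro!: AE_I2)
  qed
  ultimately show ?thesis by blast
qed

section \<open>Charts filled by reachable points\<close>

context torus_field
begin

text \<open>For small t the flow map is a translation up to a small Lipschitz error. This replaces a
  derivative of the flow with respect to its initial point.\<close>

lemma lift_flow_almost_translation:
  "norm (lift_flow v t - lift_flow w t - (v - w)) \<le> \<bar>t\<bar> * (L * exp (L * \<bar>t\<bar>) * norm (v - w))"
proof -
  define h where "h t = lift_flow v t - lift_flow w t" for t
  define K where "K = L * exp (L * \<bar>t\<bar>) * norm (v - w)"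
  have K: "K \<ge> 0" using L_pos by (simp add: K_def)
  have "norm (h t - h 0) \<le> K * norm (t - 0)"
  proof (rule differentiable_bound[of "{-\<bar>t\<bar>..\<bar>t\<bar>}" h "\<lambda>s a. a *\<^sub>R (V (to_torus (lift_flow v s)) - V (to_torus (lift_flow w s)))"])
    fix s assume s: "s \<in> {-\<bar>t\<bar>..\<bar>t\<bar>}"
    have "(h has_vector_derivative V (to_torus (lift_flow v s)) - V (to_torus (lift_flow w s))) (at s)"
      unfolding h_def by (intro has_vector_derivative_diff lift_flow(2))
    then show "(h has_derivative (\<lambda>a. a *\<^sub>R (V (to_torus (lift_flow v s)) - V (to_torus (lift_flow w s))))) (at s within {-\<bar>t\<bar>..\<bar>t\<bar>})"
      by (simp add: has_vector_derivative_def has_derivative_at_withinI)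
    have "norm (V (to_torus (lift_flow v s)) - V (to_torus (lift_flow w s))) \<le> L * norm (lift_flow v s - lift_flow w s)"
      by (rule lipschitz)
    also have "\<dots> \<le> L * (exp (L * \<bar>s\<bar>) * norm (v - w))"
      using L_pos by (intro mult_left_mono lift_flow_lipschitz) auto
    also have "\<dots> \<le> L * (exp (L * \<bar>t\<bar>) * norm (v - w))"
      using L_pos s by (intro mult_left_mono mult_right_mono) auto
    finally have b: "norm (V (to_torus (lift_flow v s)) - V (to_torus (lift_flow w s))) \<le> K" by (simp add: K_def mult.assoc)
    show "onorm (\<lambda>a. a *\<^sub>R (V (to_torus (lift_flow v s)) - V (to_torus (lift_flow w s)))) \<le> K"
      by (intro onorm_bound K) (simp add: mult.commute[of K] mult_left_mono b)
  qed auto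
  then show ?thesis by (simp add: h_def lift_flow(1) K_def mult.commute)
qed

text \<open>Up to an error \<eta>, a map with strict derivative D and value y at 0 whose values
  project into S almost everywhere. The error is arbitrary but not zero, as S need not contain the
  point of y. Comparing two parameters instead of one with 0 yields injectivity at the end, and
  continuity of G supplies the Borel sets for Fubini.\<close>

definition reachable_chart :: "'n torus set \<Rightarrow> (real^'n \<Rightarrow> real^'n) \<Rightarrow> real^'n \<Rightarrow> bool" where
  "reachable_chart S D y \<longleftrightarrow> (\<forall>\<eta>>0. \<exists>r>0. \<exists>G. continuous_on UNIV G \<and>
     (\<forall>\<tau> \<tau>'. norm \<tau> < r \<longrightarrow> norm \<tau>' < r \<longrightarrow> norm (G \<tau> - G \<tau>' - D (\<tau> - \<tau>')) \<le> \<eta> * norm (\<tau> - \<tau>')) \<and>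
     (\<forall>\<tau>. norm \<tau> < r \<longrightarrow> norm (G \<tau> - y) \<le> \<eta>) \<and>
     (AE \<tau> in lborel. norm \<tau> < r \<longrightarrow> to_torus (G \<tau>) \<in> S))"

text \<open>One step of the chain is made at the time \<open>c + a \<bullet> \<tau>\<close>. For fixed \<open>\<tau>\<close> this is an admissible time
  for almost every \<open>c\<close>; by Fubini some small \<open>c\<close> is good for almost every \<open>\<tau>\<close>, whatever the
  vector \<open>a\<close>.\<close>

lemma reachable_chart_step:
  fixes A :: "real^'n^'n" and a :: "real^'n"
  assumes R: "reachable_chart S D y" and D: "linear D" and S: "S \<in> sets borel"
    and fA: "\<And>v. f (to_torus v) = to_torus (A *v v)"
    and \<delta>: "\<delta> > 0" and inv: "\<And>x. x \<in> S \<Longrightarrow> AE t in lborel. \<bar>t\<bar> < \<delta> \<longrightarrow> flow_line V (f x) t \<in> S"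
  shows "reachable_chart S (\<lambda>\<tau>. A *v D \<tau> + (a \<bullet> \<tau>) *\<^sub>R V (to_torus (A *v y))) (A *v y)"
  unfolding reachable_chart_def
proof (intro allI impI)
  fix \<eta> :: real assume \<eta>: "\<eta> > 0"
  obtain KA where KA: "KA > 0" "\<And>v. norm (A *v v) \<le> KA * norm v"
    using linear_bounded_pos[of "(*v) A"] by auto
  obtain KD where KD: "KD > 0" "\<And>v. norm (D v) \<le> KD * norm v"
    using linear_bounded_pos[OF D] by auto
  define Kl where "Kl = norm a"
  have Kl: "Kl \<ge> 0" "\<And>\<tau>. \<bar>a \<bullet> \<tau>\<bar> \<le> Kl * norm \<tau>" by (auto simp: Kl_def Cauchy_Schwarz_ineq2)
  \<comment> \<open>C - 1 is the total coefficient of the errors in the difference estimate below.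
    Bounding both the time range \<rho> and the old error \<eta>0 by \<eta> / (2 C) therefore leaves
    an error below \<eta>.\<close>
  define C where "C = 1 + L * Kl + L * exp L * (KA * (KD + 1)) + L * KA * Kl + KA"
  have C: "C \<ge> 1" "C \<ge> KA" using L_pos Kl KA KD by (auto simp: C_def)
  define \<rho> where "\<rho> = min (min 1 (\<eta> / (2 * C))) \<delta>"
  define \<eta>0 where "\<eta>0 = min 1 (\<eta> / (2 * C))"
  have \<rho>: "0 < \<rho>" "\<rho> \<le> 1" "\<rho> \<le> \<delta>" "\<rho> \<le> \<eta> / (2 * C)"
    and \<eta>0: "0 < \<eta>0" "\<eta>0 \<le> 1" "\<eta>0 \<le> \<eta> / (2 * C)"
    using \<eta> C \<delta> by (auto simp: \<rho>_def \<eta>0_def)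
  obtain r G where r: "r > 0" and G: "continuous_on UNIV G"
    and Gd: "\<And>\<tau> \<tau>'. norm \<tau> < r \<Longrightarrow> norm \<tau>' < r \<Longrightarrow> norm (G \<tau> - G \<tau>' - D (\<tau> - \<tau>')) \<le> \<eta>0 * norm (\<tau> - \<tau>')"
    and Gy: "\<And>\<tau>. norm \<tau> < r \<Longrightarrow> norm (G \<tau> - y) \<le> \<eta>0"
    and GS: "AE \<tau> in lborel. norm \<tau> < r \<longrightarrow> to_torus (G \<tau>) \<in> S"
    using R \<eta>0(1) unfolding reachable_chart_def by meson
  define H where "H c \<tau> = lift_flow (A *v G \<tau>) (c + a \<bullet> \<tau>)" for c \<tau>
  have contA: "continuous_on UNIV ((*v) A)" by (intro linear_continuous_on linear_conv_bounded_linear[THEN iffD1]) simp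
  have contH2: "continuous_on UNIV (\<lambda>p. H (snd p) (fst p))"
  proof -
    have "continuous_on UNIV (\<lambda>p :: (real^'n) \<times> real. (A *v G (fst p), snd p + a \<bullet> fst p))"
      by (intro continuous_intros continuous_on_compose2[OF contA] continuous_on_compose2[OF G]) auto
    from continuous_on_compose2[OF continuous_on_lift_flow[of UNIV] this] show ?thesis
      by (simp add: H_def)
  qed
  have contH: "continuous_on UNIV (H c)" for c
  proof -
    have "continuous_on UNIV (\<lambda>\<tau> :: real^'n. (\<tau>, c))" by (intro continuous_intros)
    from continuous_on_compose2[OF contH2 this] show ?thesis by simp
  qed
  define good where "good \<tau> c \<longleftrightarrow> (norm \<tau> < r \<and> \<bar>c + a \<bullet> \<tau>\<bar> < \<delta> \<longrightarrow> to_torus (H c \<tau>) \<in> S)" for \<tau> c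
  have "AE \<tau> in lborel. AE c in lborel. good \<tau> c"
  proof (rule eventually_mono[OF GS])
    fix \<tau> :: "real^'n" assume imp: "norm \<tau> < r \<longrightarrow> to_torus (G \<tau>) \<in> S"
    show "AE c in lborel. good \<tau> c"
    proof (cases "norm \<tau> < r")
      case True
      then have "AE t in lborel. \<bar>t\<bar> < \<delta> \<longrightarrow> flow_line V (f (to_torus (G \<tau>))) t \<in> S" using imp by (intro inv) auto
      then obtain Q where Q: "{t. \<not> (\<bar>t\<bar> < \<delta> \<longrightarrow> flow_line V (f (to_torus (G \<tau>))) t \<in> S)} \<subseteq> Q" "Q \<in> null_sets lborel"
        by (auto elim!: AE_E simp: null_sets_def)
      have "{c. c - (- (a \<bullet> \<tau>)) \<in> Q} \<in> null_sets lborel" by (rule null_sets_translation[OF Q(2)])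
      then have "AE c in lborel. c \<notin> {c. c - (- (a \<bullet> \<tau>)) \<in> Q}" by (rule AE_not_in)
      then show ?thesis
      proof (rule AE_mp, intro AE_I2 impI)
        fix c assume "c \<notin> {c. c - (- (a \<bullet> \<tau>)) \<in> Q}"
        then have "c + a \<bullet> \<tau> \<notin> Q" by simp
        then have "\<bar>c + a \<bullet> \<tau>\<bar> < \<delta> \<longrightarrow> flow_line V (f (to_torus (G \<tau>))) (c + a \<bullet> \<tau>) \<in> S" using Q(1) by blast
        then show "good \<tau> c" by (simp add: good_def H_def fA flow_line_eq)
      qed
    qed (simp add: good_def)
  qed
  moreover have "(AE \<tau> in lborel. AE c in lborel. good \<tau> c) = (AE c in lborel. AE \<tau> in lborel. good \<tau> c)"
  proof (rule pair_sigma_finite.AE_commute)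
    show "pair_sigma_finite (lborel :: (real^'n) measure) (lborel :: real measure)" ..
    have m: "(\<lambda>p. to_torus (H (snd p) (fst p))) \<in> borel_measurable (borel :: ((real^'n) \<times> real) measure)"
      by (rule borel_measurable_continuous_onI)
        (rule continuous_on_compose2[OF continuous_on_to_torus[of UNIV] contH2], simp)
    have "{p. to_torus (H (snd p) (fst p)) \<in> S} \<in> sets (borel :: ((real^'n) \<times> real) measure)"
      using measurable_sets[OF m S] by (simp add: vimage_def)
    moreover have "{p :: (real^'n) \<times> real. norm (fst p) < r \<and> \<bar>snd p + a \<bullet> fst p\<bar> < \<delta>} \<in> sets borel"
      by (intro borel_open open_Collect_conj open_Collect_less continuous_intros)
    ultimately have "- {p :: (real^'n) \<times> real. norm (fst p) < r \<and> \<bar>snd p + a \<bullet> fst p\<bar> < \<delta>} \<union> {p. to_torus (H (snd p) (fst p)) \<in> S} \<in> sets borel"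
      by auto
    moreover have "- {p :: (real^'n) \<times> real. norm (fst p) < r \<and> \<bar>snd p + a \<bullet> fst p\<bar> < \<delta>} \<union> {p. to_torus (H (snd p) (fst p)) \<in> S}
      = {p. good (fst p) (snd p)}" by (auto simp: good_def)
    ultimately show "{p \<in> space (lborel \<Otimes>\<^sub>M lborel). good (fst p) (snd p)} \<in> sets (lborel \<Otimes>\<^sub>M lborel)"
      unfolding lborel_prod by simp
  qed
  ultimately have "AE c in lborel. AE \<tau> in lborel. good \<tau> c" by simp
  then obtain Q where Q: "{c. \<not> (AE \<tau> in lborel. good \<tau> c)} \<subseteq> Q" "Q \<in> null_sets lborel"
    by (auto elim!: AE_E simp: null_sets_def)
  have "\<not> {-(\<rho>/2)<..<\<rho>/2} \<subseteq> Q"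
  proof
    assume "{-(\<rho>/2)<..<\<rho>/2} \<subseteq> Q"
    then have "emeasure lborel {-(\<rho>/2)<..<\<rho>/2} \<le> emeasure lborel Q" using Q(2) by (intro emeasure_mono) auto
    then show False using Q(2) \<rho>(1) by (simp add: null_setsD1)
  qed
  then obtain c where c: "\<bar>c\<bar> < \<rho> / 2" "AE \<tau> in lborel. good \<tau> c" using Q(1) by (force simp: abs_less_iff)
  \<comment> \<open>On this ball the linear part a \<bullet> \<tau> stays below \<rho> / 2, the
    bound already met by c; the sum is an admissible time.\<close>
  define r' where "r' = min r (\<rho> / (2 * (Kl + 1)))"
  have r': "r' > 0" "r' \<le> r" using r \<rho> Kl by (auto simp: r'_def)
  have time: "\<bar>c + a \<bullet> \<tau>\<bar> < \<rho>" if "norm \<tau> < r'" for \<tau>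
  proof -
    have "\<bar>a \<bullet> \<tau>\<bar> \<le> Kl * norm \<tau>" by (rule Kl)
    also have "\<dots> \<le> (Kl + 1) * (\<rho> / (2 * (Kl + 1)))" using that Kl by (intro mult_mono) (auto simp: r'_def)
    also have "\<dots> = \<rho> / 2"
    proof -
      have "k * (\<rho> / (2 * k)) = \<rho> / 2" if "k > 0" for k using that by (simp add: field_simps)
      from this[of "Kl + 1"] show ?thesis using Kl(1) by (simp only: add_nonneg_pos zero_less_one)
    qed
    finally show ?thesis using c(1) by linarith
  qed
  have GA: "norm (A *v G \<tau> - A *v y) \<le> KA * \<eta>0" if "norm \<tau> < r'" for \<tau>
  proof -
    have "norm (A *v G \<tau> - A *v y) \<le> KA * norm (G \<tau> - y)"
      using KA(2)[of "G \<tau> - y"] by (simp add: matrix_vector_mult_diff_distrib)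
    also have "\<dots> \<le> KA * \<eta>0" using that r' KA Gy by (intro mult_left_mono) auto
    finally show ?thesis .
  qed
  show "\<exists>r>0. \<exists>G. continuous_on UNIV G \<and>
     (\<forall>\<tau> \<tau>'. norm \<tau> < r \<longrightarrow> norm \<tau>' < r \<longrightarrow> norm (G \<tau> - G \<tau>' - (A *v D (\<tau> - \<tau>') + (a \<bullet> (\<tau> - \<tau>')) *\<^sub>R V (to_torus (A *v y)))) \<le> \<eta> * norm (\<tau> - \<tau>')) \<and>
     (\<forall>\<tau>. norm \<tau> < r \<longrightarrow> norm (G \<tau> - A *v y) \<le> \<eta>) \<and>
     (AE \<tau> in lborel. norm \<tau> < r \<longrightarrow> to_torus (G \<tau>) \<in> S)"
  proof (intro exI[of _ r'] conjI exI[of _ "H c"] allI impI contH)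
    show "r' > 0" by (rule r')
    show "AE \<tau> in lborel. norm \<tau> < r' \<longrightarrow> to_torus (H c \<tau>) \<in> S"
      using c(2)
    proof (rule AE_mp, intro AE_I2 impI)
      fix \<tau> assume "good \<tau> c" and t: "norm \<tau> < r'"
      then show "to_torus (H c \<tau>) \<in> S" using time[OF t] r' \<rho>(3) by (simp add: good_def)
    qed
    show "norm (H c \<tau> - A *v y) \<le> \<eta>" if t: "norm \<tau> < r'" for \<tau>
    proof -
      have "norm (H c \<tau> - A *v G \<tau>) \<le> \<rho>"
        using lift_flow_speed[of "A *v G \<tau>" "c + a \<bullet> \<tau>" 0] time[OF t] by (simp add: H_def lift_flow(1))
      then have "norm (H c \<tau> - A *v y) \<le> \<rho> + KA * \<eta>0"
        using GA[OF t] norm_triangle_ineq[of "H c \<tau> - A *v G \<tau>" "A *v G \<tau> - A *v y"] by simp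
      also have "\<dots> \<le> \<eta> / (2 * C) + C * (\<eta> / (2 * C))" using \<rho> \<eta>0 C KA by (intro add_mono mult_mono) auto
      also have "\<dots> \<le> \<eta> / 2 + \<eta> / 2" using C(1) \<eta> by (intro add_mono) (auto simp: field_simps)
      finally show ?thesis by simp
    qed
    fix \<tau> \<tau>' :: "real^'n" assume t: "norm \<tau> < r'" "norm \<tau>' < r'"
    define q q' s s' w e where "q = A *v G \<tau>" and "q' = A *v G \<tau>'" and "s = c + a \<bullet> \<tau>" and "s' = c + a \<bullet> \<tau>'"
      and "w = V (to_torus (A *v y))" and "e = norm (\<tau> - \<tau>')"
    have ss: "\<bar>s\<bar> < \<rho>" "\<bar>s'\<bar> < \<rho>" using time t by (auto simp: s_def s'_def)
    have e0: "e \<ge> 0" by (simp add: e_def)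
    have ds: "s - s' = a \<bullet> (\<tau> - \<tau>')" by (simp add: s_def s'_def inner_diff_right)
    then have dsb: "\<bar>s - s'\<bar> \<le> Kl * e" using Kl by (simp add: e_def)
    have 1: "norm (lift_flow q s - lift_flow q s' - (s - s') *\<^sub>R w) \<le> L * (\<rho> + KA * \<eta>0) * (Kl * e)"
    proof -
      have "norm (lift_flow q s - lift_flow q s' - (s - s') *\<^sub>R w) \<le> L * (\<rho> + KA * \<eta>0) * \<bar>s - s'\<bar>"
      proof (rule lift_flow_almost_straight[OF _ ss])
        fix \<sigma> assume \<sigma>: "\<bar>\<sigma>\<bar> < \<rho>"
        have "norm (lift_flow q \<sigma> - A *v y) \<le> \<rho> + KA * \<eta>0"
          using lift_flow_speed[of q \<sigma> 0] \<sigma> GA[OF t(1)] norm_triangle_ineq[of "lift_flow q \<sigma> - q" "q - A *v y"]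
          by (simp add: lift_flow(1) q_def)
        then have "L * norm (lift_flow q \<sigma> - A *v y) \<le> L * (\<rho> + KA * \<eta>0)" using L_pos by (intro mult_left_mono) auto
        then show "norm (V (to_torus (lift_flow q \<sigma>)) - w) \<le> L * (\<rho> + KA * \<eta>0)"
          unfolding w_def using lipschitz order_trans by blast
      qed
      also have "\<dots> \<le> L * (\<rho> + KA * \<eta>0) * (Kl * e)"
        using dsb L_pos \<rho> KA \<eta>0 by (intro mult_left_mono) auto
      finally show ?thesis .
    qed
    have dG: "norm (G \<tau> - G \<tau>' - D (\<tau> - \<tau>')) \<le> \<eta>0 * e" unfolding e_def using t r' by (intro Gd) auto
    have dq: "norm (q - q') \<le> KA * (KD + 1) * e"
    proof -
      have "norm (G \<tau> - G \<tau>') \<le> norm (G \<tau> - G \<tau>' - D (\<tau> - \<tau>')) + norm (D (\<tau> - \<tau>'))"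
        using norm_triangle_ineq[of "G \<tau> - G \<tau>' - D (\<tau> - \<tau>')" "D (\<tau> - \<tau>')"] by simp
      also have "\<dots> \<le> \<eta>0 * e + KD * e" using dG KD(2) by (intro add_mono) (auto simp: e_def)
      also have "\<dots> \<le> 1 * e + KD * e" using \<eta>0 e0 by (intro add_mono mult_right_mono) auto
      finally have "KA * norm (G \<tau> - G \<tau>') \<le> KA * (1 * e + KD * e)" using KA by (intro mult_left_mono) auto
      moreover have "norm (q - q') \<le> KA * norm (G \<tau> - G \<tau>')"
        using KA(2)[of "G \<tau> - G \<tau>'"] by (simp add: q_def q'_def matrix_vector_mult_diff_distrib)
      ultimately show ?thesis by (simp add: algebra_simps)
    qed
    have 2: "norm (lift_flow q s' - lift_flow q' s' - (q - q')) \<le> \<rho> * (L * exp L * (KA * (KD + 1) * e))"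
    proof -
      have "norm (lift_flow q s' - lift_flow q' s' - (q - q')) \<le> \<bar>s'\<bar> * (L * exp (L * \<bar>s'\<bar>) * norm (q - q'))"
        by (rule lift_flow_almost_translation)
      also have "\<dots> \<le> \<rho> * (L * exp L * (KA * (KD + 1) * e))"
      proof (intro mult_mono)
        show "exp (L * \<bar>s'\<bar>) \<le> exp L" using ss \<rho>(2) L_pos by simp
      qed (use ss \<rho> L_pos dq in auto)
      finally show ?thesis .
    qed
    have 3: "norm (q - q' - A *v D (\<tau> - \<tau>')) \<le> KA * (\<eta>0 * e)"
    proof -
      have "q - q' - A *v D (\<tau> - \<tau>') = A *v (G \<tau> - G \<tau>' - D (\<tau> - \<tau>'))"
        by (simp add: q_def q'_def matrix_vector_mult_diff_distrib)
      then have "norm (q - q' - A *v D (\<tau> - \<tau>')) \<le> KA * norm (G \<tau> - G \<tau>' - D (\<tau> - \<tau>'))" using KA(2) by simp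
      also have "\<dots> \<le> KA * (\<eta>0 * e)" using dG KA by (intro mult_left_mono) auto
      finally show ?thesis .
    qed
    \<comment> \<open>Three errors: the flow against the constant direction w, the time s' map
      against a translation, and the old chart against D.\<close>
    have eq: "H c \<tau> - H c \<tau>' - (A *v D (\<tau> - \<tau>') + (a \<bullet> (\<tau> - \<tau>')) *\<^sub>R w)
       = (lift_flow q s - lift_flow q s' - (s - s') *\<^sub>R w) + (lift_flow q s' - lift_flow q' s' - (q - q'))
          + (q - q' - A *v D (\<tau> - \<tau>'))"
      unfolding ds[symmetric] by (simp add: H_def q_def q'_def s_def s'_def)
    have "norm (H c \<tau> - H c \<tau>' - (A *v D (\<tau> - \<tau>') + (a \<bullet> (\<tau> - \<tau>')) *\<^sub>R w))
       \<le> L * (\<rho> + KA * \<eta>0) * (Kl * e) + \<rho> * (L * exp L * (KA * (KD + 1) * e)) + KA * (\<eta>0 * e)"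
      unfolding eq by (intro norm_triangle_mono 1 2 3)
    also have "\<dots> = (\<rho> * (L * Kl + L * exp L * (KA * (KD + 1))) + \<eta>0 * (L * KA * Kl + KA)) * e"
      by (simp add: algebra_simps)
    also have "\<dots> \<le> (\<eta> / (2 * C) * (L * Kl + L * exp L * (KA * (KD + 1))) + \<eta> / (2 * C) * (L * KA * Kl + KA)) * e"
      using \<rho> \<eta>0 L_pos Kl KA KD e0 by (intro mult_right_mono add_mono) auto
    also have "\<dots> = \<eta> / (2 * C) * (C - 1) * e"
    proof -
      have "C - 1 = (L * Kl + L * exp L * (KA * (KD + 1))) + (L * KA * Kl + KA)" by (simp add: C_def)
      then show ?thesis by (simp only: distrib_left)
    qed
    also have "\<dots> \<le> \<eta> * e"
      using C(1) \<eta> e0 by (intro mult_right_mono) (auto simp: field_simps)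
    finally show "norm (H c \<tau> - H c \<tau>' - (A *v D (\<tau> - \<tau>') + (a \<bullet> (\<tau> - \<tau>')) *\<^sub>R V (to_torus (A *v y)))) \<le> \<eta> * norm (\<tau> - \<tau>')"
      by (simp add: w_def e_def)
  qed
qed

text \<open>With error 1/2 the chart G is injective with a 2-Lipschitz inverse. Pulling back the
  null set S would make almost the whole ball of parameters, hence the ball, null.\<close>

lemma reachable_chart_identity_contradiction:
  assumes R: "reachable_chart S (\<lambda>\<tau>. \<tau>) y" and S: "S \<in> null_sets torus_measure"
  shows False
proof -
  obtain r G where r: "r > 0"
    and Gd: "\<And>\<tau> \<tau>'. norm \<tau> < r \<Longrightarrow> norm \<tau>' < r \<Longrightarrow> norm (G \<tau> - G \<tau>' - (\<tau> - \<tau>')) \<le> 1/2 * norm (\<tau> - \<tau>')"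
    and GS: "AE \<tau> in lborel. norm \<tau> < r \<longrightarrow> to_torus (G \<tau>) \<in> S"
    using R[unfolded reachable_chart_def, rule_format, of "1/2"] by auto
  have low: "norm (\<tau> - \<tau>') \<le> 2 * norm (G \<tau> - G \<tau>')" if "norm \<tau> < r" "norm \<tau>' < r" for \<tau> \<tau>'
    using Gd[OF that] norm_triangle_ineq3[of "\<tau> - \<tau>'" "G \<tau> - G \<tau>'"]
    by (simp add: norm_minus_commute)
  define B where "B = ball (0 :: real^'n) r"
  have inj: "inj_on G B" by (rule inj_onI) (use low in \<open>force simp: B_def\<close>)
  define S' where "S' = {v. to_torus v \<in> S} \<inter> G ` B"
  have Sb: "S \<in> sets borel" using S by auto
  have "{v. to_torus v \<in> S} \<in> null_sets lborel" using null_sets_torus_measure_iff[OF Sb] S by simp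
  then have "negligible {v. to_torus v \<in> S}" by (simp add: negligible_iff_null_sets null_sets_completionI)
  then have n1: "negligible S'" unfolding S'_def by (rule negligible_subset) auto
  define h where "h = inv_into B G"
  have "negligible (h ` S')"
  proof (rule negligible_locally_Lipschitz_image[OF _ n1])
    fix x assume x: "x \<in> S'"
    have "norm (h z - h x) \<le> 2 * norm (z - x)" if "z \<in> S'" for z
    proof -
      have "h z \<in> B" "h x \<in> B" "G (h z) = z" "G (h x) = x"
        using that x by (auto simp: S'_def h_def inv_into_into f_inv_into_f)
      then show ?thesis using low[of "h z" "h x"] by (simp add: B_def)
    qed
    then show "\<exists>T B. open T \<and> x \<in> T \<and> (\<forall>y\<in>S' \<inter> T. norm (h y - h x) \<le> B * norm (y - x))"
      by (intro exI[of _ UNIV] exI[of _ 2]) auto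
  qed simp
  moreover obtain Q where Q: "{\<tau>. \<not> (norm \<tau> < r \<longrightarrow> to_torus (G \<tau>) \<in> S)} \<subseteq> Q" "Q \<in> null_sets lborel"
    using GS by (auto elim!: AE_E simp: null_sets_def)
  have "negligible Q" using Q(2) by (simp add: negligible_iff_null_sets null_sets_completionI)
  moreover have "B \<subseteq> h ` S' \<union> Q"
  proof
    fix \<tau> assume \<tau>: "\<tau> \<in> B"
    show "\<tau> \<in> h ` S' \<union> Q"
    proof (cases "to_torus (G \<tau>) \<in> S")
      case True
      then have "G \<tau> \<in> S'" using \<tau> by (auto simp: S'_def)
      moreover have "h (G \<tau>) = \<tau>" unfolding h_def by (rule inv_into_f_f[OF inj \<tau>])
      ultimately show ?thesis by force
    next
      case False
      then show ?thesis using Q(1) \<tau> by (auto simp: B_def)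
    qed
  qed
  ultimately have "negligible B" by (meson negligible_Un negligible_subset)
  then show False using open_not_negligible[of B] r by (simp add: B_def)
qed

text \<open>Begins with a constant chart at a point of S close to y, with derivative 0. Step j
  contributes the rank one map given by a j and V at the j-th image, which the remaining steps
  transport by A^(k - j); the vectors a j stay free.\<close>

lemma reachable_chart_iterate:
  fixes A :: "real^'n^'n" and a :: "nat \<Rightarrow> real^'n"
  assumes S: "S \<in> sets borel" and dense: "\<And>U. open U \<Longrightarrow> U \<noteq> {} \<Longrightarrow> S \<inter> U \<noteq> {}"
    and fA: "\<And>v. f (to_torus v) = to_torus (A *v v)"
    and \<delta>: "\<delta> > 0" and inv: "\<And>x. x \<in> S \<Longrightarrow> AE t in lborel. \<bar>t\<bar> < \<delta> \<longrightarrow> flow_line V (f x) t \<in> S"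
  shows "reachable_chart S (\<lambda>\<tau>. \<Sum>j\<in>{1..k}. (a j \<bullet> \<tau>) *\<^sub>R (((*v) A) ^^ (k - j)) (V (to_torus ((((*v) A) ^^ j) y))))
     ((((*v) A) ^^ k) y)"
proof (induction k)
  case 0
  show ?case
    unfolding reachable_chart_def
  proof (intro allI impI)
    fix \<eta> :: real assume "\<eta> > 0"
    have "open (to_torus ` ball y \<eta>)" "to_torus ` ball y \<eta> \<noteq> {}"
      using \<open>\<eta> > 0\<close> by (auto intro: open_image_to_torus)
    then obtain v where v: "v \<in> ball y \<eta>" "to_torus v \<in> S" using dense by blast
    then have "norm (v - y) \<le> \<eta>" by (simp add: dist_norm norm_minus_commute)
    then show "\<exists>r>0. \<exists>G. continuous_on UNIV G \<and>
     (\<forall>\<tau> \<tau>'. norm \<tau> < r \<longrightarrow> norm \<tau>' < r \<longrightarrow> norm (G \<tau> - G \<tau>' - (\<Sum>j\<in>{1..0}. (a j \<bullet> (\<tau> - \<tau>')) *\<^sub>R (((*v) A) ^^ (0 - j)) (V (to_torus ((((*v) A) ^^ j) y))))) \<le> \<eta> * norm (\<tau> - \<tau>')) \<and>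
     (\<forall>\<tau>. norm \<tau> < r \<longrightarrow> norm (G \<tau> - (((*v) A) ^^ 0) y) \<le> \<eta>) \<and>
     (AE \<tau> in lborel. norm \<tau> < r \<longrightarrow> to_torus (G \<tau>) \<in> S)"
      using v \<open>\<eta> > 0\<close> by (intro exI[of _ 1] conjI exI[of _ "\<lambda>_. v"]) auto
  qed
next
  case (Suc k)
  define D where "D \<tau> = (\<Sum>j\<in>{1..k}. (a j \<bullet> \<tau>) *\<^sub>R (((*v) A) ^^ (k - j)) (V (to_torus ((((*v) A) ^^ j) y))))" for \<tau>
  have lin: "linear D" unfolding D_def
    by (intro linear_compose_sum ballI linearI) (simp_all add: inner_add_right scaleR_add_left)
  have IH: "reachable_chart S D ((((*v) A) ^^ k) y)" using Suc by (simp add: D_def[abs_def])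
  have "A *v D \<tau> + (a (Suc k) \<bullet> \<tau>) *\<^sub>R V (to_torus (A *v (((*v) A) ^^ k) y))
     = (\<Sum>j\<in>{1..Suc k}. (a j \<bullet> \<tau>) *\<^sub>R (((*v) A) ^^ (Suc k - j)) (V (to_torus ((((*v) A) ^^ j) y))))" for \<tau>
  proof -
    have "A *v D \<tau> = (\<Sum>j\<in>{1..k}. (a j \<bullet> \<tau>) *\<^sub>R (((*v) A) ^^ (Suc k - j)) (V (to_torus ((((*v) A) ^^ j) y))))"
      unfolding D_def by (subst linear_sum[of "(*v) A"])
        (auto simp: matrix_vector_mult_scaleR Suc_diff_le intro!: sum.cong)
    then show ?thesis by simp
  qed
  then show ?case using reachable_chart_step[OF IH lin S fA \<delta> inv, of "a (Suc k)"] by simp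
qed

end

section \<open>Absolute continuity\<close>

lemma span_image_coefficients:
  fixes v :: "'i \<Rightarrow> 'a::real_vector"
  assumes "finite I" "x \<in> span (v ` I)"
  shows "\<exists>c. x = (\<Sum>j\<in>I. c j *\<^sub>R v j)"
proof -
  define R where "R = {x. \<exists>c. x = (\<Sum>j\<in>I. c j *\<^sub>R v j)}"
  have "subspace R"
    unfolding subspace_def
  proof (intro conjI ballI allI)
    show "0 \<in> R" by (auto simp: R_def intro!: exI[of _ "\<lambda>_. 0"])
    show "x + y \<in> R" if xy: "x \<in> R" "y \<in> R" for x y
    proof -
      obtain c where "x = (\<Sum>j\<in>I. c j *\<^sub>R v j)" using xy(1) unfolding R_def by blast
      moreover obtain d where "y = (\<Sum>j\<in>I. d j *\<^sub>R v j)" using xy(2) unfolding R_def by blast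
      ultimately have "x + y = (\<Sum>j\<in>I. (c j + d j) *\<^sub>R v j)" by (simp add: scaleR_add_left sum.distrib)
      then show ?thesis unfolding R_def by (intro CollectI exI[of _ "\<lambda>j. c j + d j"])
    qed
    show "k *\<^sub>R x \<in> R" if x: "x \<in> R" for k x
    proof -
      obtain c where "x = (\<Sum>j\<in>I. c j *\<^sub>R v j)" using x unfolding R_def by blast
      then have "k *\<^sub>R x = (\<Sum>j\<in>I. (k * c j) *\<^sub>R v j)" by (simp add: scaleR_sum_right)
      then show ?thesis unfolding R_def by (intro CollectI exI[of _ "\<lambda>j. k * c j"])
    qed
  qed
  moreover have "v ` I \<subseteq> R"
  proof
    fix w assume "w \<in> v ` I"
    then obtain i where i: "i \<in> I" "w = v i" by blast
    have "(\<Sum>j\<in>I. (if j = i then 1 else 0) *\<^sub>R v j) = (\<Sum>j\<in>I. if j = i then v i else 0)"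
      by (intro sum.cong) auto
    then have "w = (\<Sum>j\<in>I. (if j = i then 1 else 0) *\<^sub>R v j)" using i assms(1) by simp
    then show "w \<in> R" unfolding R_def by (intro CollectI exI[of _ "\<lambda>j. if j = i then 1 else 0"])
  qed
  ultimately have "span (v ` I) \<subseteq> R" by (intro span_minimal)
  then show ?thesis using assms(2) by (auto simp: R_def)
qed

text \<open>The a j collect the coordinates of the basis vectors in the family. Letting the k times
  depend on \<tau> through them keeps the parameter space of dimension n even if k > n.\<close>

lemma spanning_family_right_inverse:
  fixes v :: "'i \<Rightarrow> real^('n::finite)"
  assumes "finite I" "span (v ` I) = UNIV"
  shows "\<exists>a. \<forall>\<tau>. (\<Sum>j\<in>I. (a j \<bullet> \<tau>) *\<^sub>R v j) = \<tau>"
proof -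
  have "\<exists>c. axis i 1 = (\<Sum>j\<in>I. c j *\<^sub>R v j)" for i :: 'n
    by (rule span_image_coefficients[OF assms(1)]) (simp add: assms(2))
  then obtain c where c: "\<And>i::'n. axis i 1 = (\<Sum>j\<in>I. c i j *\<^sub>R v j)" by metis
  define a where "a j = (\<chi> i. c i j)" for j
  have "(\<Sum>j\<in>I. (a j \<bullet> \<tau>) *\<^sub>R v j) = \<tau>" for \<tau>
  proof -
    have "\<tau> = (\<Sum>i\<in>UNIV. (\<tau> $ i) *\<^sub>R axis i 1)"
      using basis_expansion[of \<tau>] by (simp add: scalar_mult_eq_scaleR)
    also have "\<dots> = (\<Sum>i\<in>UNIV. \<Sum>j\<in>I. (\<tau> $ i * c i j) *\<^sub>R v j)"
      by (subst c) (simp add: scaleR_sum_right)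
    also have "\<dots> = (\<Sum>j\<in>I. \<Sum>i\<in>UNIV. (\<tau> $ i * c i j) *\<^sub>R v j)" by (rule sum.swap)
    also have "\<dots> = (\<Sum>j\<in>I. (a j \<bullet> \<tau>) *\<^sub>R v j)"
      by (simp add: a_def inner_vec_def scaleR_sum_left[symmetric] mult.commute)
    finally show ?thesis by simp
  qed
  then show ?thesis by blast
qed

lemma torus_differential_iterate:
  fixes A :: "real^('n::finite)^'n"
  assumes fA: "\<And>v. f (to_torus v) = to_torus (A *v v)"
  shows "torus_differential (f ^^ p) x = ((*v) A) ^^ p"
proof -
  have m: "(*v) (matrix (((*v) A) ^^ p)) = ((*v) A) ^^ p"
    by (rule matrix_vector_mul(2)[OF linear_matrix_funpow])
  have "(f ^^ p) (to_torus v) = to_torus ((((*v) A) ^^ p) v)" for v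
    by (induction p) (simp_all add: fA)
  then have "(f ^^ p) (to_torus v) = to_torus (matrix (((*v) A) ^^ p) *v v)" for v by (simp only: m)
  then show ?thesis using torus_differential_linear m by metis
qed

context torus_field
begin

text \<open>The time t0 itself may be exceptional, but the times whose k-th image lies in U form a
  nonempty open set, which no null set contains.\<close>

lemma invariant_set_meets_preimage:
  assumes cf: "continuous_on UNIV f" and \<delta>: "\<delta> > 0"
    and inv: "\<And>x. x \<in> S \<Longrightarrow> AE t in lborel. \<bar>t\<bar> < \<delta> \<longrightarrow> flow_line V (f x) t \<in> S"
    and x: "x \<in> S" and t0: "\<bar>t0\<bar> < \<delta>" and U: "open U" "(f ^^ k) (flow_line V (f x) t0) \<in> U"
  shows "\<exists>z\<in>S. (f ^^ k) z \<in> U"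
proof -
  have cfk: "continuous_on UNIV (f ^^ k)"
  proof (induction k)
    case (Suc k)
    then show ?case using continuous_on_compose2[OF cf Suc] by (simp add: o_def)
  qed (simp add: id_def)
  define h where "h t = (f ^^ k) (flow_line V (f x) t)" for t
  have "continuous_on UNIV h"
    unfolding h_def by (rule continuous_on_compose2[OF cfk continuous_on_flow_line_time]) simp
  then have "open (h -` U)" using U(1) by (rule open_vimage[rotated])
  then have "open (h -` U \<inter> {-\<delta><..<\<delta>})" by auto
  moreover have "t0 \<in> h -` U \<inter> {-\<delta><..<\<delta>}" using t0 U(2) by (auto simp: h_def abs_less_iff)
  ultimately have nn: "\<not> negligible (h -` U \<inter> {-\<delta><..<\<delta>})" using open_not_negligible by blast
  obtain Q where Q: "{t. \<not> (\<bar>t\<bar> < \<delta> \<longrightarrow> flow_line V (f x) t \<in> S)} \<subseteq> Q" "Q \<in> null_sets lborel"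
    using inv[OF x] by (auto elim!: AE_E simp: null_sets_def)
  have "negligible Q" using Q(2) by (simp add: negligible_iff_null_sets null_sets_completionI)
  then obtain t where "t \<in> h -` U \<inter> {-\<delta><..<\<delta>}" "t \<notin> Q" using nn negligible_subset by blast
  then have "flow_line V (f x) t \<in> S" "(f ^^ k) (flow_line V (f x) t) \<in> U"
    using Q(1) by (auto simp: h_def abs_less_iff)
  then show ?thesis by blast
qed

text \<open>A step of the chain may stay as close to f z as desired, by times near 0. So a point of
  S whose k-th image is in U is followed by a point of S whose (k - 1)-th image is in U.\<close>

lemma invariant_set_meets_open:
  assumes cf: "continuous_on UNIV f" and \<delta>: "\<delta> > 0"
    and inv: "\<And>x. x \<in> S \<Longrightarrow> AE t in lborel. \<bar>t\<bar> < \<delta> \<longrightarrow> flow_line V (f x) t \<in> S"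
    and U: "open U"
  shows "z \<in> S \<Longrightarrow> (f ^^ k) z \<in> U \<Longrightarrow> S \<inter> U \<noteq> {}"
proof (induction k arbitrary: z)
  case (Suc k)
  have "(f ^^ k) (flow_line V (f z) 0) \<in> U" using Suc.prems(2) flow_line_0[of "f z"] by (simp add: funpow_swap1)
  then obtain z' where "z' \<in> S" "(f ^^ k) z' \<in> U"
    using invariant_set_meets_preimage[OF cf \<delta> inv Suc.prems(1) _ U, of 0 k] \<delta> by auto
  then show ?case by (rule Suc.IH)
qed auto

end

theorem theorem3:
  fixes A :: "real^('n::finite)^'n"
    and f :: "'n torus \<Rightarrow> 'n torus"
    and V :: "'n torus \<Rightarrow> real^'n"
    and \<epsilon> :: real
    and \<mu> :: "'n torus measure"
  assumes "hyperbolic_toral_automorphism A f"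
    and "C2_unit_vector_field V"
    and "\<epsilon> > 0"
    and "\<not> tangential_coincidence V (stable_foliation A)"
    and "\<And>G W. toral_subgroup G \<Longrightarrow> G \<noteq> UNIV \<Longrightarrow> (\<exists>k\<ge>1. (f ^^ k) ` G = G) \<Longrightarrow>
           subspace W \<Longrightarrow> to_torus ` W = G \<Longrightarrow>
           \<not> tangential_coincidence V (linear_foliation (span (W \<union> stable_subspace A)))"
    and "\<exists>x. spanning_time f V \<epsilon> x < \<infinity>"
    and "invariant_measure (rank1_perturbation f V \<epsilon>) \<mu>"
  shows "absolutely_continuous torus_measure \<mu>"
proof (rule ccontr)
  assume sing: "\<not> absolutely_continuous torus_measure \<mu>"
  note hyp = assms(1) and C2 = assms(2) and \<epsilon> = assms(3) and coinc = assms(5)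
  obtain L where "torus_field V L" using C2_unit_vector_field_lipschitz[OF C2] by blast
  then interpret torus_field V L .
  have fA: "f (to_torus v) = to_torus (A *v v)" for v
    using hyp by (auto simp: hyperbolic_toral_automorphism_def)
  note cf = hyperbolic_continuous[OF hyp]
  define \<delta> where "\<delta> = time_radius \<epsilon>"
  have \<delta>: "\<delta> > 0" unfolding \<delta>_def by (rule time_radius_pos[OF \<epsilon>])
  obtain S where S: "S \<in> null_sets torus_measure" "S \<noteq> {}"
    and inv: "\<And>x. x \<in> S \<Longrightarrow> AE t in lborel. \<bar>t\<bar> < \<delta> \<longrightarrow> flow_line V (f x) t \<in> S"
    using singular_invariant_set[OF hyp \<epsilon> assms(7) sing] unfolding \<delta>_def by blast
  have dense: "S \<inter> U \<noteq> {}" if U: "open U" "U \<noteq> {}" for U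
  proof -
    obtain x where x: "x \<in> S" using S(2) by blast
    obtain v where v: "to_torus v = f x" using to_torus_surj by blast
    have "\<exists>k. \<exists>t\<in>{-(\<delta>/2)..\<delta>/2}. (f ^^ k) (to_torus (lift_flow v t)) \<in> U"
      by (rule arc_orbit_dense[OF hyp C2 _ lift_flow(2) _ U]) (fact coinc, use \<delta> in simp)
    then obtain k t where t: "t \<in> {-(\<delta>/2)..\<delta>/2}" "(f ^^ k) (to_torus (lift_flow v t)) \<in> U" by blast
    have "(f ^^ k) (flow_line V (f x) t) \<in> U" using t(2) unfolding v[symmetric] flow_line_eq .
    moreover have "\<bar>t\<bar> < \<delta>" using t(1) \<delta> by auto
    ultimately obtain z where z: "z \<in> S" "(f ^^ k) z \<in> U"
      using invariant_set_meets_preimage[OF cf \<delta> inv x _ U(1)] by blast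
    show ?thesis by (rule invariant_set_meets_open[OF cf \<delta> _ U(1) z]) (rule inv)
  qed
  obtain x where "spanning_time f V \<epsilon> x < \<infinity>" using assms(6) by blast
  then obtain i y where "spanning_time0 f V y + enat i < \<infinity>"
    unfolding spanning_time_def INF_less_iff by blast
  then have "spanning_time0 f V y < \<infinity>" by (cases "spanning_time0 f V y") auto
  then obtain k where k: "k \<ge> 1"
    "span ((\<lambda>j. torus_differential (f ^^ (k - j)) ((f ^^ j) y) (V ((f ^^ j) y))) ` {1..k}) = UNIV"
    unfolding spanning_time0_def INF_less_iff by blast
  obtain y0 where y0: "to_torus y0 = y" using to_torus_surj by blast
  have fk: "(f ^^ j) y = to_torus ((((*v) A) ^^ j) y0)" for j
    unfolding y0[symmetric] by (induction j) (simp_all add: fA)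
  \<comment> \<open>The spanning condition at y0 lets the vectors a j be chosen so that the
    derivative of the chart is the identity.\<close>
  obtain a where a: "\<And>\<tau>. (\<Sum>j\<in>{1..k}. (a j \<bullet> \<tau>) *\<^sub>R (((*v) A) ^^ (k - j)) (V (to_torus ((((*v) A) ^^ j) y0)))) = \<tau>"
    using spanning_family_right_inverse[OF _ k(2)]
    unfolding torus_differential_iterate[OF fA] fk by auto
  have "reachable_chart S (\<lambda>\<tau>. \<Sum>j\<in>{1..k}. (a j \<bullet> \<tau>) *\<^sub>R (((*v) A) ^^ (k - j)) (V (to_torus ((((*v) A) ^^ j) y0))))
     ((((*v) A) ^^ k) y0)"
    by (rule reachable_chart_iterate[OF _ _ fA \<delta>]) (use S(1) dense inv in auto)
  then show False unfolding a using S(1) by (rule reachable_chart_identity_contradiction)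
qed

end
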